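(* Let $A\in\mathbb{A}$, let $Q$ be an open subset of $\mathbb{R}^{N}$, let $1\le p<\infty$, and let $t\in\mathbb{R}^{N}$ be fixed. Let $\varepsilon\to0$ along a sequence such that, for some $r\in\Delta(A)$, $$\delta_{t/\varepsilon}\to r\quad\text{in }\Delta(A)\text{ as }\varepsilon\to0.$$ Let $(u_{\varepsilon})_{\varepsilon}\subset L^{p}(Q)$ be weakly $\Sigma$-convergent in $L^{p}(Q)$ to $u_{0}\in L^{p}(Q;\mathcal{B}_{A}^{p})$, and define $v_{\varepsilon}(x)=u_{\varepsilon}(x+t)$ for $x\in Q-t=\{z-t: z\in Q\}$. Then, as $\varepsilon\to0$, $$v_{\varepsilon}\to v_{0}\quad\text{in }L^{p}(Q-t)\text{-weak }\Sigma,$$ where $v_{0}\in L^{p}(Q-t;\mathcal{B}_{A}^{p})$ is defined by $\widehat{v}_{0}(x,s)=\widehat{u}_{0}(x+t,s+r)$ for $(x,s)\in(Q-t)\times\Delta(A)$.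
   Context: An algebra with mean value on $\mathbb{R}^{N}$ is a closed subalgebra $A$ of the $C^*$-algebra $BUC(\mathbb{R}^{N})$ of bounded uniformly continuous complex functions on $\mathbb{R}^N$ which contains the constants, is closed under complex conjugation, is translation invariant ($u(\cdot+a)\in A$ for all $u\in A$, $a\in\mathbb{R}^{N}$), and such that for each $u\in A$ the functions $x\mapsto u(x/\varepsilon)$ converge, as $\varepsilon\to0$, weakly-$*$ in $L^{\infty}(\mathbb{R}^{N})$ to a constant $M(u)\in\mathbb{C}$ (the mean value of $u$). $\Delta(A)$ is the spectrum of $A$ (nonzero multiplicative linear functionals on $A$, with the weak-$*$ topology; it is compact), and $\mathcal{G}:A\to\mathcal{C}(\Delta(A))$, $\mathcal{G}(u)(s)=\langle s,u\rangle$, is the Gelfand transformation (an isometric $*$-isomorphism). $\delta_{y}\in\Delta(A)$ is the Dirac mass at $y\in\mathbb{R}^{N}$: $\langle\delta_{y},u\rangle=u(y)$. The $M$-measure $\beta$ is the Radon probability measure on $\Delta(A)$ with $M(u)=\int_{\Delta(A)}\mathcal{G}(u)\,d\beta$ for $u\in A$. The class $\mathbb{A}$ consists of the algebras with mean value $A$ that are separable (so $\Delta(A)$ is compact metrizable) and for which $\Delta(A)$ is a topological group, written additively, with $\delta_{x}+\delta_{y}=\delta_{x+y}$ and $\delta_x-\delta_y=\delta_{x-y}$ for all $x,y\in\mathbb{R}^{N}$. For $1\le p<\infty$, $B_{A}^{p}$ is the Besicovitch space, i.e. the closure of $A$ in the seminorm $\|u\|_{p}=\big(\limsup_{R\to\infty}\frac{1}{|B_{R}|}\int_{B_{R}}|u(y)|^{p}dy\big)^{1/p}$,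 with $B_R$ the open ball of radius $R$. The map $\mathcal{G}$ extends by continuity to $\mathcal{G}:B_{A}^{p}\to L^{p}(\Delta(A))=L^{p}(\Delta(A),\beta)$, and induces an isometric isomorphism $\mathcal{G}_{1}$ of $\mathcal{B}_{A}^{p}=B_{A}^{p}/\mathcal{N}$, $\mathcal{N}=\{u\in B_A^p:\mathcal{G}(u)=0\}$, onto $L^{p}(\Delta(A))$. One writes $\widehat{u}=\mathcal{G}_{1}(u)$ for $u\in\mathcal{B}_{A}^{p}$ and $\widehat u=\mathcal{G}(u)$ for $u\in B_A^p$; for functions of $x$ with values in these spaces, $\widehat{u}(x,\cdot)$ is taken pointwise in $x$. Weak $\Sigma$-convergence: $(u_{\varepsilon})\subset L^{p}(Q)$ ($1\le p<\infty$) weakly $\Sigma$-converges in $L^{p}(Q)$ to $u_{0}\in L^{p}(Q;\mathcal{B}_{A}^{p})$ (written $u_{\varepsilon}\to u_{0}$ in $L^{p}(Q)$-weak $\Sigma$) if, as $\varepsilon\to0$, for all $\psi\in L^{p'}(Q;A)$ ($1/p'=1-1/p$), $$\int_{Q}u_{\varepsilon}(x)\,\psi\Big(x,\frac{x}{\varepsilon}\Big)dx\to\iint_{Q\times\Delta(A)}\widehat{u}_{0}(x,s)\widehat{\psi}(x,s)\,dx\,d\beta(s).$$ Here $\varepsilon$ ranges over an ordinary sequence of numbers in $(0,1]$ tending to $0$. *)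

theory Defs
  imports "HOL-Probability.Probability_Measure" "HOL-Algebra.Group"
begin

section \<open>Algebras with mean value\<close>

definition BUC :: "('a::euclidean_space \<Rightarrow> complex) set" where
  "BUC = {u. bounded (range u) \<and> uniformly_continuous_on UNIV u}"

text \<open>Weak-* convergence in \<open>L\<^sup>\<infinity>\<close> of \<open>x \<mapsto> u (x / e)\<close> to the constant \<open>m\<close>, tested against
  all of \<open>L\<^sup>1\<close>.\<close>

definition has_mean_value :: "('a::euclidean_space \<Rightarrow> complex) \<Rightarrow> complex \<Rightarrow> bool" where
  "has_mean_value u m \<longleftrightarrow>
     (\<forall>\<phi> :: 'a \<Rightarrow> complex. integrable lebesgue \<phi> \<longrightarrow>
        ((\<lambda>e::real. LINT x|lebesgue. u (x /\<^sub>R e) * \<phi> x) \<longlongrightarrow> m * (LINT x|lebesgue. \<phi> x))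
          (at_right 0))"

definition mean_value :: "('a::euclidean_space \<Rightarrow> complex) \<Rightarrow> complex" where
  "mean_value u = (THE m. has_mean_value u m)"

definition algebra_with_mean_value :: "('a::euclidean_space \<Rightarrow> complex) set \<Rightarrow> bool" where
  "algebra_with_mean_value A \<longleftrightarrow>
     A \<subseteq> BUC \<and>
     (\<forall>c. (\<lambda>_. c) \<in> A) \<and>
     (\<forall>u\<in>A. \<forall>v\<in>A. (\<lambda>x. u x + v x) \<in> A) \<and>
     (\<forall>c. \<forall>u\<in>A. (\<lambda>x. c * u x) \<in> A) \<and>
     (\<forall>u\<in>A. \<forall>v\<in>A. (\<lambda>x. u x * v x) \<in> A) \<and>
     (\<forall>f u. (\<forall>n::nat. f n \<in> A) \<and> uniform_limit UNIV f u sequentially \<longrightarrow> u \<in> A) \<and>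
     (\<forall>u\<in>A. (\<lambda>x. cnj (u x)) \<in> A) \<and>
     (\<forall>u\<in>A. \<forall>a. (\<lambda>x. u (x + a)) \<in> A) \<and>
     (\<forall>u\<in>A. \<exists>m. has_mean_value u m)"

definition sup_norm :: "('a \<Rightarrow> complex) \<Rightarrow> real" where
  "sup_norm u = (SUP x. norm (u x))"

definition sup_dist :: "('a \<Rightarrow> complex) \<Rightarrow> ('a \<Rightarrow> complex) \<Rightarrow> real" where
  "sup_dist u v = sup_norm (\<lambda>x. u x - v x)"

definition separable_algebra :: "('a \<Rightarrow> complex) set \<Rightarrow> bool" where
  "separable_algebra A \<longleftrightarrow>
     (\<exists>D. countable D \<and> D \<subseteq> A \<and> (\<forall>u\<in>A. \<forall>e>0. \<exists>d\<in>D. sup_dist u d < e))"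

section \<open>Spectrum, Gelfand transformation and the class of algebras\<close>

text \<open>Functionals on \<open>A\<close> are functions that are \<open>undefined\<close> outside \<open>A\<close>.  The function type
  carries the product topology, so the topology that the spectrum inherits from its ambient type
  is that of pointwise convergence on \<open>A\<close>, i.e. the weak-* topology.\<close>

type_synonym 'a functional = "('a \<Rightarrow> complex) \<Rightarrow> complex"

definition spectrum :: "('a \<Rightarrow> complex) set \<Rightarrow> 'a functional set" where
  "spectrum A = {s \<in> extensional A.
     (\<forall>u\<in>A. \<forall>v\<in>A. s (\<lambda>x. u x + v x) = s u + s v) \<and>
     (\<forall>c. \<forall>u\<in>A. s (\<lambda>x. c * u x) = c * s u) \<and>
     (\<forall>u\<in>A. \<forall>v\<in>A. s (\<lambda>x. u x * v x) = s u * s v) \<and>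
     (\<exists>u\<in>A. s u \<noteq> 0)}"

definition gelfand :: "('a \<Rightarrow> complex) \<Rightarrow> 'a functional \<Rightarrow> complex" where
  "gelfand u = (\<lambda>s. s u)"

definition dirac :: "('a \<Rightarrow> complex) set \<Rightarrow> 'a \<Rightarrow> 'a functional" where
  "dirac A y = (\<lambda>u\<in>A. u y)"

text \<open>The group law on the spectrum, written additively in the literature, is given by a
  (multiplicatively written) group \<open>G\<close> of the algebra library.\<close>

definition class_AA :: "('a::euclidean_space \<Rightarrow> complex) set \<Rightarrow> 'a functional monoid \<Rightarrow> bool" where
  "class_AA A G \<longleftrightarrow>
     algebra_with_mean_value A \<and> separable_algebra A \<and>
     group G \<and> carrier G = spectrum A \<and>
     continuous_on (spectrum A \<times> spectrum A) (\<lambda>(s, r). s \<otimes>\<^bsub>G\<^esub> r) \<and>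
     continuous_on (spectrum A) (\<lambda>s. inv\<^bsub>G\<^esub> s) \<and>
     (\<forall>x y. dirac A x \<otimes>\<^bsub>G\<^esub> dirac A y = dirac A (x + y)) \<and>
     (\<forall>x y. dirac A x \<otimes>\<^bsub>G\<^esub> (inv\<^bsub>G\<^esub> dirac A y) = dirac A (x - y))"

text \<open>Radon: Borel on the spectrum and inner regular with respect to compact sets.\<close>

definition M_measure :: "('a::euclidean_space \<Rightarrow> complex) set \<Rightarrow> 'a functional measure \<Rightarrow> bool" where
  "M_measure A \<beta> \<longleftrightarrow>
     sets \<beta> = sets (restrict_space borel (spectrum A)) \<and>
     prob_space \<beta> \<and>
     (\<forall>E\<in>sets \<beta>. emeasure \<beta> E = (SUP K\<in>{K. compact K \<and> K \<subseteq> E}. emeasure \<beta> K)) \<and>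
     (\<forall>u\<in>A. mean_value u = (LINT s|\<beta>. gelfand u s))"

section \<open>Lebesgue and Bochner spaces\<close>

text \<open>Elements of Lebesgue spaces are represented by functions, equality of elements being equality
  almost everywhere.\<close>

definition Lp :: "real \<Rightarrow> 'x measure \<Rightarrow> ('x \<Rightarrow> complex) set" where
  "Lp p M = {f \<in> borel_measurable M. integrable M (\<lambda>x. norm (f x) powr p)}"

definition Lp_norm :: "real \<Rightarrow> 'x measure \<Rightarrow> ('x \<Rightarrow> complex) \<Rightarrow> real" where
  "Lp_norm p M f = (LINT x|M. norm (f x) powr p) powr (1 / p)"

text \<open>Bochner spaces of functions with values in a set \<open>V\<close> on which \<open>d\<close> is the metric and \<open>\<nu>\<close> the
  norm; this form allows \<open>V\<close> to be a space of functions or a quotient space.\<close>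

definition strongly_measurable ::
  "'x measure \<Rightarrow> 'v set \<Rightarrow> ('v \<Rightarrow> 'v \<Rightarrow> real) \<Rightarrow> ('x \<Rightarrow> 'v) \<Rightarrow> bool" where
  "strongly_measurable M V d f \<longleftrightarrow>
     (\<exists>\<sigma>. (\<forall>n. simple_function M (\<sigma> n) \<and> \<sigma> n \<in> space M \<rightarrow> V) \<and>
          (AE x in M. (\<lambda>n. d (\<sigma> n x) (f x)) \<longlonglongrightarrow> 0))"

definition bochner_Lp ::
  "real \<Rightarrow> 'x measure \<Rightarrow> 'v set \<Rightarrow> ('v \<Rightarrow> 'v \<Rightarrow> real) \<Rightarrow> ('v \<Rightarrow> real) \<Rightarrow> ('x \<Rightarrow> 'v) set" where
  "bochner_Lp p M V d \<nu> =
     {f. f \<in> space M \<rightarrow> V \<and> strongly_measurable M V d f \<and> integrable M (\<lambda>x. \<nu> (f x) powr p)}"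

definition bochner_Linf ::
  "'x measure \<Rightarrow> 'v set \<Rightarrow> ('v \<Rightarrow> 'v \<Rightarrow> real) \<Rightarrow> ('v \<Rightarrow> real) \<Rightarrow> ('x \<Rightarrow> 'v) set" where
  "bochner_Linf M V d \<nu> =
     {f. f \<in> space M \<rightarrow> V \<and> strongly_measurable M V d f \<and> (\<exists>C. AE x in M. \<nu> (f x) \<le> C)}"

text \<open>\<open>L\<^sup>q(Q; A)\<close> for the exponent \<open>q\<close> conjugate to \<open>p\<close>.\<close>

definition test_space ::
  "real \<Rightarrow> ('a::euclidean_space \<Rightarrow> complex) set \<Rightarrow> 'a set \<Rightarrow> ('a \<Rightarrow> 'a \<Rightarrow> complex) set" where
  "test_space p A Q =
     (if p = 1 then bochner_Linf (lebesgue_on Q) A sup_dist sup_norm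
      else bochner_Lp (p / (p - 1)) (lebesgue_on Q) A sup_dist sup_norm)"

section \<open>Besicovitch spaces\<close>

definition Lp_loc :: "real \<Rightarrow> ('a::euclidean_space \<Rightarrow> complex) set" where
  "Lp_loc p = {u \<in> borel_measurable lebesgue.
     \<forall>K. compact K \<longrightarrow> set_integrable lebesgue K (\<lambda>y. norm (u y) powr p)}"

definition limsup_mean :: "real \<Rightarrow> ('a::euclidean_space \<Rightarrow> complex) \<Rightarrow> ereal" where
  "limsup_mean p u = Limsup at_top (\<lambda>R::real.
     ereal ((LINT y:ball 0 R|lebesgue. norm (u y) powr p) / measure lebesgue (ball (0::'a) R)))"

definition besic_norm :: "real \<Rightarrow> ('a::euclidean_space \<Rightarrow> complex) \<Rightarrow> real" where
  "besic_norm p u = real_of_ereal (limsup_mean p u) powr (1 / p)"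

text \<open>The closure of \<open>A\<close> is taken among the functions of finite seminorm, where
  \<^const>\<open>besic_norm\<close> is not affected by the convention that \<open>\<infinity>\<close> is mapped to \<open>0\<close>.\<close>

definition marcinkiewicz :: "real \<Rightarrow> ('a::euclidean_space \<Rightarrow> complex) set" where
  "marcinkiewicz p = {u \<in> Lp_loc p. limsup_mean p u < \<infinity>}"

definition besicovitch ::
  "real \<Rightarrow> ('a::euclidean_space \<Rightarrow> complex) set \<Rightarrow> ('a \<Rightarrow> complex) set" where
  "besicovitch p A =
     {u \<in> marcinkiewicz p. \<forall>e>0. \<exists>a\<in>A. besic_norm p (\<lambda>y. u y - a y) < e}"

text \<open>The extension by continuity of \<^const>\<open>gelfand\<close> to \<^const>\<open>besicovitch\<close>.  Its value at \<open>u\<close> is an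
  element of \<open>L\<^sup>p(\<beta>)\<close>, here the set of all its representatives.\<close>

definition gelfand_ext ::
  "real \<Rightarrow> ('a::euclidean_space \<Rightarrow> complex) set \<Rightarrow> 'a functional measure
     \<Rightarrow> ('a \<Rightarrow> complex) \<Rightarrow> ('a functional \<Rightarrow> complex) set" where
  "gelfand_ext p A \<beta> u = {f \<in> Lp p \<beta>.
     \<forall>a. (\<forall>n::nat. a n \<in> A) \<and> (\<lambda>n. besic_norm p (\<lambda>y. u y - a n y)) \<longlonglongrightarrow> 0 \<longrightarrow>
         (\<lambda>n. Lp_norm p \<beta> (\<lambda>s. gelfand (a n) s - f s)) \<longlonglongrightarrow> 0}"

definition null_space ::
  "real \<Rightarrow> ('a::euclidean_space \<Rightarrow> complex) set \<Rightarrow> 'a functional measure \<Rightarrow> ('a \<Rightarrow> complex) set" where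
  "null_space p A \<beta> = {u \<in> besicovitch p A. (\<lambda>_. 0) \<in> gelfand_ext p A \<beta> u}"

definition besic_quot ::
  "real \<Rightarrow> ('a::euclidean_space \<Rightarrow> complex) set \<Rightarrow> 'a functional measure
     \<Rightarrow> ('a \<Rightarrow> complex) set set" where
  "besic_quot p A \<beta> = besicovitch p A //
     {(u, v). u \<in> besicovitch p A \<and> v \<in> besicovitch p A \<and> (\<lambda>y. u y - v y) \<in> null_space p A \<beta>}"

definition quot_norm :: "real \<Rightarrow> ('a::euclidean_space \<Rightarrow> complex) set \<Rightarrow> real" where
  "quot_norm p U = (INF u\<in>U. besic_norm p u)"

definition quot_dist ::
  "real \<Rightarrow> ('a::euclidean_space \<Rightarrow> complex) set \<Rightarrow> ('a \<Rightarrow> complex) set \<Rightarrow> real" where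
  "quot_dist p U V = quot_norm p {(\<lambda>y. u y - v y) |u v. u \<in> U \<and> v \<in> V}"

text \<open>The isomorphism of the quotient onto \<open>L\<^sup>p(\<beta>)\<close>; \<^const>\<open>gelfand_ext\<close> is constant on classes, and
  the union is its common value.\<close>

definition gelfand1 ::
  "real \<Rightarrow> ('a::euclidean_space \<Rightarrow> complex) set \<Rightarrow> 'a functional measure
     \<Rightarrow> ('a \<Rightarrow> complex) set \<Rightarrow> ('a functional \<Rightarrow> complex) set" where
  "gelfand1 p A \<beta> U = (\<Union>u\<in>U. gelfand_ext p A \<beta> u)"

definition Lp_besic ::
  "real \<Rightarrow> ('a::euclidean_space \<Rightarrow> complex) set \<Rightarrow> 'a functional measure \<Rightarrow> 'a set
     \<Rightarrow> ('a \<Rightarrow> ('a \<Rightarrow> complex) set) set" where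
  "Lp_besic p A \<beta> Q =
     bochner_Lp p (lebesgue_on Q) (besic_quot p A \<beta>) (quot_dist p) (quot_norm p)"

section \<open>Weak sigma-convergence\<close>

text \<open>To integrate \<open>(x, s) \<mapsto> gelfand1 (u0 x) s\<close> over \<open>Q \<times> spectrum A\<close> one needs a jointly measurable
  representative \<open>F\<close>.  It exists and is unique almost everywhere, because
  \<open>L\<^sup>p(Q; L\<^sup>p(\<beta>)) = L\<^sup>p(Q \<times> spectrum A)\<close>.\<close>

definition represents_hat ::
  "real \<Rightarrow> ('a::euclidean_space \<Rightarrow> complex) set \<Rightarrow> 'a functional measure \<Rightarrow> 'a set
     \<Rightarrow> ('a \<Rightarrow> ('a \<Rightarrow> complex) set) \<Rightarrow> ('a \<times> 'a functional \<Rightarrow> complex) \<Rightarrow> bool" where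
  "represents_hat p A \<beta> Q u0 F \<longleftrightarrow>
     F \<in> Lp p (lebesgue_on Q \<Otimes>\<^sub>M \<beta>) \<and>
     (AE x in lebesgue_on Q. (\<lambda>s. F (x, s)) \<in> gelfand1 p A \<beta> (u0 x))"

definition weak_sigma_conv ::
  "real \<Rightarrow> ('a::euclidean_space \<Rightarrow> complex) set \<Rightarrow> 'a functional measure \<Rightarrow> 'a set \<Rightarrow> (nat \<Rightarrow> real)
     \<Rightarrow> (nat \<Rightarrow> 'a \<Rightarrow> complex) \<Rightarrow> ('a \<Rightarrow> ('a \<Rightarrow> complex) set) \<Rightarrow> bool" where
  "weak_sigma_conv p A \<beta> Q \<epsilon> u u0 \<longleftrightarrow>
     (\<forall>n. u n \<in> Lp p (lebesgue_on Q)) \<and>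
     u0 \<in> Lp_besic p A \<beta> Q \<and>
     (\<exists>F. represents_hat p A \<beta> Q u0 F \<and>
        (\<forall>\<psi>\<in>test_space p A Q.
           (\<lambda>n. LINT x|lebesgue_on Q. u n x * \<psi> x (x /\<^sub>R \<epsilon> n))
             \<longlonglongrightarrow> (LINT (x, s)|(lebesgue_on Q \<Otimes>\<^sub>M \<beta>). F (x, s) * gelfand (\<psi> x) s)))"

end

theory Submission
  imports Defs "HOL-Analysis.Weierstrass_Theorems" "HOL-Analysis.Ball_Volume"
begin

text \<open>
  Write \<open>h\<^sub>n = t / \<epsilon>\<^sub>n\<close>.  The substitution \<open>x \<mapsto> x + t\<close> turns the pairing of \<open>v\<^sub>n\<close> with
  \<open>\<psi> (x, x / \<epsilon>\<^sub>n)\<close> on \<open>Q - t\<close> into the pairing of \<open>u\<^sub>n\<close> with \<open>\<psi> (x - t, x / \<epsilon>\<^sub>n - h\<^sub>n)\<close> on \<open>Q\<close>.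
  For a fixed \<open>a \<in> A\<close> the translates \<open>a (\<cdot> - h\<^sub>n)\<close> converge uniformly, because \<open>\<delta> (h\<^sub>n) \<rightarrow> r\<close> and the group law of
  the compact spectrum is continuous; the limit is the \<open>shift\<close> of \<open>a\<close> by \<open>-r\<close>, that is
  \<open>y \<mapsto> \<langle>\<delta> y - r, a\<rangle>\<close>, and it lies in \<open>A\<close>.  (Here and below the text writes the group law additively.)  So, up to an error, \<open>v\<^sub>n\<close> tests against \<open>\<psi>\<close> as \<open>u\<^sub>n\<close> tests
  against \<open>\<psi>\<^sub>2 (x, \<cdot>)\<close>, the shift of \<open>\<psi> (x - t, \<cdot>)\<close> by \<open>-r\<close>.  This is an admissible test function on \<open>Q\<close>, and the limit
  provided by the hypothesis becomes the desired one after substituting \<open>(x, s) \<mapsto> (x + t, s + r)\<close>, which preserves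
  the product measure as \<open>\<beta>\<close> is invariant under translation by \<open>r\<close>.

  Three points need work.

  \<^item> The Gelfand theory of \<open>A\<close>: characters are bounded by the supremum norm (\<open>character_bound\<close>), Dirac masses are
  dense (\<open>character_approx_dirac\<close>), and the Stone--Weierstrass theorem makes every continuous function on the spectrum
  a Gelfand transform (\<open>gelfand_onto\<close>).  Invariance of \<open>\<beta>\<close> (\<open>distr_right_mult\<close>) follows since translation does not
  change mean values, and since the regular measure \<open>\<beta>\<close> is determined by the integrals of Gelfand transforms.

  \<^item> The error term.  For each \<open>x\<close> it tends to \<open>0\<close>, with only an integrable bound, while \<open>u\<^sub>n\<close> converges only weakly.
  The pairing still tends to \<open>0\<close> (\<open>null_oscillation_integral\<close>): after multiplication by the bound, \<open>u\<^sub>n\<close> converges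
  weakly against all bounded functions, and a gliding hump argument (\<open>gliding_hump\<close>) shows that such a sequence
  pairs to \<open>0\<close> with bounded sequences that tend to \<open>0\<close> almost everywhere.  This treats \<open>p = 1\<close> and \<open>p > 1\<close> alike.

  \<^item> The existence of \<open>v\<^sub>0\<close>.  The shift by \<open>r\<close> is isometric on \<open>A\<close> for the Besicovitch seminorm, which is the \<open>L\<^sup>p(\<beta>)\<close>
  norm of the Gelfand transform (\<open>besic_norm_isometry\<close>).  Besicovitch spaces are complete
  (\<open>besicovitch_complete\<close>), so the shift extends to them and to the quotient, where it corresponds to
  \<open>f \<mapsto> f (\<cdot> + r)\<close> (\<open>gelfand1_shift\<close>).
\<close>

section \<open>Lebesgue spaces and changes of variables\<close>

text \<open>Convexity of \<open>z \<mapsto> z powr p\<close> at the point \<open>(x + y) / (a + b)\<close>, read as a convex combination of \<open>x / a\<close> and \<open>y / b\<close>.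
  With \<open>a\<close> and \<open>b\<close> slightly above the norms of the two summands, integrating gives Minkowski's inequality.\<close>
lemma powr_add_le_weighted:
  fixes x y a b p :: real
  assumes p: "1 \<le> p" and a: "0 < a" and b: "0 < b" and x: "0 \<le> x" and y: "0 \<le> y"
  shows "(x + y) powr p \<le> (a + b) powr p * (a / (a + b) * (x powr p / a powr p) + b / (a + b) * (y powr p / b powr p))"
proof -
  define l where "l = a / (a + b)"
  have l: "0 < l" "l < 1" "b / (a + b) = 1 - l" using a b by (auto simp: l_def field_simps)
  have *: "(l * (x / a) + (1 - l) * (y / b)) powr p \<le> l * (x / a) powr p + (1 - l) * (y / b) powr p"
  proof -
    consider "x = 0" | "y = 0" | "0 < x" "0 < y" using x y by linarith
    then show ?thesis
    proof cases
      case 1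
      have "(1 - l) powr p \<le> (1 - l) powr 1" using l p by (intro powr_mono') auto
      then show ?thesis using 1 l b y p mult_right_mono[of "(1 - l) powr p" "1 - l" "(y / b) powr p"]
        powr_mult[of "1 - l" "y / b" p] by auto
    next
      case 2
      have "l powr p \<le> l powr 1" using l p by (intro powr_mono') auto
      then show ?thesis using 2 l a x p mult_right_mono[of "l powr p" l "(x / a) powr p"]
        powr_mult[of l "x / a" p] by auto
    next
      case 3
      then show ?thesis
        using convex_onD[OF powr_convex[OF p], of "1 - l" "x / a" "y / b"] l a b by auto
    qed
  qed
  have "(x + y) powr p = ((a + b) * (l * (x / a) + (1 - l) * (y / b))) powr p"
    using a b unfolding l(3)[symmetric] by (simp add: distrib_left l_def)
  also have "\<dots> = (a + b) powr p * (l * (x / a) + (1 - l) * (y / b)) powr p"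
    by (rule powr_mult)
  also have "\<dots> \<le> (a + b) powr p * (l * (x / a) powr p + (1 - l) * (y / b) powr p)"
    using * by (intro mult_left_mono) auto
  finally show ?thesis
    using a b x y unfolding l(3) l_def[symmetric] by (simp add: powr_divide)
qed

lemma Lp_measurable: "f \<in> Lp p M \<Longrightarrow> f \<in> borel_measurable M"
  and Lp_integrable: "f \<in> Lp p M \<Longrightarrow> integrable M (\<lambda>x. norm (f x) powr p)"
  by (auto simp: Lp_def)

lemma Lp_norm_nonneg [simp]: "0 \<le> Lp_norm p M f"
  by (simp add: Lp_norm_def)

lemma Lp_norm_powr:
  assumes "1 \<le> p" shows "Lp_norm p M f powr p = (LINT x|M. norm (f x) powr p)"
  using assms by (simp add: Lp_norm_def powr_powr integral_nonneg_AE)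

lemma Lp_norm_le_iff:
  assumes "1 \<le> p" "0 \<le> c"
  shows "Lp_norm p M f \<le> c \<longleftrightarrow> (LINT x|M. norm (f x) powr p) \<le> c powr p"
  unfolding Lp_norm_powr[OF assms(1), symmetric]
  using assms by (meson Lp_norm_nonneg powr_mono2 powr_less_mono2 not_less less_le_trans zero_less_one less_eq_real_def)

lemma Lp_add:
  assumes p: "1 \<le> p" and f: "f \<in> Lp p M" and g: "g \<in> Lp p M"
  shows "(\<lambda>x. f x + g x) \<in> Lp p M"
    and "Lp_norm p M (\<lambda>x. f x + g x) \<le> Lp_norm p M f + Lp_norm p M g"
proof -
  note [measurable] = Lp_measurable[OF f] Lp_measurable[OF g]
  note fi = Lp_integrable[OF f] and gi = Lp_integrable[OF g]
  have bound: "norm (f x + g x) powr p \<le> (a + b) powr p * (a / (a + b) * (norm (f x) powr p / a powr p) + b / (a + b) * (norm (g x) powr p / b powr p))"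
    if "0 < a" "0 < b" for a b x
    by (rule order_trans[OF powr_mono2 powr_add_le_weighted]) (use p that norm_triangle_ineq in auto)
  have bi: "integrable M (\<lambda>x. (a + b) powr p * (a / (a + b) * (norm (f x) powr p / a powr p) + b / (a + b) * (norm (g x) powr p / b powr p)))" for a b
    using fi gi by (intro integrable_mult_right Bochner_Integration.integrable_add integrable_divide)
  have int: "integrable M (\<lambda>x. norm (f x + g x) powr p)"
    by (rule Bochner_Integration.integrable_bound[OF bi[of 1 1]]) (use bound[of 1 1] in \<open>auto intro!: AE_I2\<close>)
  then show "(\<lambda>x. f x + g x) \<in> Lp p M" by (auto simp: Lp_def)
  have "Lp_norm p M (\<lambda>x. f x + g x) \<le> Lp_norm p M f + Lp_norm p M g + e" if "0 < e" for e
  proof -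
    define a where "a = Lp_norm p M f + e / 2"
    define b where "b = Lp_norm p M g + e / 2"
    have ab: "0 < a" "0 < b" using that by (auto simp: a_def b_def add_nonneg_pos)
    have "(LINT x|M. norm (f x) powr p) \<le> a powr p" "(LINT x|M. norm (g x) powr p) \<le> b powr p"
      unfolding Lp_norm_powr[OF p, symmetric] using p that by (auto simp: a_def b_def intro!: powr_mono2)
    then have le1: "(LINT x|M. norm (f x) powr p) / a powr p \<le> 1" "(LINT x|M. norm (g x) powr p) / b powr p \<le> 1"
      using ab by auto
    have "(LINT x|M. norm (f x + g x) powr p)
        \<le> (LINT x|M. (a + b) powr p * (a / (a + b) * (norm (f x) powr p / a powr p) + b / (a + b) * (norm (g x) powr p / b powr p)))"
      by (intro integral_mono int bi bound ab)
    also have "\<dots> = (a + b) powr p * (a / (a + b) * ((LINT x|M. norm (f x) powr p) / a powr p) + b / (a + b) * ((LINT x|M. norm (g x) powr p) / b powr p))"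
      using fi gi by (simp add: Bochner_Integration.integral_add)
    also have "\<dots> \<le> (a + b) powr p * (a / (a + b) * 1 + b / (a + b) * 1)"
      using ab le1 by (intro mult_left_mono add_mono) auto
    also have "\<dots> = (a + b) powr p" using ab by (simp add: add_divide_distrib[symmetric])
    finally have "Lp_norm p M (\<lambda>x. f x + g x) \<le> a + b"
      using ab by (subst Lp_norm_le_iff[OF p]) auto
    then show ?thesis by (simp add: a_def b_def)
  qed
  then show "Lp_norm p M (\<lambda>x. f x + g x) \<le> Lp_norm p M f + Lp_norm p M g"
    by (rule field_le_epsilon)
qed

lemma Lp_uminus: "f \<in> Lp p M \<Longrightarrow> (\<lambda>x. - f x) \<in> Lp p M"
  by (auto simp: Lp_def)

lemma Lp_diff:
  assumes "1 \<le> p" "f \<in> Lp p M" "g \<in> Lp p M"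
  shows "(\<lambda>x. f x - g x) \<in> Lp p M"
    and "Lp_norm p M (\<lambda>x. f x - g x) \<le> Lp_norm p M f + Lp_norm p M g"
  using Lp_add[OF assms(1,2) Lp_uminus[OF assms(3)]] by (auto simp: Lp_norm_def)

lemma Lp_norm_triangle:
  assumes "1 \<le> p" "f \<in> Lp p M" "g \<in> Lp p M" "h \<in> Lp p M"
  shows "Lp_norm p M (\<lambda>x. f x - h x) \<le> Lp_norm p M (\<lambda>x. f x - g x) + Lp_norm p M (\<lambda>x. g x - h x)"
  using Lp_add(2)[OF assms(1) Lp_diff(1)[OF assms(1-3)] Lp_diff(1)[OF assms(1,3,4)]] by simp

text \<open>Every substitution below is measure preserving in the form \<open>distr M N \<theta> = N\<close>: the translation by \<open>t\<close>, the
  group translation by \<open>r\<close>, and their product.\<close>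
lemma Lp_distr:
  assumes "distr M N \<theta> = N" "\<theta> \<in> M \<rightarrow>\<^sub>M N" "f \<in> Lp p N"
  shows "(\<lambda>x. f (\<theta> x)) \<in> Lp p M" and "Lp_norm p M (\<lambda>x. f (\<theta> x)) = Lp_norm p N f"
proof -
  have f: "f \<in> borel_measurable N" "integrable N (\<lambda>x. norm (f x) powr p)" using assms(3) by (auto simp: Lp_def)
  then have "integrable M (\<lambda>x. norm (f (\<theta> x)) powr p)"
    using integrable_distr[OF assms(2), of "\<lambda>x. norm (f x) powr p"] assms(1) by simp
  then show "(\<lambda>x. f (\<theta> x)) \<in> Lp p M" using measurable_compose[OF assms(2) f(1)] by (simp add: Lp_def)
  show "Lp_norm p M (\<lambda>x. f (\<theta> x)) = Lp_norm p N f"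
    unfolding Lp_norm_def using integral_distr[OF assms(2), of "\<lambda>x. norm (f x) powr p"] f(1) assms(1) by simp
qed

lemma Lp_mult_integrable:
  fixes f :: "'x \<Rightarrow> complex" and h :: "'x \<Rightarrow> complex"
  assumes p: "1 < p" and f: "f \<in> Lp p M" and h: "h \<in> borel_measurable M"
    and hi: "integrable M (\<lambda>x. H x powr (p / (p - 1)))" and hH: "AE x in M. norm (h x) \<le> H x"
  shows "integrable M (\<lambda>x. f x * h x)"
proof -
  define q where "q = p / (p - 1)"
  have q: "1 < q" "1 / p + 1 / q = 1" using p by (auto simp: q_def field_simps)
  have "integrable M (\<lambda>x. norm (f x) powr p / p + H x powr q / q)"
    using Lp_integrable[OF f] hi unfolding q_def by (intro Bochner_Integration.integrable_add integrable_divide)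
  then show ?thesis
  proof (rule Bochner_Integration.integrable_bound)
    show "(\<lambda>x. f x * h x) \<in> borel_measurable M" using Lp_measurable[OF f] h by measurable
    show "AE x in M. norm (f x * h x) \<le> norm (norm (f x) powr p / p + H x powr q / q)"
      using hH
    proof eventually_elim
      case (elim x)
      have "norm (f x * h x) \<le> norm (f x) * H x" unfolding norm_mult by (rule mult_left_mono[OF elim]) simp
      also have "\<dots> \<le> norm (f x) powr p / p + H x powr q / q"
        by (rule Youngs_inequality) (use p q elim order_trans[OF norm_ge_zero elim] in auto)
      finally show ?case by simp
    qed
  qed
qed

lemma lebesgue_translation_measurable [measurable]: "(\<lambda>x. x + t) \<in> lebesgue \<rightarrow>\<^sub>M (lebesgue :: 'a::euclidean_space measure)"
  using lebesgue_affine_measurable[of "\<lambda>_. 1" t] by (simp add: euclidean_representation add.commute)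

lemma distr_lebesgue_translation: "distr lebesgue lebesgue (\<lambda>x. x + t) = (lebesgue :: 'a::euclidean_space measure)"
  using lebesgue_affine_euclidean[of "\<lambda>_. 1" t, symmetric]
  by (simp add: euclidean_representation add.commute density_1)

lemma translation_measurable_on [measurable]:
  fixes Q :: "'a::euclidean_space set"
  shows "(\<lambda>x. x + t) \<in> lebesgue_on ((\<lambda>z. z - t) ` Q) \<rightarrow>\<^sub>M lebesgue_on Q"
  by (intro measurable_restrict_space3) auto

lemma distr_lebesgue_on_translation:
  fixes Q :: "'a::euclidean_space set"
  assumes "Q \<in> sets lebesgue"
  shows "distr (lebesgue_on ((\<lambda>z. z - t) ` Q)) (lebesgue_on Q) (\<lambda>x. x + t) = lebesgue_on Q"
proof (rule measure_eqI)
  have Q': "(\<lambda>z. z - t) ` Q \<in> sets lebesgue"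
    using lebesgue_sets_translation[OF assms, of "- t"] by (simp add: image_def)
  fix E assume "E \<in> sets (distr (lebesgue_on ((\<lambda>z. z - t) ` Q)) (lebesgue_on Q) (\<lambda>x. x + t))"
  then have E: "E \<in> sets (lebesgue_on Q)" by simp
  then have EQ: "E \<subseteq> Q" "E \<in> sets lebesgue" using assms by (auto simp: sets_restrict_space_iff)
  have eq: "(\<lambda>x. x + t) -` E \<inter> (\<lambda>z. z - t) ` Q = (\<lambda>x. x + t) -` E \<inter> space lebesgue"
    using EQ by (auto simp: image_iff algebra_simps)
  have "emeasure (distr (lebesgue_on ((\<lambda>z. z - t) ` Q)) (lebesgue_on Q) (\<lambda>x. x + t)) E
      = emeasure (lebesgue_on ((\<lambda>z. z - t) ` Q)) ((\<lambda>x. x + t) -` E \<inter> (\<lambda>z. z - t) ` Q)"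
    using E by (subst emeasure_distr) auto
  also have "\<dots> = emeasure lebesgue ((\<lambda>x. x + t) -` E \<inter> (\<lambda>z. z - t) ` Q)"
    using Q' by (subst emeasure_restrict_space) auto
  also have "\<dots> = emeasure lebesgue ((\<lambda>x. x + t) -` E \<inter> space lebesgue)"
    unfolding eq ..
  also have "\<dots> = emeasure (distr lebesgue lebesgue (\<lambda>x. x + t)) E"
    using EQ by (subst emeasure_distr) auto
  also have "\<dots> = emeasure (lebesgue_on Q) E"
    using EQ assms by (simp add: distr_lebesgue_translation emeasure_restrict_space)
  finally show "emeasure (distr (lebesgue_on ((\<lambda>z. z - t) ` Q)) (lebesgue_on Q) (\<lambda>x. x + t)) E = emeasure (lebesgue_on Q) E" .
qed simp

text \<open>Test functions are only almost everywhere limits of simple functions; completeness of Lebesgue measure makes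
  them measurable in the space variable.\<close>
lemma borel_measurable_completion_AE_eq:
  assumes f: "f \<in> borel_measurable (completion M)" and eq: "AE x in completion M. f x = g x"
  shows "g \<in> borel_measurable (completion M)"
proof (rule measurableI)
  fix B :: "'b set" assume B: "B \<in> sets borel"
  show "g -` B \<inter> space (completion M) \<in> sets (completion M)"
  proof (rule completion.in_sets_AE)
    show "AE x in completion M. (x \<in> f -` B \<inter> space (completion M)) = (x \<in> g -` B \<inter> space (completion M))"
      using eq by eventually_elim simp
  qed (use measurable_sets[OF f B] in auto)
qed simp

lemma borel_measurable_lebesgue_on_AE_eq:
  fixes f g :: "'a::euclidean_space \<Rightarrow> complex"
  assumes Q: "Q \<in> sets lebesgue" and f: "f \<in> borel_measurable (lebesgue_on Q)"
    and eq: "AE x in lebesgue_on Q. f x = g x"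
  shows "g \<in> borel_measurable (lebesgue_on Q)"
proof -
  have "(\<lambda>x. if x \<in> Q then f x else 0) \<in> borel_measurable lebesgue"
    using f Q by (simp add: borel_measurable_if)
  moreover have "AE x in lebesgue. (if x \<in> Q then f x else 0) = (if x \<in> Q then g x else 0)"
    using eq Q by (simp add: AE_restrict_space_iff)
  ultimately have "(\<lambda>x. if x \<in> Q then g x else 0) \<in> borel_measurable lebesgue"
    by (rule borel_measurable_completion_AE_eq)
  then show ?thesis using Q by (simp add: borel_measurable_if)
qed

lemma borel_measurable_lebesgue_on_AE_lim:
  fixes f :: "nat \<Rightarrow> 'a::euclidean_space \<Rightarrow> complex"
  assumes Q: "Q \<in> sets lebesgue" and f: "\<And>n. f n \<in> borel_measurable (lebesgue_on Q)"
    and lim: "AE x in lebesgue_on Q. (\<lambda>n. f n x) \<longlonglongrightarrow> g x"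
  shows "g \<in> borel_measurable (lebesgue_on Q)"
proof (rule borel_measurable_lebesgue_on_AE_eq[OF Q])
  show "(\<lambda>x. lim (\<lambda>n. f n x)) \<in> borel_measurable (lebesgue_on Q)"
    using f by measurable
  show "AE x in lebesgue_on Q. lim (\<lambda>n. f n x) = g x"
    using lim by eventually_elim (rule limI)
qed

section \<open>Weakly convergent sequences and bounded null sequences\<close>

text \<open>The hypothesis says that \<open>w n\<close> converges weakly against all bounded functions, as in the Vitali--Hahn--Saks theorem.
  If the conclusion fails, there are infinitely many \<open>n\<close> at which the integral of \<open>w n * g n\<close> is at least \<open>\<delta>\<close>.  One picks
  such indices \<open>N k\<close> one after another and modifies a bounded function \<open>\<Phi> k\<close> each time, so that its pairing with
  \<open>w (N k)\<close> jumps by \<open>\<delta>\<close>.  The modification is dominated by \<open>g (N k)\<close>, and \<open>N k\<close> is chosen so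
  late that \<open>g (N k)\<close> is negligible for all the earlier \<open>w (N j)\<close>.  The limit \<open>\<Theta>\<close> of the \<open>\<Phi> k\<close> is a bounded function against
  which the subsequence \<open>w (N k)\<close> does not converge.\<close>
lemma gliding_hump:
  fixes w g :: "nat \<Rightarrow> 'x \<Rightarrow> complex"
  assumes w: "\<And>n. integrable M (w n)"
    and g: "\<And>n. g n \<in> borel_measurable M"
    and g1: "\<And>n x. norm (g n x) \<le> 1"
    and lim: "AE x in M. (\<lambda>n. g n x) \<longlonglongrightarrow> 0"
    and conv: "\<And>\<phi>. \<phi> \<in> borel_measurable M \<Longrightarrow> (\<And>x. norm (\<phi> x) \<le> 1) \<Longrightarrow>
                 convergent (\<lambda>n. LINT x|M. w n x * \<phi> x)"
  shows "(\<lambda>n. LINT x|M. w n x * g n x) \<longlonglongrightarrow> 0"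
proof (rule ccontr)
  let ?W = "\<lambda>m f. LINT x|M. w m x * f x"
  assume "\<not> ?thesis"
  then obtain \<delta> where \<delta>: "\<delta> > 0" and bad: "\<exists>\<^sub>F n in sequentially. \<delta> \<le> norm (?W n (g n))"
    unfolding tendsto_iff frequently_def by (auto simp: not_le)
  have wm[measurable]: "w n \<in> borel_measurable M" for n using w[of n] by auto
  note g[measurable]
  have int_w: "integrable M (\<lambda>x. w n x * f x)" if "f \<in> borel_measurable M" "\<And>x. norm (f x) \<le> 1" for n f
    by (rule Bochner_Integration.integrable_bound[OF w[of n]])
       (use that in \<open>auto simp: norm_mult intro!: mult_left_le AE_I2\<close>)
  have small: "(\<lambda>n. LINT x|M. norm (w m x) * norm (g n x)) \<longlonglongrightarrow> 0" for m
  proof -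
    have "(\<lambda>n. LINT x|M. norm (w m x) * norm (g n x)) \<longlonglongrightarrow> (LINT x|M. 0)"
    proof (rule integral_dominated_convergence[where w = "\<lambda>x. norm (w m x)"])
      show "AE x in M. (\<lambda>i. norm (w m x) * norm (g i x)) \<longlonglongrightarrow> 0"
        using lim
      proof eventually_elim
        case (elim x)
        show ?case by (rule tendsto_eq_intros tendsto_norm_zero elim refl)+ simp
      qed
      show "AE x in M. norm (norm (w m x) * norm (g i x)) \<le> norm (w m x)" for i
        using g1 by (auto intro!: mult_left_le)
    qed (use w in auto)
    then show ?thesis by simp
  qed
  define Bad where "Bad n \<longleftrightarrow> \<delta> \<le> norm (?W n (g n))" for n
  define P where "P = (\<lambda>(k::nat) (n, \<Phi>). Bad n \<and> \<Phi> \<in> borel_measurable M \<and> (\<forall>x. norm (\<Phi> x :: complex) \<le> 1))"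
  define R where "R = (\<lambda>(k::nat) (n::nat, \<Phi>) (n'::nat, \<Phi>'). n < n' \<and>
      (\<forall>m\<le>n. (LINT x|M. norm (w m x) * norm (g n' x)) \<le> \<delta> * (1/2)^k / 8) \<and>
      (\<forall>x. norm (\<Phi>' x - \<Phi> x) \<le> 2 * norm (g n' x)) \<and>
      \<delta> \<le> norm ((?W n' \<Phi>') - (?W n \<Phi>)))"
  have "\<exists>s. \<forall>k. P k (s k) \<and> R k (s k) (s (Suc k))"
  proof (rule dependent_nat_choice)
    obtain n where "Bad n" using bad unfolding Bad_def by (meson frequently_ex)
    then show "\<exists>x. P 0 x" by (intro exI[of _ "(n, \<lambda>_. 0)"]) (auto simp: P_def)
  next
    fix s k assume "P k s"
    then obtain n \<Phi> where s: "s = (n, \<Phi>)" and n: "Bad n" and [measurable]: "\<Phi> \<in> borel_measurable M"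
      and \<Phi>1: "\<And>x. norm (\<Phi> x) \<le> 1" unfolding P_def by (cases s) auto
    have "\<forall>\<^sub>F n' in sequentially. \<forall>m\<in>{..n}. (LINT x|M. norm (w m x) * norm (g n' x)) < \<delta> * (1/2)^k / 8"
      by (intro eventually_ball_finite ballI order_tendstoD(2)[OF small]) (use \<delta> in simp_all)
    moreover have "\<forall>\<^sub>F n' in sequentially. n < n'" by (rule eventually_gt_at_top)
    ultimately have "\<exists>\<^sub>F n' in sequentially. Bad n' \<and> n < n' \<and>
        (\<forall>m\<in>{..n}. (LINT x|M. norm (w m x) * norm (g n' x)) < \<delta> * (1/2)^k / 8)"
      using bad unfolding Bad_def
      by (intro frequently_eventually_frequently eventually_conj)
    from frequently_ex[OF this] obtain n' where n': "n < n'" "Bad n'"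
      and sm: "\<And>m. m \<le> n \<Longrightarrow> (LINT x|M. norm (w m x) * norm (g n' x)) < \<delta> * (1/2)^k / 8"
      by (metis atMost_iff)
    (* Both choices c = 1 and c = -1 stay in the unit disc, and their pairings with w n' differ by
       2 * delta at least; so one of them lies at distance delta from the previous pairing. *)
    define \<Psi> where "\<Psi> c x = (1 - norm (g n' x)) * \<Phi> x + c * g n' x" for c :: complex and x
    have [measurable]: "\<Psi> c \<in> borel_measurable M" for c unfolding \<Psi>_def by measurable
    have \<Psi>1: "norm (\<Psi> c x) \<le> 1" if "norm c = 1" for c x
    proof -
      have "norm (\<Psi> c x) \<le> norm (complex_of_real (1 - norm (g n' x))) * norm (\<Phi> x) + norm c * norm (g n' x)"
        unfolding \<Psi>_def by (metis (no_types, lifting) norm_mult norm_triangle_ineq of_real_1 of_real_diff)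
      also have "\<dots> \<le> (1 - norm (g n' x)) * 1 + norm (g n' x)"
        unfolding norm_of_real using g1[of n' x] \<Phi>1[of x] that by (intro add_mono mult_mono) auto
      finally show ?thesis by simp
    qed
    define I where "I c = (LINT x|M. w n' x * \<Psi> c x)" for c
    have "I 1 - I (-1) = (LINT x|M. w n' x * \<Psi> 1 x - w n' x * \<Psi> (-1) x)"
      unfolding I_def by (subst Bochner_Integration.integral_diff) (auto intro!: int_w \<Psi>1)
    also have "\<dots> = (LINT x|M. 2 * (w n' x * g n' x))"
      by (intro Bochner_Integration.integral_cong) (auto simp: \<Psi>_def algebra_simps)
    also have "\<dots> = 2 * (?W n' (g n'))" by simp
    finally have "norm (I 1 - I (-1)) = 2 * norm (?W n' (g n'))" by (simp add: norm_mult)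
    then have "2 * \<delta> \<le> norm (I 1 - I (-1))" using n'(2) by (simp add: Bad_def)
    moreover have "norm (I 1 - I (-1)) \<le> norm (I 1 - z) + norm (I (-1) - z)" for z
      using norm_triangle_ineq4[of "I 1 - z" "I (-1) - z"] by simp
    ultimately have "\<exists>c\<in>{1, -1}. \<delta> \<le> norm (I c - (?W n \<Phi>))"
      by (smt (verit, best) insertCI)
    then obtain c where "c \<in> {1, -1}" and c2: "\<delta> \<le> norm (I c - (?W n \<Phi>))" ..
    then have "norm c = 1" by auto
    note c = this c2
    have "norm (\<Psi> c x - \<Phi> x) \<le> 2 * norm (g n' x)" for x
    proof -
      have "\<Psi> c x - \<Phi> x = c * g n' x - norm (g n' x) * \<Phi> x" by (simp add: \<Psi>_def algebra_simps)
      also have "norm \<dots> \<le> norm (g n' x) + norm (g n' x) * norm (\<Phi> x)"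
        by (rule order_trans[OF norm_triangle_ineq4]) (simp add: norm_mult c)
      also have "\<dots> \<le> 2 * norm (g n' x)" using mult_left_mono[OF \<Phi>1[of x], of "norm (g n' x)"] by simp
      finally show ?thesis .
    qed
    then show "\<exists>y. P (Suc k) y \<and> R k s y"
      by (intro exI[of _ "(n', \<Psi> c)"]) (use n' sm c \<Psi>1 in \<open>auto simp: P_def R_def s I_def less_imp_le\<close>)
  qed
  then obtain s where s: "\<And>k. P k (s k)" "\<And>k. R k (s k) (s (Suc k))" by blast
  define N where "N k = fst (s k)" for k
  define \<Phi> where "\<Phi> k = snd (s k)" for k
  have [measurable]: "\<Phi> k \<in> borel_measurable M" and \<Phi>1: "norm (\<Phi> k x) \<le> 1" for k x
    using s(1)[of k] by (auto simp: P_def \<Phi>_def split: prod.splits)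
  have Nlt: "N k < N (Suc k)"
    and sm: "m \<le> N k \<Longrightarrow> (LINT x|M. norm (w m x) * norm (g (N (Suc k)) x)) \<le> \<delta> * (1/2)^k / 8"
    and \<Phi>d: "norm (\<Phi> (Suc k) x - \<Phi> k x) \<le> 2 * norm (g (N (Suc k)) x)"
    and jump: "\<delta> \<le> norm ((?W (N (Suc k)) (\<Phi> (Suc k))) - (?W (N k) (\<Phi> k)))" for k m x
    using s(2)[of k] by (auto simp: R_def N_def \<Phi>_def split: prod.splits)
  have Nmono: "strict_mono N" using Nlt by (rule strict_monoI_Suc)
  have intd: "integrable M (\<lambda>x. norm (w m x) * norm (\<Phi> i x - \<Phi> j x))" for m i j
  proof (rule Bochner_Integration.integrable_bound[of _ "\<lambda>x. 2 * norm (w m x)"])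
    show "AE x in M. norm (norm (w m x) * norm (\<Phi> i x - \<Phi> j x)) \<le> norm (2 * norm (w m x))"
    proof (rule AE_I2)
      fix x
      have "norm (\<Phi> i x - \<Phi> j x) \<le> 2"
        using norm_triangle_ineq4[of "\<Phi> i x" "\<Phi> j x"] \<Phi>1[of i x] \<Phi>1[of j x] by linarith
      then show "norm (norm (w m x) * norm (\<Phi> i x - \<Phi> j x)) \<le> norm (2 * norm (w m x))"
        by (simp add: mult.commute[of 2] mult_left_mono)
    qed
  qed (use w in auto)
  have step: "(LINT x|M. norm (w (N j) x) * norm (\<Phi> (Suc k) x - \<Phi> k x)) \<le> \<delta> * (1/2)^k / 4"
    if "j \<le> k" for j k
  proof -
    have "(LINT x|M. norm (w (N j) x) * norm (\<Phi> (Suc k) x - \<Phi> k x))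
        \<le> (LINT x|M. 2 * (norm (w (N j) x) * norm (g (N (Suc k)) x)))"
    proof (rule integral_mono[OF intd])
      show "integrable M (\<lambda>x. 2 * (norm (w (N j) x) * norm (g (N (Suc k)) x)))"
        using integrable_norm[OF int_w[OF g g1]] by (simp add: norm_mult)
      show "norm (w (N j) x) * norm (\<Phi> (Suc k) x - \<Phi> k x) \<le> 2 * (norm (w (N j) x) * norm (g (N (Suc k)) x))" for x
        using mult_left_mono[OF \<Phi>d[of k x], of "norm (w (N j) x)"] by (simp add: mult_ac)
    qed
    also have "\<dots> \<le> 2 * (\<delta> * (1/2)^k / 8)"
      using sm[of "N j" k] strict_mono_leD[OF Nmono that] by simp
    finally show ?thesis by simp
  qed
  (* The \<Phi> k converge almost everywhere on the set where some w (N j) does not vanish;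
     outside of it the value 0 keeps \<Theta> bounded. *)
  define \<Theta> where "\<Theta> x = (if convergent (\<lambda>k. \<Phi> k x) then lim (\<lambda>k. \<Phi> k x) else 0)" for x
  have [measurable]: "\<Theta> \<in> borel_measurable M"
    unfolding \<Theta>_def convergent_eq_Cauchy Cauchy_convergent_iff[symmetric] by measurable
  have \<Theta>1: "norm (\<Theta> x) \<le> 1" for x
  proof (cases "convergent (\<lambda>k. \<Phi> k x)")
    case True
    then have "(\<lambda>k. \<Phi> k x) \<longlonglongrightarrow> \<Theta> x" by (simp add: \<Theta>_def convergent_LIMSEQ_iff)
    then show ?thesis using \<Phi>1 by (intro LIMSEQ_le_const2[OF tendsto_norm]) auto
  qed (simp add: \<Theta>_def)
  have lim\<Theta>: "AE x in M. (\<lambda>k. w (N j) x * \<Phi> k x) \<longlonglongrightarrow> w (N j) x * \<Theta> x" for j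
  proof -
    define f where "f k x = norm (w (N j) x) * norm (\<Phi> (Suc (k + j)) x - \<Phi> (k + j) x)" for k x
    have [measurable]: "f k \<in> borel_measurable M" for k unfolding f_def by measurable
    have "(\<integral>\<^sup>+x. (\<Sum>k. ennreal (f k x)) \<partial>M) = (\<Sum>k. \<integral>\<^sup>+x. ennreal (f k x) \<partial>M)"
      by (rule nn_integral_suminf) auto
    also have "\<dots> \<le> (\<Sum>k. ennreal (\<delta> * (1/2)^k / 4))"
    proof (rule suminf_le)
      fix k
      have "(\<integral>\<^sup>+x. ennreal (f k x) \<partial>M) = ennreal (LINT x|M. f k x)"
        by (rule nn_integral_eq_integral) (auto simp: f_def intd)
      also have "\<dots> \<le> ennreal (\<delta> * (1/2)^k / 4)"
      proof (rule ennreal_leI)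
        have "(LINT x|M. f k x) \<le> \<delta> * (1/2)^(k+j) / 4" unfolding f_def by (rule step) simp
        also have "\<dots> \<le> \<delta> * (1/2)^k / 4"
          using \<delta> by (intro divide_right_mono mult_left_mono power_decreasing) auto
        finally show "(LINT x|M. f k x) \<le> \<delta> * (1/2)^k / 4" .
      qed
      finally show "(\<integral>\<^sup>+x. ennreal (f k x) \<partial>M) \<le> ennreal (\<delta> * (1/2)^k / 4)" .
    qed auto
    also have "\<dots> = ennreal (\<Sum>k. \<delta> * (1/2)^k / 4)"
      using \<delta> by (intro suminf_ennreal2) (auto intro!: summable_divide summable_mult summable_geometric)
    finally have "(\<integral>\<^sup>+x. (\<Sum>k. ennreal (f k x)) \<partial>M) < \<infinity>" by (simp add: le_less_trans)
    then have "AE x in M. (\<Sum>k. ennreal (f k x)) \<noteq> \<infinity>"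
      by (intro nn_integral_PInf_AE) auto
    then show ?thesis
    proof eventually_elim
      case (elim x)
      show ?case
      proof (cases "w (N j) x = 0")
        case False
        have "summable (\<lambda>k. f k x)"
          by (rule summable_suminf_not_top) (use elim in \<open>auto simp: f_def\<close>)
        then have "summable (\<lambda>k. norm (\<Phi> (Suc (k + j)) x - \<Phi> (k + j) x))"
          using False by (simp add: f_def summable_cmult_iff)
        then have "summable (\<lambda>k. \<Phi> (Suc (k + j)) x - \<Phi> (k + j) x)" by (rule summable_norm_cancel)
        then have "convergent (\<lambda>n. \<Sum>k<n. \<Phi> (Suc (k + j)) x - \<Phi> (k + j) x)"
          by (simp add: summable_iff_convergent)
        then have "convergent (\<lambda>n. \<Phi> (n + j) x - \<Phi> j x)"
          using sum_lessThan_telescope[of "\<lambda>k. \<Phi> (k + j) x"] by simp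
        then have "convergent (\<lambda>n. \<Phi> (n + j) x)"
          using convergent_diff_const_right_iff[of "\<lambda>n. \<Phi> (n + j) x" "\<Phi> j x"] by blast
        then have "convergent (\<lambda>n. \<Phi> n x)" 
          by (rule convergent_ignore_initial_segment[THEN iffD1])
        then have "(\<lambda>k. \<Phi> k x) \<longlonglongrightarrow> \<Theta> x" by (simp add: \<Theta>_def convergent_LIMSEQ_iff)
        then show ?thesis by (rule tendsto_mult_left)
      qed simp
    qed
  qed
  have close: "norm ((?W (N j) \<Theta>) - (?W (N j) (\<Phi> j))) \<le> \<delta> * (1/2)^j / 2" for j
  proof -
    have *: "(\<lambda>k. ?W (N j) (\<Phi> k)) \<longlonglongrightarrow> (?W (N j) \<Theta>)"
      by (rule integral_dominated_convergence[OF _ _ integrable_norm[OF w[of "N j"]] lim\<Theta>])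
         (use \<Phi>1 in \<open>auto simp: norm_mult intro!: mult_left_le\<close>)
    have "norm ((?W (N j) (\<Phi> (j + i))) - (?W (N j) (\<Phi> j)))
           \<le> \<delta> * (1/2)^j / 2 * (1 - (1/2)^i)" for i
    proof (induction i)
      case (Suc i)
      have "norm ((?W (N j) (\<Phi> (Suc (j + i)))) - (?W (N j) (\<Phi> (j + i))))
          = norm (LINT x|M. w (N j) x * \<Phi> (Suc (j + i)) x - w (N j) x * \<Phi> (j + i) x)"
        by (subst Bochner_Integration.integral_diff) (auto intro!: int_w \<Phi>1)
      also have "\<dots> \<le> (LINT x|M. norm (w (N j) x * \<Phi> (Suc (j + i)) x - w (N j) x * \<Phi> (j + i) x))"
        by (rule integral_norm_bound)
      also have "\<dots> = (LINT x|M. norm (w (N j) x) * norm (\<Phi> (Suc (j + i)) x - \<Phi> (j + i) x))"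
        by (intro Bochner_Integration.integral_cong) (auto simp flip: norm_mult simp: algebra_simps)
      also have "\<dots> \<le> \<delta> * (1/2)^(j+i) / 4" by (rule step) simp
      finally have "norm ((?W (N j) (\<Phi> (j + Suc i))) - (?W (N j) (\<Phi> j)))
         \<le> \<delta> * (1/2)^(j+i) / 4 + \<delta> * (1/2)^j / 2 * (1 - (1/2)^i)"
        using Suc norm_triangle_ineq[of "(?W (N j) (\<Phi> (Suc (j + i)))) - (?W (N j) (\<Phi> (j + i)))"
            "(?W (N j) (\<Phi> (j + i))) - (?W (N j) (\<Phi> j))"] by simp
      also have "\<dots> = \<delta> * (1/2)^j / 2 * (1 - (1/2)^(Suc i))" by (simp add: power_add field_simps)
      finally show ?case .
    qed simp
    moreover have "\<delta> * (1/2)^j / 2 * (1 - (1/2)^i) \<le> \<delta> * (1/2)^j / 2" for i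
      using \<delta> by (intro mult_left_le) auto
    ultimately have "norm ((?W (N j) (\<Phi> (i + j))) - (?W (N j) (\<Phi> j))) \<le> \<delta> * (1/2)^j / 2" for i
      unfolding add.commute[of i j] using order_trans by blast
    then show ?thesis
      by (intro LIMSEQ_le_const2[OF tendsto_norm[OF tendsto_diff[OF LIMSEQ_ignore_initial_segment[OF *, of j] tendsto_const]]]) auto
  qed
  define L where "L n = (?W n \<Theta>)" for n
  have "convergent L" unfolding L_def by (rule conv) (use \<Theta>1 in auto)
  then have "convergent (L \<circ> N)" by (rule convergent_subseq_convergent[OF _ Nmono])
  then have "Cauchy (L \<circ> N)" by (rule convergent_Cauchy)
  then obtain K where K: "\<And>m n. m \<ge> K \<Longrightarrow> n \<ge> K \<Longrightarrow> norm (L (N m) - L (N n)) < \<delta> / 4"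
    using CauchyD[of "L \<circ> N" "\<delta> / 4"] \<delta> by auto
  define j where "j = Suc K"
  have cl: "norm (L (N i) - (?W (N i) (\<Phi> i))) \<le> \<delta> / 4" if "i \<ge> 1" for i
  proof -
    have "(1/2::real)^i \<le> (1/2)^1" using that by (intro power_decreasing) auto
    then have "\<delta> * (1/2)^i / 2 \<le> \<delta> * (1/2) / 2" using \<delta> by (intro divide_right_mono mult_left_mono) auto
    then show ?thesis using close[of i] unfolding L_def by simp
  qed
  have "\<delta> \<le> norm ((?W (N (Suc j)) (\<Phi> (Suc j))) - (?W (N j) (\<Phi> j)))" by (rule jump)
  also have "\<dots> = norm (((?W (N (Suc j)) (\<Phi> (Suc j))) - L (N (Suc j))) + (L (N (Suc j)) - L (N j))
       + (L (N j) - (?W (N j) (\<Phi> j))))" by simp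
  also have "\<dots> \<le> norm ((?W (N (Suc j)) (\<Phi> (Suc j))) - L (N (Suc j))) + norm (L (N (Suc j)) - L (N j))
       + norm (L (N j) - (?W (N j) (\<Phi> j)))"
    by (meson norm_triangle_ineq norm_triangle_mono order_refl)
  also have "\<dots> < \<delta> / 4 + \<delta> / 4 + \<delta> / 4"
    using cl[of "Suc j"] cl[of j] K[of "Suc j" j] by (simp add: j_def norm_minus_commute)
  finally show False using \<delta> by simp
qed

section \<open>Characters and the Gelfand transformation\<close>

lemma sup_norm_upper: "bounded (range u) \<Longrightarrow> norm (u x) \<le> sup_norm u"
  unfolding sup_norm_def
  by (rule cSUP_upper) (auto simp: bdd_above_norm[symmetric] image_image)

lemma sup_norm_least: "(\<And>x. norm (u x) \<le> c) \<Longrightarrow> sup_norm u \<le> c"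
  unfolding sup_norm_def by (rule cSUP_least) auto

lemma sup_norm_nonneg: "bounded (range u) \<Longrightarrow> 0 \<le> sup_norm u"
  by (rule order_trans[OF norm_ge_zero sup_norm_upper])

lemma continuous_on_eval [continuous_intros]: "continuous_on S (\<lambda>s. s u :: complex)"
  by (rule continuous_on_subset[OF continuous_on_product_coordinates]) simp

locale mean_value_algebra =
  fixes A :: "('a::euclidean_space \<Rightarrow> complex) set"
  assumes mean_value_algebra: "algebra_with_mean_value A"
    and separable: "separable_algebra A"
begin

lemma const_in: "(\<lambda>_. c) \<in> A"
  and add_in: "u \<in> A \<Longrightarrow> v \<in> A \<Longrightarrow> (\<lambda>x. u x + v x) \<in> A"
  and scale_in: "u \<in> A \<Longrightarrow> (\<lambda>x. c * u x) \<in> A"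
  and mult_in: "u \<in> A \<Longrightarrow> v \<in> A \<Longrightarrow> (\<lambda>x. u x * v x) \<in> A"
  and cnj_in: "u \<in> A \<Longrightarrow> (\<lambda>x. cnj (u x)) \<in> A"
  and translate_in: "u \<in> A \<Longrightarrow> (\<lambda>x. u (x + a)) \<in> A"
  and has_mean: "u \<in> A \<Longrightarrow> \<exists>m. has_mean_value u m"
  and in_BUC: "u \<in> A \<Longrightarrow> u \<in> BUC"
  using mean_value_algebra unfolding algebra_with_mean_value_def by blast+

lemma limit_in: "(\<And>n::nat. f n \<in> A) \<Longrightarrow> uniform_limit UNIV f u sequentially \<Longrightarrow> u \<in> A"
  using mean_value_algebra unfolding algebra_with_mean_value_def by blast

lemma diff_in: "u \<in> A \<Longrightarrow> v \<in> A \<Longrightarrow> (\<lambda>x. u x - v x) \<in> A"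
  using add_in[of u "\<lambda>x. (-1) * v x"] scale_in[of v "-1"] by simp

lemma sum_in: "(\<And>i. i \<in> I \<Longrightarrow> f i \<in> A) \<Longrightarrow> (\<lambda>x. \<Sum>i\<in>I. f i x) \<in> A"
  by (induction I rule: infinite_finite_induct) (auto intro: add_in const_in)

lemma power_in: "u \<in> A \<Longrightarrow> (\<lambda>x. u x ^ k) \<in> A"
  by (induction k) (auto intro: mult_in const_in)

lemma bounded_in: "u \<in> A \<Longrightarrow> bounded (range u)"
  and continuous_in: "u \<in> A \<Longrightarrow> continuous_on S u"
  using in_BUC[of u] uniformly_continuous_imp_continuous[of UNIV u]
  by (auto simp: BUC_def intro: continuous_on_subset)

lemma norm_le_sup_norm: "u \<in> A \<Longrightarrow> norm (u x) \<le> sup_norm u"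
  by (rule sup_norm_upper[OF bounded_in])

lemma sup_norm_ge0: "u \<in> A \<Longrightarrow> 0 \<le> sup_norm u"
  by (rule sup_norm_nonneg[OF bounded_in])

context
  fixes s assumes s: "s \<in> spectrum A"
begin

lemma character_add: "u \<in> A \<Longrightarrow> v \<in> A \<Longrightarrow> s (\<lambda>x. u x + v x) = s u + s v"
  and character_scale: "u \<in> A \<Longrightarrow> s (\<lambda>x. c * u x) = c * s u"
  and character_mult: "u \<in> A \<Longrightarrow> v \<in> A \<Longrightarrow> s (\<lambda>x. u x * v x) = s u * s v"
  using s unfolding spectrum_def by blast+

lemma character_one: "s (\<lambda>_. 1) = 1"
proof -
  obtain u where "u \<in> A" "s u \<noteq> 0" using s unfolding spectrum_def by blast
  then show ?thesis using character_mult[of u "\<lambda>_. 1"] const_in by auto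
qed

lemma character_const: "s (\<lambda>_. c) = c"
  using character_scale[OF const_in, of c 1] character_one by simp

lemma character_diff: "u \<in> A \<Longrightarrow> v \<in> A \<Longrightarrow> s (\<lambda>x. u x - v x) = s u - s v"
  using character_add[of u "\<lambda>x. (-1) * v x"] character_scale[of v "-1"] scale_in[of v "-1"] by simp

lemma character_sum: "finite I \<Longrightarrow> (\<And>i. i \<in> I \<Longrightarrow> f i \<in> A) \<Longrightarrow> s (\<lambda>x. \<Sum>i\<in>I. f i x) = (\<Sum>i\<in>I. s (f i))"
  by (induction I rule: finite_induct) (auto simp: character_const character_add sum_in)

text \<open>If \<open>\<bar>s u\<bar>\<close> exceeded the norm of \<open>u\<close>, then \<open>v = u / s u\<close> would have norm less than \<open>1\<close>, so that the geometric series
  \<open>g = v + v\<^sup>2 + \<dots>\<close> would lie in \<open>A\<close>; applying \<open>s\<close> to \<open>g = v + v g\<close> yields \<open>s g = 1 + s g\<close>.\<close>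
lemma character_bound:
  assumes u: "u \<in> A" shows "norm (s u) \<le> sup_norm u"
proof (rule ccontr)
  assume "\<not> ?thesis"
  then have lt: "sup_norm u < norm (s u)" by simp
  then have nz: "s u \<noteq> 0" using sup_norm_ge0[OF u] by auto
  define q where "q = sup_norm u / norm (s u)"
  have q: "0 \<le> q" "q < 1" using lt sup_norm_ge0[OF u] nz by (auto simp: q_def field_simps)
  define v where "v x = inverse (s u) * u x" for x
  have v: "v \<in> A" unfolding v_def by (rule scale_in[OF u])
  have sv: "s v = 1" unfolding v_def using nz by (simp add: character_scale[OF u])
  have vq: "norm (v x) \<le> q" for x
    using divide_right_mono[OF norm_le_sup_norm[OF u, of x], of "norm (s u)"]
    by (simp add: v_def q_def norm_mult norm_inverse divide_inverse mult.commute)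
  define g where "g x = (\<Sum>k. v x ^ Suc k)" for x
  have "uniform_limit UNIV (\<lambda>n x. \<Sum>k<n. v x ^ Suc k) (\<lambda>x. \<Sum>k. v x ^ Suc k) sequentially"
  proof (rule Weierstrass_m_test)
    show "norm (v x ^ Suc k) \<le> q ^ Suc k" for k x
      unfolding norm_power by (rule power_mono[OF vq]) simp
    show "summable (\<lambda>k. q ^ Suc k)" using q by (auto simp: summable_mult summable_geometric)
  qed
  then have g: "g \<in> A" unfolding g_def by (rule limit_in[rotated]) (intro sum_in power_in v)
  have "g x = v x + v x * g x" for x
  proof -
    have "norm (v x) < 1" using vq[of x] q by linarith
    then have "g x = v x / (1 - v x)" "v x \<noteq> 1"
      unfolding g_def using suminf_mult[of "\<lambda>k. v x ^ k" "v x"] by (auto simp: suminf_geometric summable_geometric)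
    then show ?thesis by (simp add: field_simps)
  qed
  then have "g = (\<lambda>x. v x + v x * g x)" by auto
  then have "s g = s v + s v * s g"
    using character_add[OF v mult_in[OF v g]] character_mult[OF v g] by simp
  then show False using sv by simp
qed

lemma character_uniform_limit:
  assumes f: "\<And>n::nat. f n \<in> A" and lim: "uniform_limit UNIV f u sequentially"
  shows "(\<lambda>n. s (f n)) \<longlonglongrightarrow> s u"
proof (rule tendstoI)
  fix e :: real assume e: "0 < e"
  have u: "u \<in> A" using f lim by (rule limit_in)
  have "\<forall>\<^sub>F n in sequentially. \<forall>x\<in>UNIV. dist (f n x) (u x) < e / 2"
    using uniform_limitD[OF lim, of "e / 2"] e by simp
  then show "\<forall>\<^sub>F n in sequentially. dist (s (f n)) (s u) < e"
  proof eventually_elim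
    case (elim n)
    have "dist (s (f n)) (s u) = norm (s (\<lambda>x. f n x - u x))"
      by (simp add: dist_norm character_diff f u)
    also have "\<dots> \<le> sup_norm (\<lambda>x. f n x - u x)" by (rule character_bound[OF diff_in[OF f u]])
    also have "\<dots> \<le> e / 2" using elim by (intro sup_norm_least) (auto simp: dist_norm less_imp_le)
    finally show ?case using e by simp
  qed
qed

text \<open>Dirac masses are dense in the spectrum.  If none is close to \<open>s\<close> on \<open>F\<close>, then the sum \<open>v\<close> of the \<open>\<bar>u - s u\<bar>\<^sup>2\<close> is bounded
  away from \<open>0\<close>, although \<open>s v = 0\<close>.  Then \<open>z = 1 - v / C\<close> has norm less than \<open>1\<close> and \<open>s z = 1\<close>,
  against \<open>character_bound\<close>.\<close>
lemma character_approx_dirac: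
  assumes F: "finite F" "F \<subseteq> A" and e: "0 < e"
  shows "\<exists>y. \<forall>u\<in>F. norm (u y - s u) < e"
proof (rule ccontr)
  assume "\<not> ?thesis"
  then have far: "\<exists>u\<in>F. e \<le> norm (u y - s u)" for y by (force simp: not_less)
  define h where "h u x = (u x - s u) * cnj (u x - s u)" for u and x :: 'a
  define v where "v x = (\<Sum>u\<in>F. h u x)" for x
  have h: "h u \<in> A" "s (h u) = 0" if "u \<in> F" for u
  proof -
    have *: "(\<lambda>x. u x - s u) \<in> A" using F that by (intro diff_in const_in) auto
    then show "h u \<in> A" unfolding h_def by (intro mult_in cnj_in)
    have "s (\<lambda>x. u x - s u) = 0" using F that character_diff[OF _ const_in] by (auto simp: character_const)
    then show "s (h u) = 0" unfolding h_def using character_mult[OF * cnj_in[OF *]] by simp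
  qed
  have v: "v \<in> A" unfolding v_def by (intro sum_in h)
  have sv: "s v = 0" unfolding v_def using character_sum[OF F(1), of h] h by simp
  define r where "r x = (\<Sum>u\<in>F. (norm (u x - s u))\<^sup>2)" for x
  have vr: "v x = of_real (r x)" for x
    by (simp add: v_def r_def h_def del: complex_cnj_diff of_real_power flip: complex_norm_square)
  have r: "e\<^sup>2 \<le> r x" for x
  proof -
    obtain u where u: "u \<in> F" "e \<le> norm (u x - s u)" using far by blast
    have "e\<^sup>2 \<le> (norm (u x - s u))\<^sup>2" using u e by (intro power_mono) auto
    also have "\<dots> \<le> r x" unfolding r_def using F u by (intro member_le_sum) auto
    finally show ?thesis .
  qed
  have rC: "r x \<le> sup_norm v" for x
    using norm_le_sup_norm[OF v, of x] unfolding vr by simp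
  define C where "C = sup_norm v"
  have C: "0 < C" using r rC e unfolding C_def by (meson less_le_trans zero_less_power)
  define z where "z x = 1 - inverse (of_real C) * v x" for x
  have z: "z \<in> A" unfolding z_def by (intro diff_in const_in scale_in v)
  have "s z = 1" unfolding z_def
    using character_diff[OF const_in scale_in[OF v]] character_scale[OF v] sv by (simp add: character_const)
  then have "1 \<le> sup_norm z" using character_bound[OF z] by simp
  also have "\<dots> \<le> 1 - e\<^sup>2 / C"
  proof (rule sup_norm_least)
    fix x
    have "z x = of_real (1 - r x / C)" by (simp add: z_def vr field_simps)
    then have "norm (z x) = \<bar>1 - r x / C\<bar>" by (simp only: norm_of_real)
    also have "\<dots> = 1 - r x / C" using rC[of x] C unfolding C_def by simp
    also have "\<dots> \<le> 1 - e\<^sup>2 / C" using r[of x] C by (simp add: divide_right_mono)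
    finally show "norm (z x) \<le> 1 - e\<^sup>2 / C" .
  qed
  finally have "e\<^sup>2 / C \<le> 0" by simp
  moreover have "0 < e\<^sup>2 / C" using e C by simp
  ultimately show False by linarith
qed

text \<open>True for Dirac masses, hence in general by density.\<close>
lemma character_cnj:
  assumes u: "u \<in> A" shows "s (\<lambda>x. cnj (u x)) = cnj (s u)"
proof -
  have "norm (s (\<lambda>x. cnj (u x)) - cnj (s u)) \<le> 0 + e" if e: "0 < e" for e
  proof -
    obtain y where y: "norm (u y - s u) < e / 2" "norm (cnj (u y) - s (\<lambda>x. cnj (u x))) < e / 2"
      using character_approx_dirac[of "{u, \<lambda>x. cnj (u x)}" "e / 2"] u cnj_in[OF u] e by auto
    have "norm (cnj (u y) - cnj (s u)) < e / 2" using y(1) by (metis complex_cnj_diff complex_mod_cnj)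
    then show ?thesis using y(2) norm_triangle_ineq4[of "cnj (u y) - cnj (s u)" "cnj (u y) - s (\<lambda>x. cnj (u x))"]
      by simp
  qed
  then have "norm (s (\<lambda>x. cnj (u x)) - cnj (s u)) \<le> 0" by (rule field_le_epsilon)
  then show ?thesis by simp
qed

lemma character_Re: "u \<in> A \<Longrightarrow> s (\<lambda>x. of_real (Re (u x))) = of_real (Re (s u))"
  and character_Im: "u \<in> A \<Longrightarrow> s (\<lambda>x. of_real (Im (u x))) = of_real (Im (s u))"
proof -
  assume u: "u \<in> A"
  have "(\<lambda>x. of_real (Re (u x))) = (\<lambda>x. (1/2) * (u x + cnj (u x)))"
    by (auto simp: complex_add_cnj)
  then show "s (\<lambda>x. of_real (Re (u x))) = of_real (Re (s u))"
    using character_scale[OF add_in[OF u cnj_in[OF u]], of "1/2"] character_add[OF u cnj_in[OF u]]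
    by (simp add: character_cnj[OF u] complex_add_cnj)
  have "(\<lambda>x. of_real (Im (u x))) = (\<lambda>x. (-\<i>/2) * (u x - cnj (u x)))"
    by (auto simp: complex_eq_iff)
  then show "s (\<lambda>x. of_real (Im (u x))) = of_real (Im (s u))"
    using character_scale[OF diff_in[OF u cnj_in[OF u]], of "-\<i>/2"] character_diff[OF u cnj_in[OF u]]
    by (simp add: character_cnj[OF u] complex_eq_iff)
qed

end

lemma Re_in: "u \<in> A \<Longrightarrow> (\<lambda>x. of_real (Re (u x))) \<in> A"
proof -
  assume u: "u \<in> A"
  have "(\<lambda>x. of_real (Re (u x))) = (\<lambda>x. (1/2) * (u x + cnj (u x)))"
    by (auto simp: complex_add_cnj)
  then show ?thesis using scale_in[OF add_in[OF u cnj_in[OF u]]] by metis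
qed

lemma Im_in: "u \<in> A \<Longrightarrow> (\<lambda>x. of_real (Im (u x))) \<in> A"
proof -
  assume u: "u \<in> A"
  have "(\<lambda>x. of_real (Im (u x))) = (\<lambda>x. (-\<i>/2) * (u x - cnj (u x)))"
    by (auto simp: complex_eq_iff)
  then show ?thesis using scale_in[OF diff_in[OF u cnj_in[OF u]]] by metis
qed

lemma dirac_apply: "u \<in> A \<Longrightarrow> dirac A y u = u y"
  by (simp add: dirac_def)

lemma dirac_in: "dirac A y \<in> spectrum A"
proof -
  have "dirac A y (\<lambda>_. 1) \<noteq> 0" by (simp add: dirac_apply const_in)
  then show ?thesis unfolding spectrum_def
    using const_in[of 1] by (auto simp: add_in scale_in mult_in extensional_def dirac_def intro!: bexI[of _ "\<lambda>_. 1"])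
qed

text \<open>By \<open>character_bound\<close> the spectrum is a subset of a product of discs, which is compact by Tychonoff's theorem.\<close>
lemma closed_spectrum: "closed (spectrum A)"
  and compact_spectrum: "compact (spectrum A)"
proof -
  define B :: "('a \<Rightarrow> complex) \<Rightarrow> complex set" where "B u = (if u \<in> A then cball 0 (sup_norm u) else {undefined})" for u :: "'a \<Rightarrow> complex"
  have [simp]: "compact (B u)" for u by (simp add: B_def)
  have "compact (Pi\<^sub>E UNIV B)"
    using compactin_PiE[of "\<lambda>_. euclidean" UNIV B]
    unfolding euclidean_product_topology compactin_euclidean_iff by simp
  moreover show "closed (spectrum A)"
  proof -
    have eq: "spectrum A = (\<Inter>u\<in>-A. {s. s u = undefined})
        \<inter> (\<Inter>u\<in>A. \<Inter>v\<in>A. {s. s (\<lambda>x. u x + v x) = s u + s v})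
        \<inter> (\<Inter>c. \<Inter>u\<in>A. {s. s (\<lambda>x. c * u x) = c * s u})
        \<inter> (\<Inter>u\<in>A. \<Inter>v\<in>A. {s. s (\<lambda>x. u x * v x) = s u * s v})
        \<inter> {s. s (\<lambda>_. 1) = 1}" (is "_ = ?R")
    proof (intro equalityI subsetI)
      fix s assume "s \<in> spectrum A"
      then show "s \<in> ?R" using character_one by (auto simp: spectrum_def extensional_def)
    next
      fix s assume s: "s \<in> ?R"
      then have "s (\<lambda>_. 1) \<noteq> 0" by simp
      then have "\<exists>u\<in>A. s u \<noteq> 0" using const_in[of 1] by (rule bexI)
      then show "s \<in> spectrum A" using s by (auto simp: spectrum_def extensional_def)
    qed
    show ?thesis unfolding eq
      by (intro closed_Int closed_INT ballI closed_Collect_eq continuous_intros)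
  qed
  moreover have "spectrum A \<subseteq> Pi\<^sub>E UNIV B"
  proof
    fix s assume s: "s \<in> spectrum A"
    then show "s \<in> Pi\<^sub>E UNIV B"
      using character_bound[OF s] by (auto simp: B_def spectrum_def extensional_def)
  qed
  ultimately show "compact (spectrum A)"
    by (metis compact_Int_closed inf.absorb_iff2)
qed

lemma spectrum_eqI:
  assumes "s \<in> spectrum A" "r \<in> spectrum A" "\<And>u. u \<in> A \<Longrightarrow> s u = r u"
  shows "s = r"
proof (rule extensionalityI)
  show "s \<in> extensional A" "r \<in> extensional A" using assms by (auto simp: spectrum_def)
qed (rule assms(3))

text \<open>The values of a character on a dense sequence of \<open>A\<close> determine it.  Hence the compact spectrum is homeomorphic to
  a subset of the metrizable space of complex sequences, and the Stone--Weierstrass theorem is applied there.\<close>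
definition dense_seq :: "nat \<Rightarrow> 'a \<Rightarrow> complex" where
  "dense_seq = (SOME d. range d \<subseteq> A \<and> (\<forall>u\<in>A. \<forall>e>0. \<exists>n. sup_dist u (d n) < e))"

lemma dense_seq_in: "dense_seq n \<in> A"
  and dense_seq_dense: "u \<in> A \<Longrightarrow> 0 < e \<Longrightarrow> \<exists>n. sup_dist u (dense_seq n) < e"
proof -
  obtain D where D: "countable D" "D \<subseteq> A" "\<And>u e. u \<in> A \<Longrightarrow> 0 < e \<Longrightarrow> \<exists>d\<in>D. sup_dist u d < e"
    using separable unfolding separable_algebra_def by blast
  have "D \<noteq> {}" using D(3)[OF const_in, of 1] by auto
  then have "range (from_nat_into D) = D" using D(1) by (rule range_from_nat_into)
  then have "\<exists>d. range d \<subseteq> A \<and> (\<forall>u\<in>A. \<forall>e>0. \<exists>n::nat. sup_dist u (d n) < e)"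
    using D(2,3) by (intro exI[of _ "from_nat_into D"]) (metis imageE)
  from someI_ex[OF this] show "dense_seq n \<in> A" "u \<in> A \<Longrightarrow> 0 < e \<Longrightarrow> \<exists>n. sup_dist u (dense_seq n) < e"
    unfolding dense_seq_def[symmetric] by auto
qed

definition embed :: "'a functional \<Rightarrow> nat \<Rightarrow> complex" where
  "embed s n = s (dense_seq n)"

lemma inj_on_embed: "inj_on embed (spectrum A)"
proof (rule inj_onI)
  fix s r assume s: "s \<in> spectrum A" and r: "r \<in> spectrum A" and eq: "embed s = embed r"
  have "norm (s u - r u) \<le> 0 + e" if u: "u \<in> A" and e: "0 < e" for u e
  proof -
    obtain n where n: "sup_dist u (dense_seq n) < e / 2" using dense_seq_dense[OF u, of "e / 2"] e by auto
    have "norm (t u - t (dense_seq n)) < e / 2" if t: "t \<in> spectrum A" for t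
      using character_bound[OF t diff_in[OF u dense_seq_in[of n]]] n
      by (simp add: character_diff[OF t u dense_seq_in] sup_dist_def)
    from this[OF s] this[OF r] show ?thesis
      using norm_triangle_ineq4[of "s u - s (dense_seq n)" "r u - r (dense_seq n)"] fun_cong[OF eq, of n]
      by (simp add: embed_def)
  qed
  then have "norm (s u - r u) \<le> 0" if "u \<in> A" for u
    using that field_le_epsilon[of "norm (s u - r u)" 0] by blast
  then have "s u = r u" if "u \<in> A" for u using that by simp
  then show "s = r" by (rule spectrum_eqI[OF s r])
qed

lemma continuous_embed: "continuous_on S embed"
  unfolding embed_def by (intro continuous_on_coordinatewise_then_product continuous_intros)

definition unembed :: "(nat \<Rightarrow> complex) \<Rightarrow> 'a functional" where
  "unembed = inv_into (spectrum A) embed"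

lemma unembed_embed [simp]: "s \<in> spectrum A \<Longrightarrow> unembed (embed s) = s"
  unfolding unembed_def by (rule inv_into_f_f[OF inj_on_embed])

lemma continuous_unembed: "continuous_on (embed ` spectrum A) unembed"
  by (rule continuous_on_inv[OF continuous_embed compact_spectrum]) simp

text \<open>The real-valued Gelfand transforms, transported to the image of the spectrum.\<close>
definition real_gelfand :: "((nat \<Rightarrow> complex) \<Rightarrow> real) set" where
  "real_gelfand = {f. \<exists>u\<in>A. \<forall>s\<in>spectrum A. s u = of_real (f (embed s))}"

lemma real_gelfand_ring: "function_ring_on real_gelfand (embed ` spectrum A)"
proof
  show "compact (embed ` spectrum A)" by (rule compact_continuous_image[OF continuous_embed compact_spectrum])
next
  fix f assume "f \<in> real_gelfand"
  then obtain u where u: "\<And>s. s \<in> spectrum A \<Longrightarrow> s u = of_real (f (embed s))" by (auto simp: real_gelfand_def)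
  have "continuous_on (embed ` spectrum A) (\<lambda>z. Re (unembed z u))"
    by (rule continuous_on_Re[OF continuous_on_product_then_coordinatewise[OF continuous_unembed]])
  then show "continuous_on (embed ` spectrum A) f"
    by (rule continuous_on_eq) (auto simp: u)
next
  fix f g assume "f \<in> real_gelfand" "g \<in> real_gelfand"
  then obtain u v where uv: "u \<in> A" "v \<in> A"
    "\<And>s. s \<in> spectrum A \<Longrightarrow> s u = of_real (f (embed s))" "\<And>s. s \<in> spectrum A \<Longrightarrow> s v = of_real (g (embed s))"
    by (auto simp: real_gelfand_def)
  show "(\<lambda>x. f x + g x) \<in> real_gelfand"
    unfolding real_gelfand_def using uv
    by (auto intro!: bexI[of _ "\<lambda>x. u x + v x"] simp: character_add add_in)
  show "(\<lambda>x. f x * g x) \<in> real_gelfand"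
    unfolding real_gelfand_def using uv
    by (auto intro!: bexI[of _ "\<lambda>x. u x * v x"] simp: character_mult mult_in)
next
  fix c show "(\<lambda>_. c) \<in> real_gelfand" unfolding real_gelfand_def mem_Collect_eq
    by (intro bexI[of _ "\<lambda>_. of_real c"] ballI) (auto simp: character_const const_in)
next
  fix x y assume "x \<in> embed ` spectrum A" "y \<in> embed ` spectrum A" "x \<noteq> y"
  then obtain s r where s: "s \<in> spectrum A" "x = embed s" and r: "r \<in> spectrum A" "y = embed r" and "s \<noteq> r"
    by auto
  then obtain u where u: "u \<in> A" "s u \<noteq> r u"
    using spectrum_eqI by blast
  then consider "Re (s u) \<noteq> Re (r u)" | "Im (s u) \<noteq> Im (r u)" by (auto simp: complex_eq_iff)
  then show "\<exists>f\<in>real_gelfand. f x \<noteq> f y"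
  proof cases
    case 1
    have "(\<lambda>z. Re (unembed z u)) \<in> real_gelfand"
      unfolding real_gelfand_def using Re_in[OF u(1)] character_Re u(1) by force
    then show ?thesis using 1 s r by (intro bexI[of _ "\<lambda>z. Re (unembed z u)"]) simp_all
  next
    case 2
    have "(\<lambda>z. Im (unembed z u)) \<in> real_gelfand"
      unfolding real_gelfand_def using Im_in[OF u(1)] character_Im u(1) by force
    then show ?thesis using 2 s r by (intro bexI[of _ "\<lambda>z. Im (unembed z u)"]) simp_all
  qed
qed

lemma compact_spectrum_closed:
  assumes "compact K" "K \<subseteq> spectrum A" shows "closed K"
proof -
  have "closed (embed ` K)"
    by (rule compact_imp_closed[OF compact_continuous_image[OF continuous_embed assms(1)]])
  then have "closed (embed -` (embed ` K))" by (rule closed_vimage[OF _ continuous_embed])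
  moreover have "K = spectrum A \<inter> embed -` (embed ` K)"
    using assms(2) inj_on_embed by (auto dest: inj_onD)
  ultimately show ?thesis using closed_spectrum by (metis closed_Int)
qed

text \<open>The form of Urysohn's lemma that is behind the Stone--Weierstrass theorem: the separating function can be taken to be
  a Gelfand transform.\<close>
lemma gelfand_separates_compacts:
  assumes K: "compact K" "K \<subseteq> spectrum A" and L: "compact L" "L \<subseteq> spectrum A"
    and KL: "K \<inter> L = {}" and e: "0 < e" "e < 1"
  obtains u f where "u \<in> A" "\<And>s. s \<in> spectrum A \<Longrightarrow> s u = of_real (f s)" "\<And>s. s \<in> spectrum A \<Longrightarrow> 0 \<le> f s \<and> f s \<le> 1"
    "\<And>s. s \<in> K \<Longrightarrow> f s < e" "\<And>s. s \<in> L \<Longrightarrow> 1 - e < f s"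
proof -
  interpret function_ring_on real_gelfand "embed ` spectrum A" by (rule real_gelfand_ring)
  have "closed (embed ` K)" "closed (embed ` L)"
    using K L by (auto intro!: compact_imp_closed compact_continuous_image continuous_embed)
  moreover have "embed ` K \<inter> embed ` L = {}"
    using inj_on_image_Int[OF inj_on_embed K(2) L(2)] KL by simp
  ultimately obtain f where f: "f \<in> real_gelfand" "f ` embed ` spectrum A \<subseteq> {0..1}"
    "\<forall>x\<in>embed ` K. f x < e" "\<forall>x\<in>embed ` L. 1 - e < f x"
    using two[of "embed ` K" "embed ` L" e] K(2) L(2) e by (auto simp: image_mono)
  obtain u where "u \<in> A" "\<forall>s\<in>spectrum A. s u = of_real (f (embed s))"
    using f(1) by (auto simp: real_gelfand_def)
  then show ?thesis using f that[of u "\<lambda>s. f (embed s)"] by (auto simp: image_subset_iff)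
qed

text \<open>Surjectivity of the Gelfand transformation.  It is used for two purposes: \<open>A\<close> is stable under
  \<open>u \<mapsto> \<bar>u\<bar> powr p\<close>, and the function \<open>s \<mapsto> \<langle>s + r, u\<rangle>\<close> on the spectrum comes from an element of \<open>A\<close>.\<close>
lemma gelfand_onto_real:
  fixes f :: "'a functional \<Rightarrow> real"
  assumes f: "continuous_on (spectrum A) f"
  obtains u where "u \<in> A" "\<And>s. s \<in> spectrum A \<Longrightarrow> s u = of_real (f s)"
proof -
  interpret function_ring_on real_gelfand "embed ` spectrum A" by (rule real_gelfand_ring)
  have "continuous_on (embed ` spectrum A) (\<lambda>z. f (unembed z))"
    by (rule continuous_on_compose2[OF f continuous_unembed]) auto
  then obtain F where F: "\<And>n::nat. F n \<in> real_gelfand"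
    and lim: "uniform_limit (embed ` spectrum A) F (\<lambda>z. f (unembed z)) sequentially"
    using Stone_Weierstrass by blast
  then have "\<exists>u\<in>A. \<forall>s\<in>spectrum A. s u = of_real (F n (embed s))" for n by (auto simp: real_gelfand_def)
  then obtain v where v: "\<And>n. v n \<in> A" "\<And>n s. s \<in> spectrum A \<Longrightarrow> s (v n) = of_real (F n (embed s))" by metis
  define u where "u x = complex_of_real (f (dirac A x))" for x
  have ul: "uniform_limit UNIV v u sequentially"
  proof (rule uniform_limitI)
    fix e :: real assume "0 < e"
    from uniform_limitD[OF lim this] show "\<forall>\<^sub>F n in sequentially. \<forall>x\<in>UNIV. dist (v n x) (u x) < e"
    proof eventually_elim
      case (elim n)
      show ?case
      proof
        fix x
        have "v n x = of_real (F n (embed (dirac A x)))" using v(2)[OF dirac_in, of x n] by (simp add: dirac_apply v(1))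
        then show "dist (v n x) (u x) < e" using elim dirac_in[of x] by (auto simp: u_def)
      qed
    qed
  qed
  show ?thesis
  proof
    show "u \<in> A" using v(1) ul by (rule limit_in)
    fix s assume s: "s \<in> spectrum A"
    have "(\<lambda>n. s (v n)) \<longlonglongrightarrow> of_real (f s)"
      unfolding v(2)[OF s] using tendsto_uniform_limitI[OF lim, of "embed s"] s
      by (intro tendsto_of_real) auto
    then show "s u = of_real (f s)"
      using character_uniform_limit[OF s v(1) ul] LIMSEQ_unique by blast
  qed
qed

lemma gelfand_onto:
  fixes f :: "'a functional \<Rightarrow> complex"
  assumes f: "continuous_on (spectrum A) f"
  obtains u where "u \<in> A" "\<And>s. s \<in> spectrum A \<Longrightarrow> s u = f s"
proof -
  obtain a where a: "a \<in> A" "\<And>s. s \<in> spectrum A \<Longrightarrow> s a = of_real (Re (f s))"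
    using gelfand_onto_real[of "\<lambda>s. Re (f s)"] continuous_on_Re[OF f] by blast
  obtain b where b: "b \<in> A" "\<And>s. s \<in> spectrum A \<Longrightarrow> s b = of_real (Im (f s))"
    using gelfand_onto_real[of "\<lambda>s. Im (f s)"] continuous_on_Im[OF f] by blast
  show ?thesis
  proof
    show "(\<lambda>x. a x + \<i> * b x) \<in> A" by (intro add_in scale_in a b)
    fix s assume s: "s \<in> spectrum A"
    show "s (\<lambda>x. a x + \<i> * b x) = f s"
      using character_add[OF s a(1) scale_in[OF b(1)], of \<i>] character_scale[OF s b(1), of \<i>]
      by (simp add: a(2)[OF s] b(2)[OF s] complex_eq[symmetric])
  qed
qed

end

section \<open>Mean values\<close>

lemma lebesgue_integral_scale:
  fixes f :: "'a::euclidean_space \<Rightarrow> complex"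
  assumes c: "c \<noteq> 0" and f: "f \<in> borel_measurable lebesgue"
  shows "(LINT x|lebesgue. f x) = of_real (\<bar>c\<bar> ^ DIM('a)) * (LINT x|lebesgue. f (c *\<^sub>R x))"
proof -
  have T: "(\<lambda>x::'a. 0 + (\<Sum>j\<in>Basis. (c * (x \<bullet> j)) *\<^sub>R j)) = (\<lambda>x. c *\<^sub>R x)"
    by (auto simp: euclidean_representation simp flip: scaleR_scaleR scaleR_sum_right)
  have leb: "lebesgue = density (distr lebesgue lebesgue (\<lambda>x::'a. c *\<^sub>R x)) (\<lambda>_. ennreal (\<bar>c\<bar> ^ DIM('a)))"
    using lebesgue_affine_euclidean[of "\<lambda>_. c" "0::'a"] c unfolding T by (simp add: ennreal_power)
  have m: "(\<lambda>x::'a. c *\<^sub>R x) \<in> lebesgue \<rightarrow>\<^sub>M lebesgue"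
    using lebesgue_affine_measurable[of "\<lambda>_. c" "0::'a"] c unfolding T by simp
  have "(LINT x|lebesgue. f x) = (LINT x|density (distr lebesgue lebesgue (\<lambda>x::'a. c *\<^sub>R x)) (\<lambda>_. ennreal (\<bar>c\<bar> ^ DIM('a))). f x)"
    by (rule arg_cong[of _ _ "\<lambda>M. integral\<^sup>L M f", OF leb])
  also have "\<dots> = (LINT x|distr lebesgue lebesgue (\<lambda>x::'a. c *\<^sub>R x). (\<bar>c\<bar> ^ DIM('a)) *\<^sub>R f x)"
    using f by (intro integral_density) auto
  also have "\<dots> = (LINT x|lebesgue. (\<bar>c\<bar> ^ DIM('a)) *\<^sub>R f (c *\<^sub>R x))"
    using f m by (intro integral_distr) auto
  finally show ?thesis by (simp add: scaleR_conv_of_real)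
qed

lemma integrable_indicator_ball: "integrable lebesgue (indicat_real (ball (a::'a::euclidean_space) r))"
  and integrable_indicator_cball: "integrable lebesgue (indicat_real (cball (a::'a::euclidean_space) r))"
  by (simp_all flip: lmeasurable_iff_integrable)

text \<open>Testing with the indicator of the unit ball and rescaling by \<open>R = 1 / e\<close>.\<close>
lemma has_mean_value_ball:
  fixes u :: "'a::euclidean_space \<Rightarrow> complex"
  assumes u: "has_mean_value u m" and um: "u \<in> borel_measurable lebesgue"
  shows "((\<lambda>R::real. (LINT y:ball 0 R|lebesgue. u y) / of_real (measure lebesgue (ball (0::'a) R))) \<longlongrightarrow> m) at_top"
proof -
  define V where "V = measure lebesgue (ball (0::'a) 1)"
  have V: "0 < V" unfolding V_def by (simp add: content_ball_pos)
  let ?\<phi> = "indicat_real (ball (0::'a) 1)"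
  have int: "integrable lebesgue (\<lambda>x. of_real (?\<phi> x) :: complex)"
    by (intro integrable_of_real integrable_indicator_ball)
  have int_val: "(LINT x|lebesgue. (of_real (?\<phi> x) :: complex)) = of_real V"
    unfolding integral_of_real V_def by simp
  have "((\<lambda>e. LINT x|lebesgue. u (x /\<^sub>R e) * of_real (?\<phi> x)) \<longlongrightarrow> m * of_real V) (at_right 0)"
    using u int int_val unfolding has_mean_value_def by auto
  then have lim: "((\<lambda>e. (LINT x|lebesgue. u (x /\<^sub>R e) * of_real (?\<phi> x)) / of_real V) \<longlongrightarrow> m) (at_right 0)"
    using V by (auto intro: tendsto_eq_intros)
  have eq: "(LINT x|lebesgue. u (x /\<^sub>R e) * of_real (?\<phi> x)) / of_real V
     = (LINT y:ball 0 (inverse e)|lebesgue. u y) / of_real (measure lebesgue (ball (0::'a) (inverse e)))" if e: "0 < e" for e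
  proof -
    let ?\<psi> = "indicat_real (ball (0::'a) (inverse e))"
    have ind: "?\<phi> (e *\<^sub>R x) = ?\<psi> x" for x
      using e by (auto simp: indicator_def field_simps)
    have um': "(\<lambda>x. u x * of_real (?\<psi> x)) \<in> borel_measurable lebesgue"
      by (intro borel_measurable_times um borel_measurable_integrable[OF integrable_of_real] integrable_indicator_ball)
    have \<psi>: "?\<psi> (inverse e *\<^sub>R x) = ?\<phi> x" for x using e by (auto simp: indicator_def)
    have 1: "(LINT x|lebesgue. u x * of_real (?\<psi> x))
        = of_real (\<bar>inverse e\<bar> ^ DIM('a)) * (LINT x|lebesgue. u (x /\<^sub>R e) * of_real (?\<phi> x))"
      unfolding \<psi>[symmetric] using e by (intro lebesgue_integral_scale um') auto
    have "(LINT x|lebesgue. (of_real (?\<psi> x) :: complex))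
        = of_real (\<bar>inverse e\<bar> ^ DIM('a)) * (LINT x|lebesgue. of_real (?\<phi> x))"
      unfolding \<psi>[symmetric] using e
      by (intro lebesgue_integral_scale borel_measurable_integrable[OF integrable_of_real] integrable_indicator_ball) auto
    then have "complex_of_real (measure lebesgue (ball (0::'a) (inverse e)))
        = of_real (\<bar>inverse e\<bar> ^ DIM('a)) * of_real V"
      unfolding int_val unfolding integral_of_real by simp
    then show ?thesis using 1 e
      by (simp add: set_lebesgue_integral_def scaleR_conv_of_real mult.commute)
  qed
  have "((\<lambda>e. (LINT y:ball 0 (inverse e)|lebesgue. u y) / of_real (measure lebesgue (ball (0::'a) (inverse e)))) \<longlongrightarrow> m) (at_right 0)"
    by (rule Lim_transform_eventually[OF lim]) (use eq in \<open>auto simp: eventually_at_right_field intro: exI[of _ 1]\<close>)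
  then show ?thesis by (subst filterlim_at_top_to_right)
qed

lemma mean_value_eq:
  fixes u :: "'a::euclidean_space \<Rightarrow> complex"
  assumes "has_mean_value u m"
  shows "mean_value u = m"
  unfolding mean_value_def
proof (rule the_equality[where P = "has_mean_value u", OF assms])
  fix m' assume m': "has_mean_value u m'"
  define V where "V = measure lebesgue (ball (0::'a) 1)"
  have V: "0 < V" unfolding V_def by (simp add: content_ball_pos)
  let ?\<phi> = "\<lambda>x. complex_of_real (indicat_real (ball (0::'a) 1) x)"
  have int: "integrable lebesgue ?\<phi>"
    by (intro integrable_of_real integrable_indicator_ball)
  have int_val: "(LINT x|lebesgue. ?\<phi> x) = of_real V"
    unfolding integral_of_real V_def by simp
  have lim: "((\<lambda>e. LINT x|lebesgue. u (x /\<^sub>R e) * ?\<phi> x) \<longlongrightarrow> k * of_real V) (at_right 0)" if "has_mean_value u k" for k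
    using that int unfolding has_mean_value_def int_val[symmetric] by blast
  have "m' * of_real V = m * of_real V"
    by (rule tendsto_unique[OF trivial_limit_at_right_real lim[OF m'] lim[OF assms]])
  then show "m' = m" using V by simp
qed

lemma integral_tent_pos:
  "integrable lebesgue (\<lambda>x::'a::euclidean_space. max 0 (1 - norm x))"
  "0 < (LINT x|lebesgue. max 0 (1 - norm (x::'a)))"
proof -
  show int: "integrable lebesgue (\<lambda>x::'a. max 0 (1 - norm x))"
  proof (rule Bochner_Integration.integrable_bound)
    show "integrable lebesgue (indicat_real (cball (0::'a) 1))" by (rule integrable_indicator_cball)
    show "(\<lambda>x::'a. max 0 (1 - norm x)) \<in> borel_measurable lebesgue"
      by (intro measurable_completion) measurable
  qed (auto simp: indicator_def)
  have "0 < measure lebesgue (ball (0::'a) (1/2)) * (1/2)" by (simp add: content_ball_pos)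
  also have "\<dots> = (LINT x|lebesgue. indicat_real (ball (0::'a) (1/2)) x * (1/2))" by simp
  also have "\<dots> \<le> (LINT x|lebesgue. max 0 (1 - norm (x::'a)))"
    by (intro Bochner_Integration.integral_mono int integrable_mult_left integrable_indicator_ball)
       (auto simp: indicator_def)
  finally show "0 < (LINT x|lebesgue. max 0 (1 - norm (x::'a)))" .
qed

text \<open>Testing with the tent function \<open>\<phi>\<close>: since \<open>u (x / e + h) = u ((x + e h) / e)\<close>, the translation of \<open>u\<close> by \<open>h\<close> becomes a
  translation of \<open>\<phi>\<close> by \<open>e h\<close>, and \<open>\<phi>\<close> is Lipschitz with bounded support.\<close>
lemma mean_value_translate:
  fixes u :: "'a::euclidean_space \<Rightarrow> complex"
  assumes u: "has_mean_value u m" and u': "has_mean_value (\<lambda>x. u (x + h)) m'"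
    and um: "u \<in> borel_measurable lebesgue" and ub: "\<And>x. norm (u x) \<le> C"
  shows "m' = m"
proof -
  define \<phi> where "\<phi> x = max 0 (1 - norm x)" for x :: 'a
  define c where "c = (LINT x|lebesgue. \<phi> x)"
  let ?J = "\<lambda>e. LINT x|lebesgue. u (x /\<^sub>R e + h) * of_real (\<phi> x)" and ?K = "\<lambda>e. LINT x|lebesgue. u (x /\<^sub>R e) * of_real (\<phi> x)"
  let ?D = "\<lambda>e x. u (x /\<^sub>R e) * of_real (\<phi> (x - e *\<^sub>R h)) - u (x /\<^sub>R e) * of_real (\<phi> x)"
  have c: "c > 0" and int: "integrable lebesgue \<phi>" using integral_tent_pos[where 'a='a] unfolding c_def \<phi>_def by auto
  have C: "0 \<le> C" using ub[of 0] norm_ge_zero[of "u 0"] by linarith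
  have [measurable]: "\<phi> \<in> borel_measurable borel" unfolding \<phi>_def by measurable
  note um[measurable]
  have intc: "integrable lebesgue (\<lambda>x. of_real (\<phi> x) :: complex)" using int by (rule integrable_of_real)
  have lim1: "((\<lambda>e. ?K e) \<longlongrightarrow> m * of_real c) (at_right 0)"
    and lim2: "((\<lambda>e. ?J e) \<longlongrightarrow> m' * of_real c) (at_right 0)"
    using u u' intc unfolding has_mean_value_def c_def by (auto simp: integral_of_real)
  define W where "W = measure lebesgue (cball (0::'a) (1 + norm h))"
  have bound: "norm (?J e - ?K e) \<le> C * (e * norm h) * W"
    if e: "0 < e" "e \<le> 1" for e
  proof -
    have sc: "(\<lambda>x::'a. x /\<^sub>R e) \<in> lebesgue \<rightarrow>\<^sub>M lebesgue"
      using lebesgue_measurable_scaling[of "inverse e"] by simp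
    have tr: "(\<lambda>x::'a. x + (- e *\<^sub>R h)) \<in> lebesgue \<rightarrow>\<^sub>M lebesgue" by (rule lebesgue_translation_measurable)
    have m1[measurable]: "(\<lambda>x. u (x /\<^sub>R e)) \<in> borel_measurable lebesgue"
      using measurable_compose[OF sc um] .
    have m2[measurable]: "(\<lambda>x. \<phi> (x - e *\<^sub>R h)) \<in> borel_measurable lebesgue" "\<phi> \<in> borel_measurable lebesgue"
      by (intro measurable_completion; measurable)+
    have tr2: "(\<lambda>x::'a. x + e *\<^sub>R h) \<in> lebesgue \<rightarrow>\<^sub>M lebesgue" by (rule lebesgue_translation_measurable)
    have eq: "?J e = (LINT x|lebesgue. u (x /\<^sub>R e) * of_real (\<phi> (x - e *\<^sub>R h)))"
    proof -
      have "(LINT x|lebesgue. u (x /\<^sub>R e) * of_real (\<phi> (x - e *\<^sub>R h)))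
          = (LINT x|distr lebesgue lebesgue (\<lambda>x. x + e *\<^sub>R h). u (x /\<^sub>R e) * of_real (\<phi> (x - e *\<^sub>R h)))"
        by (simp add: distr_lebesgue_translation)
      also have "\<dots> = (LINT x|lebesgue. u ((x + e *\<^sub>R h) /\<^sub>R e) * of_real (\<phi> (x + e *\<^sub>R h - e *\<^sub>R h)))"
        by (rule integral_distr[OF tr2]) measurable
      finally show ?thesis using e by (simp add: scaleR_add_right)
    qed
    have int_shift: "integrable lebesgue (\<lambda>x. \<phi> (x - e *\<^sub>R h))"
      using integrable_distr[OF tr, of \<phi>] int unfolding distr_lebesgue_translation by simp
    have iu: "integrable lebesgue (\<lambda>x. u (x /\<^sub>R e) * of_real (f x))" if "integrable lebesgue f" for f
    proof (rule Bochner_Integration.integrable_bound)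
      show "integrable lebesgue (\<lambda>x. C * \<bar>f x\<bar>)" using that by (intro integrable_mult_right integrable_abs)
      show "(\<lambda>x. u (x /\<^sub>R e) * of_real (f x)) \<in> borel_measurable lebesgue" using that by measurable
      show "AE x in lebesgue. norm (u (x /\<^sub>R e) * of_real (f x)) \<le> norm (C * \<bar>f x\<bar>)"
        using ub C by (auto simp: norm_mult abs_mult intro!: mult_right_mono)
    qed
    have lip: "\<bar>\<phi> (x - e *\<^sub>R h) - \<phi> x\<bar> \<le> e * norm h * indicat_real (cball 0 (1 + norm h)) x" for x
    proof -
      have n1: "norm (x - e *\<^sub>R h) \<le> norm x + e * norm h" "norm x \<le> norm (x - e *\<^sub>R h) + e * norm h"
        using norm_triangle_ineq4[of x "e *\<^sub>R h"] norm_triangle_ineq[of "x - e *\<^sub>R h" "e *\<^sub>R h"] e by auto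
      have "e * norm h \<le> norm h" using e by (simp add: mult_left_le_one_le)
      then show ?thesis using n1 e unfolding \<phi>_def by (auto simp: indicator_def max_def)
    qed
    have iW: "integrable lebesgue (indicat_real (cball (0::'a) (1 + norm h)))"
      by (rule integrable_indicator_cball)
    have "norm (?J e - ?K e)
      = norm (LINT x|lebesgue. ?D e x)"
      unfolding eq by (subst Bochner_Integration.integral_diff[OF iu[OF int_shift] iu[OF int]]) simp
    also have "\<dots> \<le> (LINT x|lebesgue. norm (?D e x))"
      by (rule integral_norm_bound)
    also have "\<dots> \<le> (LINT x|lebesgue. C * (e * norm h * indicat_real (cball (0::'a) (1 + norm h)) x))"
    proof (rule Bochner_Integration.integral_mono)
      show "integrable lebesgue (\<lambda>x. norm (?D e x))"
        by (intro integrable_norm Bochner_Integration.integrable_diff iu int int_shift)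
      show "integrable lebesgue (\<lambda>x. C * (e * norm h * indicat_real (cball (0::'a) (1 + norm h)) x))"
        by (intro integrable_mult_right iW)
      fix x
      have "norm (?D e x) = norm (u (x /\<^sub>R e)) * \<bar>\<phi> (x - e *\<^sub>R h) - \<phi> x\<bar>"
        by (metis norm_mult norm_of_real of_real_diff right_diff_distrib)
      also have "\<dots> \<le> C * (e * norm h * indicat_real (cball 0 (1 + norm h)) x)"
        by (intro mult_mono ub lip C) auto
      finally show "norm (?D e x) \<le> C * (e * norm h * indicat_real (cball 0 (1 + norm h)) x)" .
    qed
    also have "\<dots> = C * (e * norm h) * W" by (simp add: W_def)
    finally show ?thesis .
  qed
  have "((\<lambda>e. ?J e - ?K e) \<longlongrightarrow> 0) (at_right 0)"
  proof (rule Lim_null_comparison)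
    show "\<forall>\<^sub>F e in at_right 0. norm (?J e - ?K e) \<le> C * (e * norm h) * W"
      using bound by (auto simp: eventually_at_right_field intro: exI[of _ 1])
    show "((\<lambda>e. C * (e * norm h) * W) \<longlongrightarrow> 0) (at_right 0)"
      by (rule tendsto_eq_intros refl | simp)+
  qed
  moreover have "((\<lambda>e. ?J e - ?K e) \<longlongrightarrow> m' * of_real c - m * of_real c) (at_right 0)"
    by (intro tendsto_diff lim1 lim2)
  ultimately have "m' * of_real c - m * of_real c = 0"
    using tendsto_unique[OF trivial_limit_at_right_real] by blast
  then show ?thesis using c by simp
qed

section \<open>Shifts along the spectrum and invariance of the M-measure\<close>

locale almost_periodic_setting =
  fixes A :: "('a::euclidean_space \<Rightarrow> complex) set"
    and G :: "'a functional monoid" (structure)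
    and \<beta> :: "'a functional measure"
  assumes class_AA: "class_AA A G" and M_measure: "M_measure A \<beta>"

sublocale almost_periodic_setting \<subseteq> mean_value_algebra A
  using class_AA by unfold_locales (auto simp: class_AA_def)

sublocale almost_periodic_setting \<subseteq> group G
  using class_AA by (simp add: class_AA_def)

sublocale almost_periodic_setting \<subseteq> \<beta>: prob_space \<beta>
  using M_measure by (simp add: M_measure_def)

context almost_periodic_setting
begin

lemma carrier_eq: "carrier G = spectrum A"
  and continuous_mult: "continuous_on (spectrum A \<times> spectrum A) (\<lambda>(s, r). s \<otimes> r)"
  and dirac_mult: "dirac A x \<otimes> dirac A y = dirac A (x + y)"
  and dirac_mult_inv: "dirac A x \<otimes> (inv\<^bsub>G\<^esub> dirac A y) = dirac A (x - y)"
  and continuous_inv: "continuous_on (spectrum A) (\<lambda>s. inv\<^bsub>G\<^esub> s)"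
  using class_AA by (auto simp: class_AA_def)

lemma mult_in_spectrum: "s \<in> spectrum A \<Longrightarrow> r \<in> spectrum A \<Longrightarrow> s \<otimes> r \<in> spectrum A"
  and inv_in_spectrum: "s \<in> spectrum A \<Longrightarrow> inv\<^bsub>G\<^esub> s \<in> spectrum A"
  using m_closed inv_closed unfolding carrier_eq by auto

lemma mult_inv_cancel:
  assumes "s \<in> spectrum A" "r \<in> spectrum A"
  shows "s \<otimes> r \<otimes> inv\<^bsub>G\<^esub> r = s" "s \<otimes> inv\<^bsub>G\<^esub> r \<otimes> r = s"
  using assms by (simp_all add: m_assoc carrier_eq r_inv l_inv flip: carrier_eq)

lemma inv_dirac: "inv\<^bsub>G\<^esub> dirac A y = dirac A (- y)"
proof -
  have "dirac A 0 = \<one>\<^bsub>G\<^esub>"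
    using dirac_mult[of 0 0] dirac_in[of 0] by (metis add.left_neutral carrier_eq l_cancel_one')
  then show ?thesis using dirac_mult_inv[of 0 y] dirac_in[of y] by (metis carrier_eq diff_0 inv_closed l_one)
qed

lemma sets_beta: "sets \<beta> = sets (restrict_space borel (spectrum A))"
  using M_measure by (simp add: M_measure_def)

lemma space_beta: "space \<beta> = spectrum A"
  using sets_eq_imp_space_eq[OF sets_beta] by (simp add: space_restrict_space)

lemma measurable_beta_continuous:
  fixes f :: "'a functional \<Rightarrow> 'b::topological_space"
  shows "continuous_on (spectrum A) f \<Longrightarrow> f \<in> borel_measurable \<beta>"
  using borel_measurable_continuous_on_restrict measurable_cong_sets[OF sets_beta refl] by blast

lemma measurable_eval [measurable]: "(\<lambda>s. s u) \<in> borel_measurable \<beta>"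
  by (intro measurable_beta_continuous continuous_on_eval)

lemma integrable_eval: "u \<in> A \<Longrightarrow> integrable \<beta> (\<lambda>s. s u)"
  by (rule \<beta>.integrable_const_bound[where B = "sup_norm u"])
     (auto simp: space_beta intro!: AE_I2 character_bound)

lemma measurable_in: "u \<in> A \<Longrightarrow> u \<in> borel_measurable lebesgue"
  by (rule measurable_completion) (simp add: borel_measurable_continuous_onI continuous_in)

lemma mean_value_integral: "u \<in> A \<Longrightarrow> has_mean_value u (LINT s|\<beta>. s u)"
  using has_mean[of u] mean_value_eq[of u] M_measure by (auto simp: M_measure_def gelfand_def)

lemma integral_eval_translate:
  assumes u: "u \<in> A" shows "(LINT s|\<beta>. s (\<lambda>x. u (x + h))) = (LINT s|\<beta>. s u)"
  by (rule mean_value_translate[OF mean_value_integral[OF u] mean_value_integral[OF translate_in[OF u]]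
        measurable_in[OF u] norm_le_sup_norm[OF u]])

text \<open>For \<open>q = \<delta> h\<close> this is the translate \<open>y \<mapsto> u (y + h)\<close>.\<close>
definition shift :: "'a functional \<Rightarrow> ('a \<Rightarrow> complex) \<Rightarrow> 'a \<Rightarrow> complex" where
  "shift q u y = (dirac A y \<otimes> q) u"

context
  fixes q assumes q: "q \<in> spectrum A"
begin

lemma continuous_right_mult: "continuous_on (spectrum A) (\<lambda>s. s \<otimes> q)"
proof -
  have "continuous_on (spectrum A) (\<lambda>s. (\<lambda>(s, r). s \<otimes> r) (s, q))"
    by (rule continuous_on_compose2[OF continuous_mult])
       (auto intro!: continuous_on_Pair continuous_on_const continuous_on_id q)
  then show ?thesis by simp
qed

text \<open>The function \<open>s \<mapsto> \<langle>s + q, u\<rangle>\<close> is continuous on the spectrum, hence the Gelfand transform of an element of \<open>A\<close>; evaluated at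
  Dirac masses this element is \<open>shift q u\<close>.\<close>
lemma shift_in: "u \<in> A \<Longrightarrow> shift q u \<in> A"
  and gelfand_shift: "u \<in> A \<Longrightarrow> s \<in> spectrum A \<Longrightarrow> s (shift q u) = (s \<otimes> q) u"
proof -
  assume u: "u \<in> A"
  have "continuous_on (spectrum A) (\<lambda>s. (s \<otimes> q) u)"
    by (rule continuous_on_product_then_coordinatewise[OF continuous_right_mult])
  then obtain b where b: "b \<in> A" "\<And>s. s \<in> spectrum A \<Longrightarrow> s b = (s \<otimes> q) u"
    using gelfand_onto by blast
  have "b = shift q u"
    unfolding shift_def by (rule ext) (use b dirac_in dirac_apply in metis)
  then show "shift q u \<in> A" "s \<in> spectrum A \<Longrightarrow> s (shift q u) = (s \<otimes> q) u" using b by auto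
qed

lemma shift_diff: "u \<in> A \<Longrightarrow> v \<in> A \<Longrightarrow> shift q (\<lambda>x. u x - v x) = (\<lambda>x. shift q u x - shift q v x)"
  unfolding shift_def using character_diff[OF mult_in_spectrum[OF dirac_in q]] by auto

lemma sup_norm_shift_le: "u \<in> A \<Longrightarrow> sup_norm (shift q u) \<le> sup_norm u"
  by (rule sup_norm_least) (auto simp: shift_def intro!: character_bound mult_in_spectrum dirac_in q)

lemma measurable_right_mult [measurable]: "(\<lambda>s. s \<otimes> q) \<in> \<beta> \<rightarrow>\<^sub>M \<beta>"
proof -
  have "(\<lambda>s. s \<otimes> q) \<in> \<beta> \<rightarrow>\<^sub>M restrict_space borel (spectrum A)"
    by (intro measurable_restrict_space2 measurable_beta_continuous continuous_right_mult)
       (auto simp: space_beta mult_in_spectrum q)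
  then show ?thesis using measurable_cong_sets[OF refl sets_beta] by blast
qed

end

lemma shift_shift_inv:
  assumes "q \<in> spectrum A" "u \<in> A"
  shows "shift q (shift (inv\<^bsub>G\<^esub> q) u) = u" "shift (inv\<^bsub>G\<^esub> q) (shift q u) = u"
proof -
  show "shift q (shift (inv\<^bsub>G\<^esub> q) u) = u"
    unfolding shift_def[of q] using assms
    by (simp add: gelfand_shift inv_in_spectrum mult_in_spectrum dirac_in mult_inv_cancel dirac_apply)
  show "shift (inv\<^bsub>G\<^esub> q) (shift q u) = u"
    unfolding shift_def[of "inv\<^bsub>G\<^esub> q"] using assms
    by (simp add: gelfand_shift inv_in_spectrum mult_in_spectrum dirac_in mult_inv_cancel dirac_apply)
qed

lemma sup_norm_shift:
  assumes "q \<in> spectrum A" "u \<in> A" shows "sup_norm (shift q u) = sup_norm u"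
  using sup_norm_shift_le[OF assms] sup_norm_shift_le[OF inv_in_spectrum[OF assms(1)] shift_in[OF assms]]
    shift_shift_inv(2)[OF assms] by simp

text \<open>Uniformity in \<open>y\<close> comes from compactness: the continuous function \<open>(r, s) \<mapsto> \<langle>s + r, u\<rangle>\<close> is close to its values
  at \<open>r = q\<close> for \<open>r\<close> in a neighbourhood of \<open>q\<close> that does not depend on \<open>s\<close>.\<close>
lemma translate_tendsto_shift:
  assumes q: "q \<in> spectrum A" and h: "(\<lambda>n. dirac A (h n)) \<longlonglongrightarrow> q" and u: "u \<in> A"
  shows "(\<lambda>n. sup_norm (\<lambda>y. u (y + h n) - shift q u y)) \<longlonglongrightarrow> 0"
proof (rule tendstoI)
  fix e :: real assume e: "0 < e"
  have cont: "continuous_on (spectrum A \<times> spectrum A) (\<lambda>(r, s). (s \<otimes> r) u)"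
  proof -
    have "continuous_on (spectrum A \<times> spectrum A) (\<lambda>z. (\<lambda>(s, r). s \<otimes> r) (snd z, fst z))"
      by (rule continuous_on_compose2[OF continuous_mult])
         (auto intro!: continuous_on_Pair continuous_on_fst continuous_on_snd continuous_on_id)
    from continuous_on_product_then_coordinatewise[OF this, of u] show ?thesis by (simp add: case_prod_unfold)
  qed
  obtain X where X: "q \<in> X" "open X"
    "\<forall>r\<in>X \<inter> spectrum A. \<forall>s\<in>spectrum A. dist ((s \<otimes> r) u) ((s \<otimes> q) u) \<le> e / 2"
    by (rule continuous_on_prod_compactE[OF cont compact_spectrum q half_gt_zero[OF e], simplified prod.case])
  have "\<forall>\<^sub>F n in sequentially. dirac A (h n) \<in> X" using topological_tendstoD[OF h X(2,1)] .
  then show "\<forall>\<^sub>F n in sequentially. dist (sup_norm (\<lambda>y. u (y + h n) - shift q u y)) 0 < e"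
  proof eventually_elim
    case (elim n)
    have in_A: "(\<lambda>y. u (y + h n) - shift q u y) \<in> A" by (intro diff_in translate_in u shift_in q)
    have "sup_norm (\<lambda>y. u (y + h n) - shift q u y) \<le> e / 2"
    proof (rule sup_norm_least)
      fix y
      have "u (y + h n) = (dirac A y \<otimes> dirac A (h n)) u" by (simp add: dirac_mult dirac_apply u)
      then show "norm (u (y + h n) - shift q u y) \<le> e / 2"
        using X(3) elim dirac_in by (auto simp: shift_def dist_norm)
    qed
    then show ?case using sup_norm_ge0[OF in_A] e by simp
  qed
qed

text \<open>Invariance of \<open>\<beta>\<close> under \<open>q\<close> is inherited from the mean values of translates, through a sequence of Dirac masses that
  converges to \<open>q\<close>.  Both shifts that occur, by \<open>r\<close> and by its inverse, have such a sequence.\<close>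
definition dirac_limit :: "'a functional \<Rightarrow> bool" where
  "dirac_limit q \<longleftrightarrow> q \<in> spectrum A \<and> (\<exists>h. (\<lambda>n. dirac A (h n)) \<longlonglongrightarrow> q)"

text \<open>The Gelfand transform of \<open>shift q u\<close> is a uniform limit of those of translates of \<open>u\<close>, which all have the mean value of \<open>u\<close>.\<close>
lemma integral_right_mult:
  assumes q: "dirac_limit q" and u: "u \<in> A"
  shows "(LINT s|\<beta>. (s \<otimes> q) u) = (LINT s|\<beta>. s u)"
proof -
  obtain h where h: "(\<lambda>n. dirac A (h n)) \<longlonglongrightarrow> q" and qs: "q \<in> spectrum A" using q by (auto simp: dirac_limit_def)
  have shift: "(LINT s|\<beta>. (s \<otimes> q) u) = (LINT s|\<beta>. s (shift q u))"
    by (intro Bochner_Integration.integral_cong) (auto simp: gelfand_shift qs u space_beta)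
  have "norm ((LINT s|\<beta>. s u) - (LINT s|\<beta>. s (shift q u))) \<le> sup_norm (\<lambda>y. u (y + h n) - shift q u y)" for n
  proof -
    have in_A: "(\<lambda>y. u (y + h n) - shift q u y) \<in> A" by (intro diff_in translate_in u shift_in qs)
    have "(LINT s|\<beta>. s u) - (LINT s|\<beta>. s (shift q u)) = (LINT s|\<beta>. s (\<lambda>y. u (y + h n))) - (LINT s|\<beta>. s (shift q u))"
      by (simp add: integral_eval_translate[OF u])
    also have "\<dots> = (LINT s|\<beta>. s (\<lambda>y. u (y + h n)) - s (shift q u))"
      by (intro Bochner_Integration.integral_diff[symmetric] integrable_eval translate_in shift_in u qs)
    also have "\<dots> = (LINT s|\<beta>. s (\<lambda>y. u (y + h n) - shift q u y))"
      by (intro Bochner_Integration.integral_cong refl, unfold space_beta)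
         (rule character_diff[symmetric, OF _ translate_in[OF u] shift_in[OF qs u]])
    also have "norm \<dots> \<le> (LINT s|\<beta>. norm (s (\<lambda>y. u (y + h n) - shift q u y)))" by (rule integral_norm_bound)
    also have "\<dots> \<le> (LINT s|\<beta>. sup_norm (\<lambda>y. u (y + h n) - shift q u y))"
      by (intro Bochner_Integration.integral_mono integrable_norm integrable_eval in_A) (auto simp: space_beta character_bound in_A)
    finally show ?thesis by (simp add: \<beta>.prob_space)
  qed
  then have "norm ((LINT s|\<beta>. s u) - (LINT s|\<beta>. s (shift q u))) \<le> 0"
    by (intro LIMSEQ_le_const[OF translate_tendsto_shift[OF qs h u]]) auto
  then show ?thesis using shift by simp
qed

lemma compact_in_sets:
  assumes "compact K" "K \<subseteq> spectrum A" shows "K \<in> sets \<beta>"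
  unfolding sets_beta using compact_spectrum_closed[OF assms] closed_spectrum assms(2)
  by (auto simp: sets_restrict_space_iff)

text \<open>Let \<open>\<gamma>\<close> be the image measure.  By \<open>integral_right_mult\<close>, both measures give the same integral to Gelfand
  transforms.  If \<open>K\<close> is compact and \<open>L\<close> is a compact subset of its complement that almost exhausts it for \<open>\<beta>\<close>, a Gelfand
  transform that is nearly \<open>1\<close> on \<open>K\<close> and nearly \<open>0\<close> on \<open>L\<close> shows \<open>\<gamma> K \<le> \<beta> K\<close>.
  Inner regularity of \<open>\<beta>\<close> extends this inequality to all measurable sets, and for probability measures the inequality
  on complements gives equality.\<close>
lemma distr_right_mult:
  assumes q: "dirac_limit q" shows "distr \<beta> \<beta> (\<lambda>s. s \<otimes> q) = \<beta>"
proof -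
  let ?R = "\<lambda>s. s \<otimes> q"
  have qs: "q \<in> spectrum A" using q by (simp add: dirac_limit_def)
  note [measurable] = measurable_right_mult[OF qs]
  define \<gamma> where "\<gamma> = distr \<beta> \<beta> ?R"
  interpret \<gamma>: prob_space \<gamma> unfolding \<gamma>_def by (rule \<beta>.prob_space_distr) measurable
  have sets_\<gamma> [simp, measurable_cong]: "sets \<gamma> = sets \<beta>" by (simp add: \<gamma>_def)
  have space_\<gamma>: "space \<gamma> = spectrum A" by (simp add: \<gamma>_def space_beta)
  have reg: "emeasure \<beta> E = (SUP K\<in>{K. compact K \<and> K \<subseteq> E}. emeasure \<beta> K)" if "E \<in> sets \<beta>" for E
    using M_measure that by (simp add: M_measure_def)
  have compact_le: "measure \<gamma> K \<le> measure \<beta> K" if K: "compact K" "K \<subseteq> spectrum A" for K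
  proof (rule field_le_epsilon)
    fix \<epsilon> :: real assume \<epsilon>: "0 < \<epsilon>"
    have KS: "K \<in> sets \<beta>" by (rule compact_in_sets[OF K])
    have cK: "spectrum A - K \<in> sets \<beta>" using sets.compl_sets[OF KS] by (simp add: space_beta)
    obtain e where e: "0 < e" "e < 1" "2 * e < \<epsilon> / 2" using \<epsilon> by (metis field_lbound_gt_zero mult_pos_pos divide_pos_pos less_divide_eq_numeral1(1) mult.commute zero_less_numeral zero_less_one)
    obtain L where L: "compact L" "L \<subseteq> spectrum A - K" "measure \<beta> (spectrum A - K) < measure \<beta> L + \<epsilon> / 2"
    proof (rule ccontr)
      assume "\<not> thesis"
      then have "\<And>L. compact L \<Longrightarrow> L \<subseteq> spectrum A - K \<Longrightarrow> measure \<beta> L \<le> measure \<beta> (spectrum A - K) - \<epsilon> / 2"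
        using that by force
      then have "emeasure \<beta> (spectrum A - K) \<le> ennreal (measure \<beta> (spectrum A - K) - \<epsilon> / 2)"
        by (subst reg[OF cK], unfold \<beta>.emeasure_eq_measure, intro SUP_least ennreal_leI) auto
      moreover have "0 \<le> measure \<beta> (spectrum A - K) - \<epsilon> / 2"
        using \<open>\<And>L. compact L \<Longrightarrow> L \<subseteq> spectrum A - K \<Longrightarrow> measure \<beta> L \<le> measure \<beta> (spectrum A - K) - \<epsilon> / 2\<close>[of "{}"] by simp
      ultimately show False using \<epsilon> by (simp add: \<beta>.emeasure_eq_measure)
    qed
    have LA: "L \<subseteq> spectrum A" "L \<inter> K = {}" using L(2) by auto
    obtain u f where u: "u \<in> A" "\<And>s. s \<in> spectrum A \<Longrightarrow> s u = of_real (f s)"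
      and f01: "\<And>s. s \<in> spectrum A \<Longrightarrow> 0 \<le> f s \<and> f s \<le> 1"
      and fL: "\<And>s. s \<in> L \<Longrightarrow> f s < e" and fK: "\<And>s. s \<in> K \<Longrightarrow> 1 - e < f s"
      using gelfand_separates_compacts[OF L(1) LA(1) K LA(2) e(1,2)] by metis
    have Re_u: "Re (s u) = f s" if "s \<in> spectrum A" for s using u(2)[OF that] by simp
    have LS: "L \<in> sets \<beta>" by (rule compact_in_sets[OF L(1) LA(1)])
    have ig: "integrable \<gamma> (\<lambda>s. Re (s u))"
      by (rule \<gamma>.integrable_const_bound[where B = 1]) (use f01 Re_u in \<open>auto simp: space_\<gamma>\<close>)
    have ib: "integrable \<beta> (\<lambda>s. Re (s u))"
      by (rule \<beta>.integrable_const_bound[where B = 1]) (use f01 Re_u in \<open>auto simp: space_beta\<close>)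
    have "(1 - e) * measure \<gamma> K = (LINT s|\<gamma>. (1 - e) * indicat_real K s)"
      using KS by (simp add: space_\<gamma> Int_absorb2[OF K(2)])
    also have "\<dots> \<le> (LINT s|\<gamma>. Re (s u))"
    proof (rule Bochner_Integration.integral_mono[OF _ ig])
      show "integrable \<gamma> (\<lambda>s. (1 - e) * indicat_real K s)" using KS by (intro integrable_mult_right) (auto simp: \<gamma>.emeasure_eq_measure)
      show "(1 - e) * indicat_real K s \<le> Re (s u)" if "s \<in> space \<gamma>" for s
        using that fK[of s] f01[of s] Re_u[of s] by (auto simp: space_\<gamma> indicator_def)
    qed
    also have "\<dots> = (LINT s|\<beta>. Re (?R s u))" unfolding \<gamma>_def by (rule integral_distr) measurable
    also have "\<dots> = Re (LINT s|\<beta>. ?R s u)"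
    proof (rule integral_Re)
      have "integrable \<beta> (\<lambda>s. s (shift q u))" by (intro integrable_eval shift_in qs u)
      then show "complex_integrable \<beta> (\<lambda>s. ?R s u)"
        by (rule Bochner_Integration.integrable_cong[THEN iffD1, rotated 2]) (auto simp: space_beta gelfand_shift qs u)
    qed
    also have "\<dots> = Re (LINT s|\<beta>. s u)" by (simp add: integral_right_mult[OF q u(1)])
    also have "\<dots> = (LINT s|\<beta>. Re (s u))" by (rule integral_Re[OF integrable_eval[OF u(1)], symmetric])
    also have "\<dots> \<le> (LINT s|\<beta>. e + indicat_real (spectrum A - L) s)"
    proof (rule Bochner_Integration.integral_mono[OF ib])
      show "integrable \<beta> (\<lambda>s. e + indicat_real (spectrum A - L) s)"
        using LS by (intro Bochner_Integration.integrable_add) (auto simp: \<beta>.emeasure_eq_measure space_beta[symmetric] intro!: integrable_real_indicator)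
      show "Re (s u) \<le> e + indicat_real (spectrum A - L) s" if "s \<in> space \<beta>" for s
        using that fL[of s] f01[of s] Re_u[of s] e by (auto simp: space_beta indicator_def)
    qed
    also have "\<dots> = e + measure \<beta> (spectrum A - L)"
      using LS by (subst Bochner_Integration.integral_add) (auto simp: \<beta>.emeasure_eq_measure space_beta[symmetric] \<beta>.prob_space intro!: integrable_real_indicator)
    also have "\<dots> = e + (1 - measure \<beta> L)" using \<beta>.prob_compl[OF LS] by (simp add: space_beta)
    also have "\<dots> \<le> e + (1 - measure \<beta> (spectrum A - K) + \<epsilon> / 2)" using L(3) by simp
    also have "\<dots> = e + (measure \<beta> K + \<epsilon> / 2)" using \<beta>.prob_compl[OF KS] by (simp add: space_beta)
    finally have "(1 - e) * measure \<gamma> K \<le> e + (measure \<beta> K + \<epsilon> / 2)" .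
    moreover have "e * measure \<gamma> K \<le> e" using e \<gamma>.prob_le_1[of K] by (simp add: mult_left_le)
    ultimately show "measure \<gamma> K \<le> measure \<beta> K + \<epsilon>" using e(3) by (simp add: algebra_simps)
  qed
  have le: "measure \<gamma> E \<le> measure \<beta> E" if E: "E \<in> sets \<beta>" for E
  proof -
    have E': "?R -` E \<inter> spectrum A \<in> sets \<beta>" using measurable_sets[OF measurable_right_mult[OF qs] E] by (simp add: space_beta)
    have "emeasure \<gamma> E = emeasure \<beta> (?R -` E \<inter> spectrum A)"
      unfolding \<gamma>_def using E by (subst emeasure_distr) (auto simp: space_beta)
    also have "\<dots> \<le> emeasure \<beta> E"
      unfolding reg[OF E']
    proof (rule SUP_least)
      fix K assume "K \<in> {K. compact K \<and> K \<subseteq> ?R -` E \<inter> spectrum A}"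
      then have K: "compact K" "K \<subseteq> spectrum A" "?R ` K \<subseteq> E" by auto
      have RK: "compact (?R ` K)" "?R ` K \<subseteq> spectrum A"
        using K by (auto intro!: compact_continuous_image continuous_on_subset[OF continuous_right_mult] mult_in_spectrum qs)
      have RKS: "?R ` K \<in> sets \<beta>" by (rule compact_in_sets[OF RK])
      have "emeasure \<beta> K \<le> emeasure \<beta> (?R -` (?R ` K) \<inter> space \<beta>)"
        by (rule emeasure_mono) (use K measurable_sets[OF measurable_right_mult[OF qs] RKS] in \<open>auto simp: space_beta\<close>)
      also have "\<dots> = emeasure \<gamma> (?R ` K)" unfolding \<gamma>_def using RKS by (subst emeasure_distr) auto
      also have "\<dots> \<le> emeasure \<beta> (?R ` K)"
        using compact_le[OF RK] by (simp add: \<beta>.emeasure_eq_measure \<gamma>.emeasure_eq_measure)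
      also have "\<dots> \<le> emeasure \<beta> E" by (rule emeasure_mono[OF K(3) E])
      finally show "emeasure \<beta> K \<le> emeasure \<beta> E" .
    qed
    finally show ?thesis by (simp add: \<beta>.emeasure_eq_measure \<gamma>.emeasure_eq_measure)
  qed
  have "\<gamma> = \<beta>"
  proof (rule measure_eqI)
    fix E assume "E \<in> sets \<gamma>"
    then have E: "E \<in> sets \<beta>" by simp
    have "measure \<gamma> (space \<gamma> - E) \<le> measure \<beta> (space \<beta> - E)"
      using le[OF sets.compl_sets[OF E]] by (simp add: space_\<gamma> space_beta)
    then have "measure \<beta> E \<le> measure \<gamma> E" using \<beta>.prob_compl[OF E] \<gamma>.prob_compl[of E] E by simp
    then show "emeasure \<gamma> E = emeasure \<beta> E"
      using le[OF E] by (simp add: \<beta>.emeasure_eq_measure \<gamma>.emeasure_eq_measure)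
  qed simp
  then show ?thesis by (simp add: \<gamma>_def)
qed

lemma dirac_limit_inv: "dirac_limit q \<Longrightarrow> dirac_limit (inv\<^bsub>G\<^esub> q)"
proof -
  assume "dirac_limit q"
  then obtain h where h: "(\<lambda>n. dirac A (h n)) \<longlonglongrightarrow> q" and q: "q \<in> spectrum A" by (auto simp: dirac_limit_def)
  have "(\<lambda>n. inv\<^bsub>G\<^esub> dirac A (h n)) \<longlonglongrightarrow> inv\<^bsub>G\<^esub> q"
    by (rule continuous_on_tendsto_compose[OF continuous_inv h q]) (auto simp: dirac_in)
  then show ?thesis unfolding dirac_limit_def using inv_in_spectrum[OF q] by (auto simp: inv_dirac)
qed

end

section \<open>The Besicovitch seminorm\<close>

abbreviation ball_on :: "real \<Rightarrow> 'a::euclidean_space measure" where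
  "ball_on R \<equiv> lebesgue_on (ball 0 R)"

abbreviation ball_vol :: "'a::euclidean_space itself \<Rightarrow> real \<Rightarrow> real" where
  "ball_vol _ R \<equiv> measure lebesgue (ball (0::'a) R)"

text \<open>The \<open>L\<^sup>p\<close> mean over the ball of radius \<open>R\<close>, for which Minkowski's inequality holds; the Besicovitch seminorm is its limit superior.\<close>
definition ball_norm :: "real \<Rightarrow> real \<Rightarrow> ('a::euclidean_space \<Rightarrow> complex) \<Rightarrow> real" where
  "ball_norm p R u = Lp_norm p (ball_on R) u / ball_vol TYPE('a) R powr (1 / p)"

abbreviation ball_dist ::
  "real \<Rightarrow> real \<Rightarrow> ('a::euclidean_space \<Rightarrow> complex) \<Rightarrow> ('a \<Rightarrow> complex) \<Rightarrow> real" where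
  "ball_dist p R u v \<equiv> ball_norm p R (\<lambda>y. u y - v y)"

abbreviation besic_dist ::
  "real \<Rightarrow> ('a::euclidean_space \<Rightarrow> complex) \<Rightarrow> ('a \<Rightarrow> complex) \<Rightarrow> real" where
  "besic_dist p u v \<equiv> besic_norm p (\<lambda>y. u y - v y)"

lemma ball_norm_nonneg [simp]: "0 \<le> ball_norm p R u"
  by (simp add: ball_norm_def)

lemma ball_vol_pos: "0 < R \<Longrightarrow> 0 < ball_vol TYPE('a::euclidean_space) R"
  by (simp add: content_ball_pos)

lemma ball_vol_at_top: "filterlim (ball_vol TYPE('a::euclidean_space)) at_top at_top"
proof -
  let ?c = "unit_ball_vol (real DIM('a))"
  have "filterlim (\<lambda>R::real. ?c * R) at_top at_top"
    by (rule filterlim_tendsto_pos_mult_at_top[OF tendsto_const _ filterlim_ident]) simp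
  then show ?thesis
  proof (rule filterlim_at_top_mono)
    show "\<forall>\<^sub>F R in at_top. ?c * R \<le> ball_vol TYPE('a) R"
      using eventually_ge_at_top[of "1::real"]
    proof eventually_elim
      case (elim R)
      have "R ^ 1 \<le> R ^ DIM('a)" using elim by (intro power_increasing) auto
      then show ?case using elim by (simp add: content_ball)
    qed
  qed
qed

lemma filterlim_powr_at_top: "0 < (a::real) \<Longrightarrow> filterlim (\<lambda>x. x powr a) at_top at_top"
proof -
  assume "0 < a"
  then have "filterlim (\<lambda>x. exp (a * ln x)) at_top at_top"
    by (intro filterlim_compose[OF exp_at_top] filterlim_tendsto_pos_mult_at_top[OF tendsto_const] ln_at_top)
  then show ?thesis
    by (rule filterlim_mono_eventually)
       (use eventually_gt_at_top[of 0] in \<open>auto simp: powr_def elim: eventually_mono\<close>)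
qed

lemma Lp_loc_measurable: "u \<in> Lp_loc p \<Longrightarrow> u \<in> borel_measurable lebesgue"
  by (simp add: Lp_loc_def)

lemma Lp_loc_iff:
  "u \<in> Lp_loc p \<longleftrightarrow> u \<in> borel_measurable lebesgue \<and> (\<forall>R. u \<in> Lp p (ball_on R))"
proof (intro iffI conjI allI)
  assume u: "u \<in> Lp_loc p"
  then show m: "u \<in> borel_measurable lebesgue" by (rule Lp_loc_measurable)
  fix R
  have "set_integrable lebesgue (cball 0 R) (\<lambda>y. norm (u y) powr p)" using u by (simp add: Lp_loc_def)
  then have "set_integrable lebesgue (ball 0 R) (\<lambda>y. norm (u y) powr p)"
    by (rule set_integrable_subset) auto
  then show "u \<in> Lp p (ball_on R)"
    using m by (auto simp: Lp_def integrable_restrict_space set_integrable_def measurable_restrict_space1)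
next
  assume u: "u \<in> borel_measurable lebesgue \<and> (\<forall>R. u \<in> Lp p (ball_on R))"
  have "set_integrable lebesgue K (\<lambda>y. norm (u y) powr p)" if K: "compact K" for K
  proof -
    obtain R where "K \<subseteq> ball 0 R" using bounded_subset_ballD[OF compact_imp_bounded[OF K], of 0] by blast
    moreover have "set_integrable lebesgue (ball 0 R) (\<lambda>y. norm (u y) powr p)"
      using u by (auto simp: Lp_def integrable_restrict_space set_integrable_def)
    ultimately show ?thesis using K by (auto intro: set_integrable_subset lmeasurable_compact fmeasurableD)
  qed
  then show "u \<in> Lp_loc p" using u by (simp add: Lp_loc_def)
qed

lemma bounded_Lp_ball:
  assumes u: "u \<in> borel_measurable lebesgue" and C: "\<And>y. y \<in> ball 0 R \<Longrightarrow> norm (u y) \<le> C" and p: "1 \<le> p"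
  shows "u \<in> Lp p (ball_on R)"
proof -
  interpret finite_measure "ball_on R :: 'a measure"
    by (rule finite_measureI)
       (simp add: emeasure_restrict_space less_top emeasure_lborel_ball_finite[unfolded infinity_ennreal_def])
  have [measurable]: "u \<in> borel_measurable (ball_on R)" by (rule measurable_restrict_space1[OF u])
  have "integrable (ball_on R) (\<lambda>y. norm (u y) powr p)"
  proof (rule integrable_const_bound[where B = "C powr p"])
    show "AE x in ball_on R. norm (norm (u x) powr p) \<le> C powr p"
      using C p by (intro AE_I2) (auto intro!: powr_mono2)
  qed measurable
  then show ?thesis by (simp add: Lp_def)
qed

lemma ball_norm_powr:
  fixes u :: "'a::euclidean_space \<Rightarrow> complex"
  assumes p: "1 \<le> p" and R: "0 < R"
  shows "ball_norm p R u powr p = (LINT y:ball 0 R|lebesgue. norm (u y) powr p) / ball_vol TYPE('a) R"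
proof -
  have "ball_norm p R u powr p = Lp_norm p (ball_on R) u powr p / ball_vol TYPE('a) R"
    unfolding ball_norm_def using p ball_vol_pos[OF R, where 'a='a] by (simp add: powr_divide powr_powr)
  then show ?thesis
    unfolding Lp_norm_powr[OF p] by (simp add: integral_restrict_space set_lebesgue_integral_def)
qed

lemma limsup_mean_eq:
  assumes p: "1 \<le> p"
  shows "limsup_mean p u = Limsup at_top (\<lambda>R. ereal (ball_norm p R u powr p))"
  unfolding limsup_mean_def
  by (rule Limsup_eq) (use eventually_gt_at_top[of 0] in \<open>eventually_elim, simp add: ball_norm_powr[OF p]\<close>)

lemma limsup_mean_nonneg: assumes "1 \<le> p" shows "0 \<le> limsup_mean p u"
  unfolding limsup_mean_eq[OF assms] by (rule le_Limsup) (auto intro: always_eventually)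

lemma besic_norm_nonneg [simp]: "0 \<le> besic_norm p u"
  by (simp add: besic_norm_def)

lemma ball_norm_triangle:
  assumes p: "1 \<le> p" and "u \<in> Lp_loc p" "v \<in> Lp_loc p" "w \<in> Lp_loc p"
  shows "ball_dist p R u w \<le> ball_dist p R u v + ball_dist p R v w"
  unfolding ball_norm_def add_divide_distrib[symmetric] using assms
  by (intro divide_right_mono Lp_norm_triangle) (auto simp: Lp_loc_iff)

lemma ball_norm_mono:
  assumes p: "1 \<le> p" and u: "u \<in> Lp_loc p" and v: "v \<in> Lp_loc p"
    and le: "\<And>y. norm y < R \<Longrightarrow> norm (u y) \<le> norm (v y)"
  shows "ball_norm p R u \<le> ball_norm p R v"
  unfolding ball_norm_def
proof (rule divide_right_mono)
  have "(LINT x|ball_on R. norm (u x) powr p) \<le> (LINT x|ball_on R. norm (v x) powr p)"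
    using u v le p by (intro Bochner_Integration.integral_mono) (auto simp: Lp_loc_iff Lp_def intro!: powr_mono2)
  then show "Lp_norm p (ball_on R) u \<le> Lp_norm p (ball_on R) v"
    by (subst Lp_norm_le_iff[OF p]) (auto simp: Lp_norm_powr[OF p])
qed simp

lemma ball_norm_of_real_norm: "ball_norm p R (\<lambda>y. of_real (norm (u y))) = ball_norm p R u"
  by (simp add: ball_norm_def Lp_norm_def)

lemma ball_norm_zero: "ball_norm p R (\<lambda>_. 0) = 0"
  by (simp add: ball_norm_def Lp_norm_def)

lemma Lp_loc_diff: "1 \<le> p \<Longrightarrow> u \<in> Lp_loc p \<Longrightarrow> v \<in> Lp_loc p \<Longrightarrow> (\<lambda>y. u y - v y) \<in> Lp_loc p"
  by (auto simp: Lp_loc_iff Lp_diff)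

lemma Lp_loc_add: "1 \<le> p \<Longrightarrow> u \<in> Lp_loc p \<Longrightarrow> v \<in> Lp_loc p \<Longrightarrow> (\<lambda>y. u y + v y) \<in> Lp_loc p"
  by (auto simp: Lp_loc_iff Lp_add)

text \<open>Together with the next lemma this describes the Besicovitch seminorm by what holds for all large balls, so that
  its properties reduce to those of \<open>ball_norm\<close> and the conversions between real and extended real numbers stay here.\<close>
lemma besic_norm_leI:
  assumes p: "1 \<le> p" and u: "u \<in> Lp_loc p" and c: "0 \<le> c" and ev: "\<forall>\<^sub>F R in at_top. ball_norm p R u \<le> c"
  shows "u \<in> marcinkiewicz p" and "besic_norm p u \<le> c"
proof -
  have le: "limsup_mean p u \<le> ereal (c powr p)"
    unfolding limsup_mean_eq[OF p] using ev
    by (intro Limsup_bounded) (auto elim!: eventually_mono intro!: powr_mono2 simp: order_trans[OF zero_le_one p])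
  then show "u \<in> marcinkiewicz p" using u by (auto simp: marcinkiewicz_def)
  have "real_of_ereal (limsup_mean p u) \<le> c powr p"
    using le limsup_mean_nonneg[OF p, of u] by (cases "limsup_mean p u") auto
  moreover have "0 \<le> real_of_ereal (limsup_mean p u)" using limsup_mean_nonneg[OF p, of u] by (rule real_of_ereal_pos)
  ultimately have "besic_norm p u \<le> (c powr p) powr (1 / p)"
    unfolding besic_norm_def using p by (intro powr_mono2) auto
  then show "besic_norm p u \<le> c" using p c by (simp add: powr_powr)
qed

lemma besic_norm_lessD:
  assumes p: "1 \<le> p" and u: "u \<in> marcinkiewicz p" and less: "besic_norm p u < c"
  shows "\<forall>\<^sub>F R in at_top. ball_norm p R u < c"
proof -
  have fin: "limsup_mean p u < \<infinity>" using u by (simp add: marcinkiewicz_def)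
  have c: "0 \<le> c" using less besic_norm_nonneg[of p u] by linarith
  have "besic_norm p u powr p < c powr p" using less p by (intro powr_less_mono2) auto
  then have "real_of_ereal (limsup_mean p u) < c powr p"
    using p limsup_mean_nonneg[OF p, of u] by (simp add: besic_norm_def powr_powr real_of_ereal_pos)
  then have "limsup_mean p u < ereal (c powr p)"
    using fin limsup_mean_nonneg[OF p, of u] by (cases "limsup_mean p u") auto
  then have "\<forall>\<^sub>F R in at_top. ereal (ball_norm p R u powr p) < ereal (c powr p)"
    unfolding limsup_mean_eq[OF p] by (rule Limsup_lessD)
  then show ?thesis
  proof eventually_elim
    case (elim R)
    then show ?case using powr_mono2[of p c "ball_norm p R u"] p c by (force simp: not_less)
  qed
qed

lemma marcinkiewicz_Lp_loc: "u \<in> marcinkiewicz p \<Longrightarrow> u \<in> Lp_loc p"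
  by (simp add: marcinkiewicz_def)

lemma besic_dist_triangle_Lp_loc:
  assumes p: "1 \<le> p" and L: "u \<in> Lp_loc p" "v \<in> Lp_loc p" "w \<in> Lp_loc p"
    and uv: "(\<lambda>y. u y - v y) \<in> marcinkiewicz p" and vw: "(\<lambda>y. v y - w y) \<in> marcinkiewicz p"
  shows "(\<lambda>y. u y - w y) \<in> marcinkiewicz p"
    and "besic_dist p u w \<le> besic_dist p u v + besic_dist p v w"
proof -
  have ev: "\<forall>\<^sub>F R in at_top. ball_dist p R u w \<le> besic_dist p u v + besic_dist p v w + e"
    if e: "0 < e" for e
  proof -
    have "\<forall>\<^sub>F R in at_top. ball_dist p R u v < besic_dist p u v + e / 2"
      by (rule besic_norm_lessD[OF p uv]) (use e in simp)
    moreover have "\<forall>\<^sub>F R in at_top. ball_dist p R v w < besic_dist p v w + e / 2"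
      by (rule besic_norm_lessD[OF p vw]) (use e in simp)
    ultimately show ?thesis
    proof eventually_elim
      case (elim R)
      then show ?case using ball_norm_triangle[OF p L, of R] by simp
    qed
  qed
  note le = besic_norm_leI[OF p Lp_loc_diff[OF p L(1,3)] _ ev]
  show "(\<lambda>y. u y - w y) \<in> marcinkiewicz p" by (rule le(1)[of 1]) auto
  show "besic_dist p u w \<le> besic_dist p u v + besic_dist p v w"
    by (rule field_le_epsilon, rule le(2)) auto
qed

lemma besic_norm_zero: "1 \<le> p \<Longrightarrow> besic_norm p (\<lambda>_. 0) = 0" "1 \<le> p \<Longrightarrow> (\<lambda>_. 0) \<in> marcinkiewicz p"
proof -
  assume p: "1 \<le> p"
  have "(\<lambda>_. 0) \<in> Lp_loc p" by (auto simp: Lp_loc_iff Lp_def)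
  from besic_norm_leI[OF p this, of 0]
  show "besic_norm p (\<lambda>_. 0) = 0" "(\<lambda>_. 0) \<in> marcinkiewicz p"
    by (auto simp: ball_norm_zero intro: antisym)
qed

lemma besic_dist_commute: "besic_dist p f g = besic_dist p g f"
  by (simp add: besic_norm_def limsup_mean_def norm_minus_commute)

lemma marcinkiewicz_diff:
  assumes p: "1 \<le> p" and u: "u \<in> marcinkiewicz p" and v: "v \<in> marcinkiewicz p"
  shows "(\<lambda>y. u y - v y) \<in> marcinkiewicz p"
proof (rule besic_dist_triangle_Lp_loc(1)[OF p marcinkiewicz_Lp_loc[OF u] _ marcinkiewicz_Lp_loc[OF v]])
  show "(\<lambda>_. 0) \<in> Lp_loc p" by (rule marcinkiewicz_Lp_loc[OF besic_norm_zero(2)[OF p]])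
  show "(\<lambda>y. u y - 0) \<in> marcinkiewicz p" using u by simp
  show "(\<lambda>y. 0 - v y) \<in> marcinkiewicz p"
    using v by (auto simp: marcinkiewicz_def Lp_loc_def limsup_mean_def)
qed

lemma besic_dist_triangle:
  assumes p: "1 \<le> p" and "u \<in> marcinkiewicz p" "v \<in> marcinkiewicz p" "w \<in> marcinkiewicz p"
  shows "besic_dist p u w \<le> besic_dist p u v + besic_dist p v w"
  by (intro besic_dist_triangle_Lp_loc(2) marcinkiewicz_Lp_loc marcinkiewicz_diff assms)

lemma besic_norm_diff_diff:
  assumes p: "1 \<le> p" and M: "u \<in> marcinkiewicz p" "v \<in> marcinkiewicz p" "a \<in> marcinkiewicz p" "b \<in> marcinkiewicz p"
  shows "besic_norm p (\<lambda>y. (u y - v y) - (a y - b y)) \<le> besic_dist p u a + besic_dist p v b"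
proof -
  have "besic_norm p (\<lambda>y. (u y - a y) - (v y - b y))
      \<le> besic_norm p (\<lambda>y. (u y - a y) - 0) + besic_norm p (\<lambda>y. 0 - (v y - b y))"
    by (intro besic_dist_triangle p marcinkiewicz_diff M besic_norm_zero)
  then show ?thesis using besic_dist_commute[of p "\<lambda>_. 0" "\<lambda>y. v y - b y"] by (simp add: algebra_simps)
qed

lemma besic_norm_diff_le:
  assumes p: "1 \<le> p" and "u \<in> marcinkiewicz p" "v \<in> marcinkiewicz p"
  shows "\<bar>besic_norm p u - besic_norm p v\<bar> \<le> besic_dist p u v"
  using besic_dist_triangle[OF p assms(2,3) besic_norm_zero(2)[OF p]]
    besic_dist_triangle[OF p assms(3,2) besic_norm_zero(2)[OF p]] besic_dist_commute[of p u v]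
  by (auto simp: abs_le_iff)

context almost_periodic_setting
begin

context
  fixes p :: real assumes p: "1 \<le> p"
begin

lemma in_Lp_loc: "u \<in> A \<Longrightarrow> u \<in> Lp_loc p"
proof -
  assume u: "u \<in> A"
  then have "u \<in> Lp p (ball_on R)" for R
    by (rule bounded_Lp_ball[OF measurable_in norm_le_sup_norm[OF u] p])
  then show ?thesis unfolding Lp_loc_iff using measurable_in[OF u] by blast
qed

text \<open>For an even integer \<open>p\<close> this is algebra; in general, \<open>s \<mapsto> \<bar>s u\<bar> powr p\<close> is continuous on the spectrum, hence a Gelfand
  transform.\<close>
lemma abs_powr_in:
  assumes u: "u \<in> A"
  shows "(\<lambda>y. of_real (norm (u y) powr p)) \<in> A"
    and "s \<in> spectrum A \<Longrightarrow> s (\<lambda>y. of_real (norm (u y) powr p)) = of_real (norm (s u) powr p)"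
proof -
  have "continuous_on (spectrum A) (\<lambda>s. norm (s u) powr p)"
    using p by (intro continuous_on_powr' continuous_on_norm continuous_on_eval continuous_on_const) auto
  then obtain a where a: "a \<in> A" "\<And>s. s \<in> spectrum A \<Longrightarrow> s a = of_real (norm (s u) powr p)"
    using gelfand_onto_real by blast
  have "a = (\<lambda>y. of_real (norm (u y) powr p))"
  proof
    fix y show "a y = of_real (norm (u y) powr p)"
      using a(2)[OF dirac_in, of y] by (simp add: dirac_apply a(1) u)
  qed
  then show "(\<lambda>y. of_real (norm (u y) powr p)) \<in> A"
    "s \<in> spectrum A \<Longrightarrow> s (\<lambda>y. of_real (norm (u y) powr p)) = of_real (norm (s u) powr p)"
    using a by auto
qed

text \<open>The mean value of \<open>\<bar>u\<bar> powr p \<in> A\<close>, computed over balls on the one hand and over the spectrum on the other.\<close>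
lemma limsup_mean_in:
  assumes u: "u \<in> A" shows "limsup_mean p u = ereal (LINT s|\<beta>. norm (s u) powr p)"
proof -
  let ?a = "\<lambda>y. complex_of_real (norm (u y) powr p)"
  note a = abs_powr_in[OF u]
  have "(LINT s|\<beta>. s ?a) = (LINT s|\<beta>. complex_of_real (norm (s u) powr p))"
    by (intro Bochner_Integration.integral_cong refl, unfold space_beta) (rule a(2))
  then have "has_mean_value ?a (of_real (LINT s|\<beta>. norm (s u) powr p))"
    using mean_value_integral[OF a(1)] by (simp only: integral_complex_of_real)
  from has_mean_value_ball[OF this measurable_in[OF a(1)]]
  have "((\<lambda>R. complex_of_real ((LINT y:ball 0 R|lebesgue. norm (u y) powr p) / ball_vol TYPE('a) R))
      \<longlongrightarrow> of_real (LINT s|\<beta>. norm (s u) powr p)) at_top"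
    by (simp add: set_lebesgue_integral_def scaleR_conv_of_real flip: of_real_mult)
  then have "((\<lambda>R. (LINT y:ball 0 R|lebesgue. norm (u y) powr p) / ball_vol TYPE('a) R)
      \<longlongrightarrow> (LINT s|\<beta>. norm (s u) powr p)) at_top"
    by (rule tendsto_of_real_iff[THEN iffD1])
  then have "((\<lambda>R. ereal ((LINT y:ball 0 R|lebesgue. norm (u y) powr p) / ball_vol TYPE('a) R))
      \<longlongrightarrow> ereal (LINT s|\<beta>. norm (s u) powr p)) at_top"
    by (rule tendsto_ereal)
  then show ?thesis unfolding limsup_mean_def by (intro lim_imp_Limsup) auto
qed

lemma in_marcinkiewicz: "u \<in> A \<Longrightarrow> u \<in> marcinkiewicz p"
  by (simp add: marcinkiewicz_def in_Lp_loc limsup_mean_in)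

lemma besic_norm_isometry: "u \<in> A \<Longrightarrow> besic_norm p u = Lp_norm p \<beta> (\<lambda>s. s u)"
  by (simp add: besic_norm_def Lp_norm_def limsup_mean_in)

lemma in_besicovitch: "u \<in> A \<Longrightarrow> u \<in> besicovitch p A"
  unfolding besicovitch_def using in_marcinkiewicz by (auto intro!: bexI[of _ u] simp: besic_norm_zero(1)[OF p])

lemma besicovitch_marcinkiewicz: "u \<in> besicovitch p A \<Longrightarrow> u \<in> marcinkiewicz p"
  by (simp add: besicovitch_def)

lemma besicovitch_approx:
  assumes "u \<in> besicovitch p A"
  obtains a where "\<And>n::nat. a n \<in> A" "(\<lambda>n. besic_dist p u (a n)) \<longlonglongrightarrow> 0"
proof -
  have "\<exists>a\<in>A. besic_dist p u a < inverse (real (Suc n))" for n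
    using assms unfolding besicovitch_def by auto
  then obtain a where a: "\<And>n. a n \<in> A" "\<And>n. besic_dist p u (a n) < inverse (real (Suc n))" by metis
  have "(\<lambda>n. besic_dist p u (a n)) \<longlonglongrightarrow> 0"
    by (rule tendsto_sandwich[OF _ _ tendsto_const LIMSEQ_inverse_real_of_nat])
       (use a(2) in \<open>auto intro!: always_eventually less_imp_le\<close>)
  then show ?thesis using a that by blast
qed

lemma besicovitchI:
  assumes "u \<in> marcinkiewicz p" "\<And>n::nat. a n \<in> A" "(\<lambda>n. besic_dist p u (a n)) \<longlonglongrightarrow> 0"
  shows "u \<in> besicovitch p A"
  unfolding besicovitch_def
proof (intro CollectI conjI allI impI assms(1))
  fix e :: real assume "0 < e"
  from order_tendstoD(2)[OF assms(3) this] obtain n where "besic_dist p u (a n) < e"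
    by (auto dest: eventually_happens)
  then show "\<exists>a\<in>A. besic_dist p u a < e" using assms(2) by blast
qed

lemma besicovitch_diff:
  assumes u: "u \<in> besicovitch p A" and v: "v \<in> besicovitch p A"
  shows "(\<lambda>y. u y - v y) \<in> besicovitch p A"
proof -
  obtain a where a: "\<And>n::nat. a n \<in> A" "(\<lambda>n. besic_dist p u (a n)) \<longlonglongrightarrow> 0" using besicovitch_approx[OF u] by blast
  obtain b where b: "\<And>n::nat. b n \<in> A" "(\<lambda>n. besic_dist p v (b n)) \<longlonglongrightarrow> 0" using besicovitch_approx[OF v] by blast
  note M = besicovitch_marcinkiewicz[OF u] besicovitch_marcinkiewicz[OF v] in_marcinkiewicz[OF a(1)] in_marcinkiewicz[OF b(1)]
  show ?thesis
  proof (rule besicovitchI)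
    show "(\<lambda>y. u y - v y) \<in> marcinkiewicz p" by (intro marcinkiewicz_diff p M)
    show "(\<lambda>y. a n y - b n y) \<in> A" for n by (intro diff_in a b)
    show "(\<lambda>n. besic_norm p (\<lambda>y. (u y - v y) - (a n y - b n y))) \<longlonglongrightarrow> 0"
    proof (rule tendsto_sandwich[OF _ _ tendsto_const])
      show "(\<lambda>n. besic_dist p u (a n) + besic_dist p v (b n)) \<longlonglongrightarrow> 0"
        using tendsto_add[OF a(2) b(2)] by simp
      have "besic_norm p (\<lambda>y. (u y - v y) - (a n y - b n y)) \<le> besic_dist p u (a n) + besic_dist p v (b n)" for n
        by (intro besic_norm_diff_diff p M)
      then show "\<forall>\<^sub>F n in sequentially. besic_norm p (\<lambda>y. (u y - v y) - (a n y - b n y)) \<le> besic_dist p u (a n) + besic_dist p v (b n)"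
        by simp
      show "\<forall>\<^sub>F n in sequentially. 0 \<le> besic_norm p (\<lambda>y. (u y - v y) - (a n y - b n y))" by simp
    qed
  qed
qed

lemma indicator_ball_norm_tendsto_0:
  assumes S: "0 \<le> S"
  shows "((\<lambda>R. ball_norm p R (\<lambda>y::'a. of_real (S * indicat_real (ball 0 r) y))) \<longlongrightarrow> 0) at_top"
proof -
  define K where "K = (S powr p * ball_vol TYPE('a) r) powr (1 / p)"
  have K: "K powr p = S powr p * ball_vol TYPE('a) r" using p by (simp add: K_def powr_powr)
  have K0: "0 \<le> K" by (simp add: K_def)
  have "ball_norm p R (\<lambda>y::'a. of_real (S * indicat_real (ball 0 r) y)) \<le> K / ball_vol TYPE('a) R powr (1 / p)" for R
    unfolding ball_norm_def
  proof (rule divide_right_mono)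
    have eq: "norm (complex_of_real (S * indicat_real (ball 0 r) y)) powr p = S powr p * indicat_real (ball 0 r) y" for y :: 'a
      using S by (auto simp: indicator_def)
    have "(LINT y|ball_on R. norm (complex_of_real (S * indicat_real (ball (0::'a) r) y)) powr p)
        = (LINT y|lebesgue. indicator (ball 0 R) y * (S powr p * indicat_real (ball (0::'a) r) y))"
      unfolding eq by (subst integral_restrict_space) auto
    also have "\<dots> \<le> (LINT y|lebesgue. S powr p * indicat_real (ball (0::'a) r) y)"
    proof (rule integral_mono')
      show "integrable lebesgue (\<lambda>y. S powr p * indicat_real (ball (0::'a) r) y)"
        by (intro integrable_mult_right integrable_indicator_ball)
    qed (auto simp: indicator_def)
    also have "\<dots> = K powr p" by (simp add: K)
    finally show "Lp_norm p (ball_on R) (\<lambda>y::'a. of_real (S * indicat_real (ball 0 r) y)) \<le> K"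
      by (rule Lp_norm_le_iff[OF p K0, THEN iffD2])
  qed simp
  then have "\<forall>\<^sub>F R in at_top. norm (ball_norm p R (\<lambda>y::'a. of_real (S * indicat_real (ball 0 r) y))) \<le> K / ball_vol TYPE('a) R powr (1 / p)"
    by simp
  moreover have "((\<lambda>R. K / ball_vol TYPE('a) R powr (1 / p)) \<longlongrightarrow> 0) at_top"
  proof (rule tendsto_divide_0[OF tendsto_const filterlim_at_top_imp_at_infinity])
    show "filterlim (\<lambda>R. ball_vol TYPE('a) R powr (1 / p)) at_top at_top"
      using filterlim_compose[OF filterlim_powr_at_top ball_vol_at_top, of "1 / p"] p by simp
  qed
  ultimately show ?thesis by (rule Lim_null_comparison)
qed

text \<open>Marcinkiewicz's construction: \<open>w\<close> agrees with \<open>b n\<close> on the annulus between the radii \<open>r n\<close> and \<open>r (n + 1)\<close>.  The radii grow so fast that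
  for \<open>R \<ge> r n\<close> the means over the ball of radius \<open>R\<close> of the differences of the first functions \<open>b j\<close> are already close to their limits
  superior, and the ball of radius \<open>r (n - 1)\<close> occupies a negligible part of it.  On a ball whose radius lies between
  \<open>r n\<close> and \<open>r (n + 1)\<close>, the function \<open>w\<close> is then seen only through \<open>b (n - 1)\<close> and \<open>b n\<close>.\<close>
lemma besicovitch_complete:
  fixes b :: "nat \<Rightarrow> 'a \<Rightarrow> complex"
  assumes b: "\<And>n. b n \<in> A"
    and Cauchy: "\<And>e. 0 < e \<Longrightarrow> \<exists>N. \<forall>m\<ge>N. \<forall>n\<ge>N. besic_dist p (b m) (b n) < e"
  obtains w where "w \<in> besicovitch p A" "(\<lambda>n. besic_dist p w (b n)) \<longlonglongrightarrow> 0"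
proof -
  (* S n bounds all differences of the first functions uniformly; it bounds w - b m on the ball
     of radius r (n - 1), where w is one of them. *)
  define S where "S n = (\<Sum>j\<le>n. 2 * sup_norm (b j))" for n
  have S0: "0 \<le> S n" for n unfolding S_def by (intro sum_nonneg mult_nonneg_nonneg sup_norm_ge0 b) auto
  define D where "D k m = (\<lambda>y. b k y - b m y)" for k m
  have D: "D k m \<in> A" for k m unfolding D_def by (intro diff_in b)
  define I where "I n r = (\<lambda>y::'a. complex_of_real (S n * indicat_real (ball 0 r) y))" for n r
  define good where "good n r R' \<longleftrightarrow> (\<forall>R\<ge>R'. (\<forall>k\<le>n. \<forall>m\<le>n. ball_norm p R (D k m) \<le> besic_norm p (D k m) + (1/2)^n)
      \<and> ball_norm p R (I n r) \<le> (1/2)^n)" for n r R'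
  have "\<exists>r. \<forall>n. r n < r (Suc n) \<and> real n < r (Suc n) \<and> good (Suc n) (r n) (r (Suc n))"
  proof -
    have "\<exists>r. \<forall>n. (True :: bool) \<and> (r n < r (Suc n) \<and> real n < r (Suc n) \<and> good (Suc n) (r n) (r (Suc n)))"
    proof (rule dependent_nat_choice)
      fix x :: real and n
      have "\<forall>\<^sub>F R in at_top. \<forall>k\<in>{..Suc n}. \<forall>m\<in>{..Suc n}. ball_norm p R (D k m) < besic_norm p (D k m) + (1/2)^Suc n"
        by (intro eventually_ball_finite ballI besic_norm_lessD[OF p] in_marcinkiewicz D) auto
      moreover have "((\<lambda>R. ball_norm p R (I (Suc n) x)) \<longlongrightarrow> 0) at_top"
        unfolding I_def by (rule indicator_ball_norm_tendsto_0[OF S0])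
      then have "\<forall>\<^sub>F R in at_top. ball_norm p R (I (Suc n) x) < (1/2)^Suc n"
        by (rule order_tendstoD(2)) simp
      ultimately have "\<forall>\<^sub>F R in at_top. (\<forall>k\<in>{..Suc n}. \<forall>m\<in>{..Suc n}. ball_norm p R (D k m) < besic_norm p (D k m) + (1/2)^Suc n)
          \<and> ball_norm p R (I (Suc n) x) < (1/2)^Suc n" by (rule eventually_conj)
      then obtain R0 where R0: "\<And>R. R \<ge> R0 \<Longrightarrow> (\<forall>k\<in>{..Suc n}. \<forall>m\<in>{..Suc n}. ball_norm p R (D k m) < besic_norm p (D k m) + (1/2)^Suc n)
          \<and> ball_norm p R (I (Suc n) x) < (1/2)^Suc n"
        unfolding eventually_at_top_linorder by blast
      define y where "y = Max {R0, x + 1, real n + 1}"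
      have y: "R0 \<le> y" "x < y" "real n < y" unfolding y_def by (auto simp: less_max_iff_disj)
      have "good (Suc n) x y" unfolding good_def
        using R0 y(1) by (meson atMost_iff less_imp_le order_trans)
      then show "\<exists>y. True \<and> (x < y \<and> real n < y \<and> good (Suc n) x y)" using y by blast
    qed auto
    then show ?thesis by simp
  qed
  then obtain r where r: "\<And>n. r n < r (Suc n)" "\<And>n. real n < r (Suc n)" "\<And>n. good (Suc n) (r n) (r (Suc n))" by blast
  have rmono: "strict_mono r" using r(1) by (rule strict_monoI_Suc)
  have ex: "\<exists>k. norm y < r (Suc k)" for y :: 'a
  proof -
    obtain k where "norm y < real k" using reals_Archimedean2 by blast
    then show ?thesis using r(2)[of k] by (intro exI[of _ k]) simp
  qed
  define \<kappa> where "\<kappa> y = (LEAST k. norm y < r (Suc k))" for y :: 'a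
  have \<kappa>1: "norm y < r (Suc (\<kappa> y))" for y unfolding \<kappa>_def by (rule LeastI_ex[OF ex])
  have \<kappa>_le: "\<kappa> y \<le> k" if "norm y < r (Suc k)" for y k unfolding \<kappa>_def by (rule Least_le) (rule that)
  define w where "w y = b (\<kappa> y) y" for y
  have [measurable]: "b n \<in> borel_measurable lebesgue" for n by (rule measurable_in[OF b])
  have "(\<lambda>y::'a. norm y) \<in> borel_measurable lebesgue" by (rule measurable_completion) simp
  note [measurable] = this
  have [measurable]: "\<kappa> \<in> lebesgue \<rightarrow>\<^sub>M count_space UNIV"
    unfolding \<kappa>_def by (intro measurable_Least) measurable
  have wm: "w \<in> borel_measurable lebesgue"
    unfolding w_def by (rule measurable_compose_countable[where f = b and g = \<kappa>]) measurable
  have nb: "norm (b j y) \<le> sup_norm (b j)" for j y by (rule norm_le_sup_norm[OF b])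
  have bS: "norm (b j y - b m y) \<le> S n" if "j \<le> n" "m \<le> n" for j m n y
  proof -
    have m1: "2 * sup_norm (b i) \<le> S n" if "i \<le> n" for i
      unfolding S_def by (rule member_le_sum) (use that sup_norm_ge0[OF b] in auto)
    show ?thesis using norm_triangle_ineq4[of "b j y" "b m y"] nb[of j y] nb[of m y] m1[OF that(1)] m1[OF that(2)] by linarith
  qed
  have wL: "w \<in> Lp_loc p"
    unfolding Lp_loc_iff
  proof (intro conjI wm allI)
    fix R
    obtain n where n: "R < real n" using reals_Archimedean2 by blast
    show "w \<in> Lp p (ball_on R)"
    proof (rule bounded_Lp_ball[OF wm _ p])
      fix y :: 'a assume "y \<in> ball 0 R"
      then have "\<kappa> y \<le> n" using r(2)[of n] n by (intro \<kappa>_le) simp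
      then have "norm (b (\<kappa> y) y - b n y) \<le> S n" by (intro bS) auto
      then show "norm (w y) \<le> S n + sup_norm (b n)"
        using nb[of n y] norm_triangle_ineq[of "b (\<kappa> y) y - b n y" "b n y"] by (simp add: w_def)
    qed
  qed
  have bL: "b n \<in> Lp_loc p" for n by (rule in_Lp_loc[OF b])
  have est: "ball_dist p R w (b m) \<le> besic_norm p (D (n - 1) m) + besic_norm p (D n m) + 3 * (1/2)^n"
    if n: "m \<le> n" "1 \<le> n" and R: "r n \<le> R" "R < r (Suc n)" for m n R
  proof -
    obtain n' where n': "n = Suc n'" using n(2) by (cases n) auto
    have g: "ball_norm p R (D k l) \<le> besic_norm p (D k l) + (1/2)^n" "ball_norm p R (I n (r n')) \<le> (1/2)^n"
      if "k \<le> n" "l \<le> n" for k l using r(3)[of n'] R(1) that unfolding n' good_def by auto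
    define f1 where "f1 y = complex_of_real (norm (D n' m y))" for y
    define f2 where "f2 y = complex_of_real (norm (D n m y))" for y
    have DL: "D k l \<in> Lp_loc p" for k l by (rule in_Lp_loc[OF D])
    have normL: "(\<lambda>y. complex_of_real (norm (f y))) \<in> Lp_loc p" if "f \<in> Lp_loc p" for f :: "'a \<Rightarrow> complex"
      using that by (auto simp: Lp_loc_def)
    have fL: "f1 \<in> Lp_loc p" "f2 \<in> Lp_loc p" unfolding f1_def f2_def by (intro normL DL)+
    have IL: "I n (r n') \<in> Lp_loc p"
      unfolding Lp_loc_iff
    proof (intro conjI allI)
      show m: "I n (r n') \<in> borel_measurable lebesgue"
        unfolding I_def by (intro borel_measurable_integrable[OF integrable_of_real] integrable_mult_right integrable_indicator_ball)
      show "I n (r n') \<in> Lp p (ball_on R)" for R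
        by (rule bounded_Lp_ball[OF m _ p, of _ "S n"]) (use S0 in \<open>auto simp: I_def indicator_def\<close>)
    qed
    have neg: "(\<lambda>y. - f y) \<in> Lp_loc p" if "f \<in> Lp_loc p" for f :: "'a \<Rightarrow> complex"
      using that by (auto simp: Lp_loc_def)
    have add: "ball_norm p R (\<lambda>y. f y + h y) \<le> ball_norm p R f + ball_norm p R h" if "f \<in> Lp_loc p" "h \<in> Lp_loc p" for f h :: "'a \<Rightarrow> complex"
      unfolding ball_norm_def add_divide_distrib[symmetric] using that
      by (intro divide_right_mono Lp_add p) (auto simp: Lp_loc_iff)
    have "ball_dist p R w (b m) \<le> ball_norm p R (\<lambda>y. (f1 y + f2 y) + I n (r n') y)"
    proof (rule ball_norm_mono[OF p])
      show "(\<lambda>y. w y - b m y) \<in> Lp_loc p" by (intro Lp_loc_diff p wL bL)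
      show "(\<lambda>y. (f1 y + f2 y) + I n (r n') y) \<in> Lp_loc p" by (intro Lp_loc_add p fL IL)
      fix y :: 'a assume y: "norm y < R"
      have "\<kappa> y \<le> n" using y R(2) by (intro \<kappa>_le) simp
      then consider "\<kappa> y = n" | "\<kappa> y = n'" | "Suc (\<kappa> y) \<le> n'" unfolding n' by linarith
      then have "norm (w y - b m y) \<le> norm (D n' m y) + norm (D n m y) + S n * indicat_real (ball 0 (r n')) y"
      proof cases
        case 1 then show ?thesis using S0[of n] by (auto simp: w_def D_def add_increasing2 add_increasing)
      next
        case 2 then show ?thesis using S0[of n] by (auto simp: w_def D_def add_increasing2 add_increasing)
      next
        case 3
        have "norm y < r n'" using \<kappa>1[of y] strict_mono_leD[OF rmono 3] by linarith
        moreover have "norm (w y - b m y) \<le> S n" unfolding w_def using \<open>\<kappa> y \<le> n\<close> n(1) by (rule bS)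
        ultimately show ?thesis by (simp add: add_increasing)
      qed
      also have "\<dots> = norm ((f1 y + f2 y) + I n (r n') y)"
      proof -
        have "(f1 y + f2 y) + I n (r n') y = complex_of_real (norm (D n' m y) + norm (D n m y) + S n * indicat_real (ball 0 (r n')) y)"
          by (simp add: f1_def f2_def I_def)
        moreover have "0 \<le> norm (D n' m y) + norm (D n m y) + S n * indicat_real (ball 0 (r n')) y"
          using S0 by (intro add_nonneg_nonneg mult_nonneg_nonneg) auto
        ultimately show ?thesis by (simp only: norm_of_real abs_of_nonneg)
      qed
      finally show "norm (w y - b m y) \<le> norm ((f1 y + f2 y) + I n (r n') y)" .
    qed
    also have "\<dots> \<le> ball_norm p R f1 + ball_norm p R f2 + ball_norm p R (I n (r n'))"
      using add[OF Lp_loc_add[OF p fL] IL] add[OF fL] by linarith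
    also have "\<dots> = ball_norm p R (D n' m) + ball_norm p R (D n m) + ball_norm p R (I n (r n'))"
      unfolding f1_def f2_def by (simp only: ball_norm_of_real_norm)
    also have "\<dots> \<le> besic_norm p (D (n - 1) m) + besic_norm p (D n m) + 3 * (1/2)^n"
      using g(1)[of n' m] g(1)[of n m] g(2)[of 0 0] n(1) unfolding n' by simp
    finally show ?thesis .
  qed
  have small: "\<exists>N. \<forall>m\<ge>N. (\<lambda>y. w y - b m y) \<in> marcinkiewicz p \<and> besic_dist p w (b m) \<le> e" if e: "0 < e" for e
  proof -
    obtain N where N: "\<And>m n. m \<ge> N \<Longrightarrow> n \<ge> N \<Longrightarrow> besic_norm p (D m n) < e / 3"
      using Cauchy[of "e / 3"] e unfolding D_def by auto
    have "(\<lambda>n. 3 * (1/2::real)^n) \<longlonglongrightarrow> 0"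
      by (rule tendsto_mult_right_zero[OF LIMSEQ_power_zero]) simp
    from order_tendstoD(2)[OF this, of "e / 3"] e obtain N2 where N2: "\<And>n. n \<ge> N2 \<Longrightarrow> 3 * (1/2::real)^n < e / 3"
      unfolding eventually_sequentially by auto
    have "(\<lambda>y. w y - b m y) \<in> marcinkiewicz p \<and> besic_dist p w (b m) \<le> e" if m: "m \<ge> N" for m
    proof -
      define n0 where "n0 = Suc (m + N + N2)"
      have ev: "\<forall>\<^sub>F R in at_top. ball_dist p R w (b m) \<le> e"
        using eventually_ge_at_top[of "r n0"]
      proof eventually_elim
        case (elim R)
        define n where "n = (LEAST k. R < r (Suc k))"
        obtain k where "R < real k" using reals_Archimedean2 by blast
        then have "\<exists>k. R < r (Suc k)" using r(2)[of k] by (intro exI[of _ k]) simp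
        then have n1: "R < r (Suc n)" unfolding n_def by (rule LeastI_ex)
        have "n0 < Suc n" using elim n1 strict_mono_less[OF rmono, of n0 "Suc n"] by linarith
        then obtain n' where n': "n = Suc n'" "n0 \<le> n" by (cases n) (auto simp: n0_def)
        have "\<not> R < r (Suc n')" using not_less_Least[of n' "\<lambda>k. R < r (Suc k)"] n' by (simp add: n_def)
        then have "r n \<le> R" using n' by simp
        then have "ball_dist p R w (b m) \<le> besic_norm p (D (n - 1) m) + besic_norm p (D n m) + 3 * (1/2)^n"
          using n1 n' by (intro est) (auto simp: n0_def)
        also have "\<dots> < e / 3 + e / 3 + e / 3"
          using n' m by (intro add_strict_mono N N2) (auto simp: n0_def)
        finally show ?case by simp
      qed
      show ?thesis using besic_norm_leI[OF p Lp_loc_diff[OF p wL bL] less_imp_le[OF e] ev] by blast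
    qed
    then show ?thesis by blast
  qed
  obtain m where m: "(\<lambda>y. w y - b m y) \<in> marcinkiewicz p" using small[of 1] by auto
  have "(\<lambda>y. b m y - 0) \<in> marcinkiewicz p" using in_marcinkiewicz[OF b] by simp
  from besic_dist_triangle_Lp_loc(1)[OF p wL bL marcinkiewicz_Lp_loc[OF besic_norm_zero(2)[OF p]] m this]
  have wM: "w \<in> marcinkiewicz p" by simp
  have lim: "(\<lambda>n. besic_dist p w (b n)) \<longlonglongrightarrow> 0"
  proof (rule LIMSEQ_I)
    fix e :: real assume "0 < e"
    then obtain N where N: "\<And>n. n \<ge> N \<Longrightarrow> besic_dist p w (b n) \<le> e / 2"
      using small[of "e / 2"] by auto
    show "\<exists>N. \<forall>n\<ge>N. norm (besic_dist p w (b n) - 0) < e"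
    proof (intro exI[of _ N] allI impI)
      fix n assume "n \<ge> N"
      from N[OF this] \<open>0 < e\<close> show "norm (besic_dist p w (b n) - 0) < e" by simp
    qed
  qed
  show ?thesis using that besicovitchI[OF wM b lim] lim by blast
qed

end
end

context almost_periodic_setting
begin

context
  fixes p :: real assumes p: "1 \<le> p"
begin

section \<open>Extension of the shift to Besicovitch spaces\<close>

lemma eval_Lp: "u \<in> A \<Longrightarrow> (\<lambda>s. s u) \<in> Lp p \<beta>"
proof -
  assume u: "u \<in> A"
  have "integrable \<beta> (\<lambda>s. norm (s u) powr p)"
    by (rule \<beta>.integrable_const_bound[where B = "sup_norm u powr p"])
       (use p in \<open>auto simp: space_beta intro!: AE_I2 powr_mono2 character_bound u\<close>)
  then show ?thesis by (simp add: Lp_def)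
qed

lemma besic_norm_diff_isometry:
  assumes "u \<in> A" "v \<in> A"
  shows "besic_dist p u v = Lp_norm p \<beta> (\<lambda>s. s u - s v)"
proof -
  have "Lp_norm p \<beta> (\<lambda>s. s (\<lambda>y. u y - v y)) = Lp_norm p \<beta> (\<lambda>s. s u - s v)"
    unfolding Lp_norm_def using assms
    by (intro arg_cong[where f = "\<lambda>x. x powr (1 / p)"] Bochner_Integration.integral_cong refl)
       (simp add: space_beta character_diff[OF _ assms])
  then show ?thesis using besic_norm_isometry[OF p diff_in[OF assms]] by simp
qed

text \<open>By the isometry, one approximating sequence is enough to verify the condition on all of them.\<close>
lemma gelfand_extI:
  assumes u: "u \<in> marcinkiewicz p" and f: "f \<in> Lp p \<beta>" and a: "\<And>n::nat. a n \<in> A"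
    and ua: "(\<lambda>n. besic_dist p u (a n)) \<longlonglongrightarrow> 0"
    and af: "(\<lambda>n. Lp_norm p \<beta> (\<lambda>s. s (a n) - f s)) \<longlonglongrightarrow> 0"
  shows "f \<in> gelfand_ext p A \<beta> u"
  unfolding gelfand_ext_def gelfand_def
proof (intro CollectI conjI f allI impI, elim conjE)
  fix c :: "nat \<Rightarrow> 'a \<Rightarrow> complex"
  assume "\<forall>n. c n \<in> A" and uc: "(\<lambda>n. besic_dist p u (c n)) \<longlonglongrightarrow> 0"
  then have c: "c n \<in> A" for n by simp
  have "Lp_norm p \<beta> (\<lambda>s. s (c n) - f s)
      \<le> (besic_dist p u (c n) + besic_dist p u (a n)) + Lp_norm p \<beta> (\<lambda>s. s (a n) - f s)" for n
  proof -
    have "Lp_norm p \<beta> (\<lambda>s. s (c n) - f s) \<le> Lp_norm p \<beta> (\<lambda>s. s (c n) - s (a n)) + Lp_norm p \<beta> (\<lambda>s. s (a n) - f s)"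
      by (intro Lp_norm_triangle p eval_Lp c a f)
    moreover have "besic_dist p (c n) (a n) \<le> besic_dist p (c n) u + besic_dist p u (a n)"
      by (intro besic_dist_triangle p in_marcinkiewicz u c a)
    ultimately show ?thesis
      using besic_norm_diff_isometry[OF c a, of n n] besic_dist_commute[of p "c n" u] by simp
  qed
  then show "(\<lambda>n. Lp_norm p \<beta> (\<lambda>s. s (c n) - f s)) \<longlonglongrightarrow> 0"
    by (intro Lim_null_comparison[OF _ tendsto_add_zero[OF tendsto_add_zero[OF uc ua] af]]) simp
qed

lemma gelfand_extD:
  assumes "f \<in> gelfand_ext p A \<beta> u"
  shows "f \<in> Lp p \<beta>"
    and "(\<And>n::nat. a n \<in> A) \<Longrightarrow> (\<lambda>n. besic_dist p u (a n)) \<longlonglongrightarrow> 0 \<Longrightarrow>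
      (\<lambda>n. Lp_norm p \<beta> (\<lambda>s. s (a n) - f s)) \<longlonglongrightarrow> 0"
  using assms unfolding gelfand_ext_def gelfand_def by blast+

text \<open>Hence the elements of the quotient are the classes of functions at Besicovitch distance \<open>0\<close>.\<close>
lemma null_space_iff: "w \<in> null_space p A \<beta> \<longleftrightarrow> w \<in> besicovitch p A \<and> besic_norm p w = 0"
proof
  assume "w \<in> null_space p A \<beta>"
  then have w: "w \<in> besicovitch p A" and f: "(\<lambda>_. 0) \<in> gelfand_ext p A \<beta> w" by (auto simp: null_space_def)
  obtain a where a: "\<And>n::nat. a n \<in> A" "(\<lambda>n. besic_dist p w (a n)) \<longlonglongrightarrow> 0"
    using besicovitch_approx[OF p w] by blast
  have wm: "w \<in> marcinkiewicz p" by (rule besicovitch_marcinkiewicz[OF p w])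
  have lim: "(\<lambda>n. besic_norm p (a n)) \<longlonglongrightarrow> 0"
    using gelfand_extD(2)[OF f a] by (simp add: besic_norm_isometry[OF p a(1)])
  have "norm (besic_norm p w) \<le> besic_dist p w (a n) + besic_norm p (a n)" for n
    using besic_norm_diff_le[OF p wm in_marcinkiewicz[OF p a(1)], of n] by simp
  then have "norm (besic_norm p w) \<le> 0"
    by (intro LIMSEQ_le_const[OF tendsto_add_zero[OF a(2) lim]]) auto
  then show "w \<in> besicovitch p A \<and> besic_norm p w = 0" using w by (simp add: antisym)
next
  assume w: "w \<in> besicovitch p A \<and> besic_norm p w = 0"
  have "(\<lambda>_. 0) \<in> gelfand_ext p A \<beta> w"
  proof (rule gelfand_extI)
    show "w \<in> marcinkiewicz p" using w besicovitch_marcinkiewicz[OF p] by blast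
    show "(\<lambda>_. 0) \<in> Lp p \<beta>" by (simp add: Lp_def)
    show "(\<lambda>_. 0) \<in> A" by (rule const_in)
    show "(\<lambda>n. besic_norm p (\<lambda>y. w y - 0)) \<longlonglongrightarrow> 0" using w by simp
    have "Lp_norm p \<beta> (\<lambda>s. s (\<lambda>_. 0) - 0) = 0"
      using besic_norm_isometry[OF p const_in[of 0]] besic_norm_zero(1)[OF p, where 'a = 'a] by simp
    then show "(\<lambda>n. Lp_norm p \<beta> (\<lambda>s. s (\<lambda>_. 0) - 0)) \<longlonglongrightarrow> 0" by simp
  qed
  then show "w \<in> null_space p A \<beta>" using w by (simp add: null_space_def)
qed

definition besic_class :: "('a \<Rightarrow> complex) \<Rightarrow> ('a \<Rightarrow> complex) set" where
  "besic_class u = {v \<in> besicovitch p A. besic_dist p u v = 0}"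

lemma besic_quot_eq: "besic_quot p A \<beta> = besic_class ` besicovitch p A"
  unfolding besic_quot_def quotient_def null_space_iff besic_class_def
  by (auto simp: besicovitch_diff[OF p])

lemma besic_class_self: "u \<in> besicovitch p A \<Longrightarrow> u \<in> besic_class u"
  by (simp add: besic_class_def besic_norm_zero(1)[OF p])

lemma besic_norm_limit:
  fixes a b :: "nat \<Rightarrow> 'a \<Rightarrow> complex"
  assumes M: "u \<in> marcinkiewicz p" "v \<in> marcinkiewicz p" "\<And>n. a n \<in> marcinkiewicz p" "\<And>n. b n \<in> marcinkiewicz p"
    and a: "(\<lambda>n. besic_dist p u (a n)) \<longlonglongrightarrow> 0" and b: "(\<lambda>n. besic_dist p v (b n)) \<longlonglongrightarrow> 0"
  shows "(\<lambda>n. besic_dist p (a n) (b n)) \<longlonglongrightarrow> besic_dist p u v"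
proof (rule Lim_transform2[OF tendsto_const])
  have "norm (besic_dist p u v - besic_dist p (a n) (b n))
      \<le> besic_dist p u (a n) + besic_dist p v (b n)" for n
  proof -
    have "\<bar>besic_dist p u v - besic_dist p (a n) (b n)\<bar>
        \<le> besic_norm p (\<lambda>y. (u y - v y) - (a n y - b n y))"
      by (intro besic_norm_diff_le p marcinkiewicz_diff M)
    also have "\<dots> \<le> besic_dist p u (a n) + besic_dist p v (b n)"
      by (intro besic_norm_diff_diff p M)
    finally show ?thesis by simp
  qed
  then show "(\<lambda>n. besic_dist p u v - besic_dist p (a n) (b n)) \<longlonglongrightarrow> 0"
    by (intro Lim_null_comparison[OF _ tendsto_add_zero[OF a b]]) simp
qed

lemma besic_class_norm_eq:
  assumes "u \<in> besicovitch p A" "v \<in> besic_class u" "u' \<in> besicovitch p A" "v' \<in> besic_class u'"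
  shows "besic_dist p v v' = besic_dist p u u'"
proof (rule LIMSEQ_unique[OF tendsto_const])
  show "(\<lambda>n::nat. besic_dist p v v') \<longlonglongrightarrow> besic_dist p u u'"
    by (rule besic_norm_limit) (use assms in \<open>auto simp: besic_class_def intro!: besicovitch_marcinkiewicz[OF p]\<close>)
qed

lemma quot_norm_class:
  assumes u: "u \<in> besicovitch p A" shows "quot_norm p (besic_class u) = besic_norm p u"
proof -
  have "besic_norm p ` besic_class u = {besic_norm p u}"
  proof
    have eq: "besic_norm p v = besic_norm p u" if "v \<in> besic_class u" for v
      using that besic_norm_diff_le[OF p besicovitch_marcinkiewicz[OF p u] besicovitch_marcinkiewicz[OF p, of v]]
      by (simp add: besic_class_def)
    show "besic_norm p ` besic_class u \<subseteq> {besic_norm p u}" using eq by blast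
    show "{besic_norm p u} \<subseteq> besic_norm p ` besic_class u" using besic_class_self[OF u] by blast
  qed
  then show ?thesis by (simp add: quot_norm_def)
qed

lemma quot_dist_class:
  assumes u: "u \<in> besicovitch p A" and u': "u' \<in> besicovitch p A"
  shows "quot_dist p (besic_class u) (besic_class u') = besic_dist p u u'"
proof -
  have "besic_norm p ` {(\<lambda>y. v y - v' y) |v v'. v \<in> besic_class u \<and> v' \<in> besic_class u'} = {besic_dist p u u'}"
    (is "?L = _")
  proof
    show "?L \<subseteq> {besic_dist p u u'}" using besic_class_norm_eq[OF u _ u'] by auto
    show "{besic_dist p u u'} \<subseteq> ?L" using besic_class_self[OF u] besic_class_self[OF u'] by auto
  qed
  then show ?thesis by (simp add: quot_dist_def quot_norm_def)
qed

context
  fixes q assumes q: "dirac_limit q"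
begin

lemma q_in: "q \<in> spectrum A"
  using q by (simp add: dirac_limit_def)

lemma besic_norm_shift:
  assumes "a \<in> A" shows "besic_norm p (shift q a) = besic_norm p a"
proof -
  have "Lp_norm p \<beta> (\<lambda>s. s (shift q a)) = Lp_norm p \<beta> (\<lambda>s. (s \<otimes> q) a)"
    unfolding Lp_norm_def
    by (intro arg_cong[where f = "\<lambda>x. x powr (1 / p)"] Bochner_Integration.integral_cong refl)
       (simp add: space_beta gelfand_shift[OF q_in assms])
  also have "\<dots> = Lp_norm p \<beta> (\<lambda>s. s a)"
    by (rule Lp_distr(2)[OF distr_right_mult[OF q] measurable_right_mult[OF q_in] eval_Lp[OF assms]])
  finally show ?thesis
    using besic_norm_isometry[OF p assms] besic_norm_isometry[OF p shift_in[OF q_in assms]] by simp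
qed

lemma besic_norm_shift_diff:
  assumes "a \<in> A" "b \<in> A"
  shows "besic_dist p (shift q a) (shift q b) = besic_dist p a b"
  using besic_norm_shift[OF diff_in[OF assms]] shift_diff[OF q_in assms] by simp

text \<open>A relation instead of a function: \<open>w\<close> is determined by \<open>u\<close> only up to Besicovitch distance \<open>0\<close>.\<close>
definition shift_limit :: "('a \<Rightarrow> complex) \<Rightarrow> ('a \<Rightarrow> complex) \<Rightarrow> bool" where
  "shift_limit u w \<longleftrightarrow> w \<in> besicovitch p A \<and>
     (\<forall>a. (\<forall>n::nat. a n \<in> A) \<longrightarrow> (\<lambda>n. besic_dist p u (a n)) \<longlonglongrightarrow> 0 \<longrightarrow>
        (\<lambda>n. besic_dist p w (shift q (a n))) \<longlonglongrightarrow> 0)"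

lemma shift_limit_exists:
  assumes u: "u \<in> besicovitch p A" shows "\<exists>w. shift_limit u w"
proof -
  obtain a where a: "\<And>n::nat. a n \<in> A" and ua: "(\<lambda>n. besic_dist p u (a n)) \<longlonglongrightarrow> 0"
    using besicovitch_approx[OF p u] by blast
  have um: "u \<in> marcinkiewicz p" by (rule besicovitch_marcinkiewicz[OF p u])
  have tri: "besic_dist p b c \<le> besic_dist p u b + besic_dist p u c"
    if "b \<in> A" "c \<in> A" for b c
    using besic_dist_triangle[OF p in_marcinkiewicz[OF p that(1)] um in_marcinkiewicz[OF p that(2)]]
      besic_dist_commute[of p b u] by simp
  obtain w where w: "w \<in> besicovitch p A" and lim: "(\<lambda>n. besic_dist p w (shift q (a n))) \<longlonglongrightarrow> 0"
  proof (rule besicovitch_complete[OF p, of "\<lambda>n. shift q (a n)"])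
    show "shift q (a n) \<in> A" for n by (rule shift_in[OF q_in a])
    fix e :: real assume "0 < e"
    then obtain N where N: "\<And>n. n \<ge> N \<Longrightarrow> besic_dist p u (a n) < e / 2"
      using order_tendstoD(2)[OF ua, of "e / 2"] unfolding eventually_sequentially by auto
    have "besic_dist p (shift q (a m)) (shift q (a n)) < e" if "m \<ge> N" "n \<ge> N" for m n
      using tri[OF a a, of m n] N[OF that(1)] N[OF that(2)] by (simp add: besic_norm_shift_diff[OF a a])
    then show "\<exists>N. \<forall>m\<ge>N. \<forall>n\<ge>N. besic_dist p (shift q (a m)) (shift q (a n)) < e" by blast
  qed blast
  have wm: "w \<in> marcinkiewicz p" by (rule besicovitch_marcinkiewicz[OF p w])
  have "(\<lambda>n. besic_dist p w (shift q (c n))) \<longlonglongrightarrow> 0"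
    if c: "\<forall>n. c n \<in> A" and uc: "(\<lambda>n. besic_dist p u (c n)) \<longlonglongrightarrow> 0" for c :: "nat \<Rightarrow> 'a \<Rightarrow> complex"
  proof -
    have "besic_dist p w (shift q (c n)) \<le> besic_dist p w (shift q (a n))
        + (besic_dist p u (a n) + besic_dist p u (c n))" for n
      using besic_dist_triangle[OF p wm in_marcinkiewicz[OF p shift_in[OF q_in a]] in_marcinkiewicz[OF p shift_in[OF q_in]], of "c n" n]
        tri[of "a n" "c n"] a[of n] c by (simp add: besic_norm_shift_diff)
    then show ?thesis
      by (intro Lim_null_comparison[OF _ tendsto_add_zero[OF lim tendsto_add_zero[OF ua uc]]]) simp
  qed
  then show ?thesis using w unfolding shift_limit_def by blast
qed

lemma shift_limit_norm_diff:
  assumes "shift_limit u w" "shift_limit u' w'" "u \<in> besicovitch p A" "u' \<in> besicovitch p A"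
  shows "besic_dist p w w' = besic_dist p u u'"
proof -
  obtain a where a: "\<And>n::nat. a n \<in> A" and ua: "(\<lambda>n. besic_dist p u (a n)) \<longlonglongrightarrow> 0"
    using besicovitch_approx[OF p assms(3)] by blast
  obtain b where b: "\<And>n::nat. b n \<in> A" and ub: "(\<lambda>n. besic_dist p u' (b n)) \<longlonglongrightarrow> 0"
    using besicovitch_approx[OF p assms(4)] by blast
  have w: "w \<in> besicovitch p A" "(\<lambda>n. besic_dist p w (shift q (a n))) \<longlonglongrightarrow> 0"
    "w' \<in> besicovitch p A" "(\<lambda>n. besic_dist p w' (shift q (b n))) \<longlonglongrightarrow> 0"
    using assms(1,2) a b ua ub unfolding shift_limit_def by blast+
  have "(\<lambda>n. besic_dist p (shift q (a n)) (shift q (b n))) \<longlonglongrightarrow> besic_dist p w w'"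
    by (intro besic_norm_limit besicovitch_marcinkiewicz[OF p] in_marcinkiewicz[OF p] shift_in q_in a b w)
  moreover have "(\<lambda>n. besic_dist p (a n) (b n)) \<longlonglongrightarrow> besic_dist p u u'"
    by (intro besic_norm_limit besicovitch_marcinkiewicz[OF p] in_marcinkiewicz[OF p] a b ua ub assms)
  ultimately show ?thesis
    unfolding besic_norm_shift_diff[OF a b] by (rule LIMSEQ_unique)
qed

lemma shift_limit_norm:
  assumes "shift_limit u w" "u \<in> besicovitch p A"
  shows "besic_norm p w = besic_norm p u"
proof -
  have "shift q (\<lambda>_. 0) = (\<lambda>_. 0)"
    unfolding shift_def by (rule ext) (simp add: character_const[OF mult_in_spectrum[OF dirac_in q_in]])
  then obtain w0 where w0: "shift_limit (\<lambda>_. 0) w0" and "besic_norm p w0 = 0"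
  proof -
    obtain w0 where w0: "shift_limit (\<lambda>_. 0) w0" using shift_limit_exists[OF in_besicovitch[OF p const_in]] by blast
    have "(\<lambda>n::nat. besic_norm p (\<lambda>y. w0 y - shift q (\<lambda>_. 0) y)) \<longlonglongrightarrow> 0"
      using w0 const_in[of 0] besic_norm_zero(1)[OF p, where 'a = 'a] unfolding shift_limit_def by (auto dest!: spec[of _ "\<lambda>_ _. 0"])
    then have "besic_norm p w0 = 0" using \<open>shift q (\<lambda>_. 0) = (\<lambda>_. 0)\<close> by (simp add: LIMSEQ_const_iff)
    with w0 show ?thesis using that by blast
  qed
  have wm: "w \<in> marcinkiewicz p" "w0 \<in> marcinkiewicz p"
    using assms(1) w0 besicovitch_marcinkiewicz[OF p] unfolding shift_limit_def by blast+
  have "\<bar>besic_norm p w - besic_dist p w w0\<bar> \<le> besic_norm p (\<lambda>y. w y - (w y - w0 y))"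
    by (intro besic_norm_diff_le p marcinkiewicz_diff wm)
  then show ?thesis
    using \<open>besic_norm p w0 = 0\<close> shift_limit_norm_diff[OF assms(1) w0 assms(2) in_besicovitch[OF p const_in]] by simp
qed

text \<open>By \<open>shift_limit_norm_diff\<close> the class depends neither on the representative \<open>u\<close> nor on \<open>w\<close>.\<close>
definition quot_shift :: "('a \<Rightarrow> complex) set \<Rightarrow> ('a \<Rightarrow> complex) set" where
  "quot_shift U = besic_class (SOME w. \<exists>u\<in>U. shift_limit u w)"

lemma quot_shift_obtain:
  assumes "U \<in> besic_quot p A \<beta>"
  obtains u w where "u \<in> besicovitch p A" "U = besic_class u" "shift_limit u w" "w \<in> besicovitch p A" "quot_shift U = besic_class w"
proof -
  obtain u0 where u0: "u0 \<in> besicovitch p A" "U = besic_class u0" using assms unfolding besic_quot_eq by blast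
  have "\<exists>w. \<exists>u\<in>U. shift_limit u w" using shift_limit_exists[OF u0(1)] besic_class_self[OF u0(1)] u0(2) by blast
  then have "\<exists>u\<in>U. shift_limit u (SOME w. \<exists>u\<in>U. shift_limit u w)" by (rule someI_ex)
  then obtain u where u: "u \<in> U" "shift_limit u (SOME w. \<exists>u\<in>U. shift_limit u w)" by blast
  have ub: "u \<in> besicovitch p A" using u u0 by (simp add: besic_class_def)
  have "besic_class u0 = besic_class u"
  proof (intro equalityI subsetI)
    fix v assume v: "v \<in> besic_class u0"
    then have "besic_dist p u v = besic_dist p u0 u0"
      using u u0 by (intro besic_class_norm_eq) auto
    then show "v \<in> besic_class u" using v by (simp add: besic_class_def besic_norm_zero(1)[OF p])
  next
    fix v assume v: "v \<in> besic_class u"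
    then have vb: "v \<in> besicovitch p A" by (simp add: besic_class_def)
    have "besic_dist p u v = besic_dist p u0 v"
      using u u0 besic_class_self[OF vb] vb by (intro besic_class_norm_eq) auto
    then show "v \<in> besic_class u0" using v by (simp add: besic_class_def)
  qed
  then have "U = besic_class u" using u0(2) by simp
  moreover have "(SOME w. \<exists>u\<in>U. shift_limit u w) \<in> besicovitch p A" using u(2) by (simp add: shift_limit_def)
  ultimately show ?thesis by (rule that[OF ub _ u(2) _ quot_shift_def])
qed

lemma quot_shift_in: "U \<in> besic_quot p A \<beta> \<Longrightarrow> quot_shift U \<in> besic_quot p A \<beta>"
  by (elim quot_shift_obtain) (auto simp: besic_quot_eq)

lemma quot_norm_shift: "U \<in> besic_quot p A \<beta> \<Longrightarrow> quot_norm p (quot_shift U) = quot_norm p U"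
  by (elim quot_shift_obtain) (simp add: quot_norm_class shift_limit_norm)

lemma quot_dist_shift:
  assumes "U \<in> besic_quot p A \<beta>" "V \<in> besic_quot p A \<beta>"
  shows "quot_dist p (quot_shift U) (quot_shift V) = quot_dist p U V"
proof -
  obtain u w where "u \<in> besicovitch p A" "U = besic_class u" "shift_limit u w" "w \<in> besicovitch p A" "quot_shift U = besic_class w"
    by (rule quot_shift_obtain[OF assms(1)])
  moreover obtain v z where "v \<in> besicovitch p A" "V = besic_class v" "shift_limit v z" "z \<in> besicovitch p A" "quot_shift V = besic_class z"
    by (rule quot_shift_obtain[OF assms(2)])
  ultimately show ?thesis by (simp add: quot_dist_class shift_limit_norm_diff)
qed

text \<open>Under the isomorphism of the quotient with \<open>L\<^sup>p(\<beta>)\<close>, the shift is the composition with translation by \<open>q\<close>: both are limits along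
  the same sequence in \<open>A\<close>, and composition with the measure preserving translation is isometric on \<open>L\<^sup>p(\<beta>)\<close>.\<close>
lemma gelfand1_shift:
  assumes U: "U \<in> besic_quot p A \<beta>" and f: "f \<in> gelfand1 p A \<beta> U"
  shows "(\<lambda>s. f (s \<otimes> q)) \<in> gelfand1 p A \<beta> (quot_shift U)"
proof -
  obtain u w where u: "u \<in> besicovitch p A" "U = besic_class u" and uw: "shift_limit u w"
    and w: "w \<in> besicovitch p A" "quot_shift U = besic_class w"
    by (rule quot_shift_obtain[OF U])
  obtain v where v: "v \<in> besic_class u" and fv: "f \<in> gelfand_ext p A \<beta> v" using f u by (auto simp: gelfand1_def)
  obtain a where a: "\<And>n::nat. a n \<in> A" and ua: "(\<lambda>n. besic_dist p u (a n)) \<longlonglongrightarrow> 0"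
    using besicovitch_approx[OF p u(1)] by blast
  have eq: "besic_dist p v (a n) = besic_dist p u (a n)" for n
    by (rule besic_class_norm_eq[OF u(1) v in_besicovitch[OF p a] besic_class_self[OF in_besicovitch[OF p a]]])
  have fL: "f \<in> Lp p \<beta>" by (rule gelfand_extD(1)[OF fv])
  have lim: "(\<lambda>n. Lp_norm p \<beta> (\<lambda>s. s (a n) - f s)) \<longlonglongrightarrow> 0"
    by (rule gelfand_extD(2)[OF fv a]) (simp add: eq ua)
  note dist = distr_right_mult[OF q] measurable_right_mult[OF q_in]
  have "(\<lambda>s. f (s \<otimes> q)) \<in> gelfand_ext p A \<beta> w"
  proof (rule gelfand_extI)
    show "w \<in> marcinkiewicz p" by (rule besicovitch_marcinkiewicz[OF p w(1)])
    show "(\<lambda>s. f (s \<otimes> q)) \<in> Lp p \<beta>" by (rule Lp_distr(1)[OF dist fL])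
    show "shift q (a n) \<in> A" for n by (rule shift_in[OF q_in a])
    show "(\<lambda>n. besic_dist p w (shift q (a n))) \<longlonglongrightarrow> 0"
      using uw a ua unfolding shift_limit_def by blast
    have "Lp_norm p \<beta> (\<lambda>s. s (shift q (a n)) - f (s \<otimes> q)) = Lp_norm p \<beta> (\<lambda>s. s (a n) - f s)" for n
    proof -
      have "Lp_norm p \<beta> (\<lambda>s. s (shift q (a n)) - f (s \<otimes> q)) = Lp_norm p \<beta> (\<lambda>s. (s \<otimes> q) (a n) - f (s \<otimes> q))"
        unfolding Lp_norm_def
        by (intro arg_cong[where f = "\<lambda>x. x powr (1 / p)"] Bochner_Integration.integral_cong refl)
           (simp add: space_beta gelfand_shift[OF q_in a])
      also have "\<dots> = Lp_norm p \<beta> (\<lambda>s. s (a n) - f s)"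
        by (rule Lp_distr(2)[OF dist Lp_diff(1)[OF p eval_Lp[OF a] fL]])
      finally show ?thesis .
    qed
    then show "(\<lambda>n. Lp_norm p \<beta> (\<lambda>s. s (shift q (a n)) - f (s \<otimes> q))) \<longlonglongrightarrow> 0" using lim by simp
  qed
  then show ?thesis using besic_class_self[OF w(1)] w(2) by (auto simp: gelfand1_def)
qed

end
end
end

section \<open>Bochner spaces and test functions\<close>

lemma strongly_measurable_map:
  assumes f: "strongly_measurable N V d f" "f \<in> space N \<rightarrow> V"
    and \<theta>: "\<theta> \<in> M \<rightarrow>\<^sub>M N" "distr M N \<theta> = N"
    and \<Phi>: "\<And>a. a \<in> V \<Longrightarrow> \<Phi> a \<in> V'" "\<And>a b. a \<in> V \<Longrightarrow> b \<in> V \<Longrightarrow> d' (\<Phi> a) (\<Phi> b) = d a b"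
  shows "strongly_measurable M V' d' (\<lambda>x. \<Phi> (f (\<theta> x)))"
proof -
  obtain \<sigma> where \<sigma>: "\<And>n. simple_function N (\<sigma> n)" "\<And>n. \<sigma> n \<in> space N \<rightarrow> V"
    and lim: "AE x in N. (\<lambda>n. d (\<sigma> n x) (f x)) \<longlonglongrightarrow> 0"
    using f(1) unfolding strongly_measurable_def by blast
  have \<theta>s: "x \<in> space M \<Longrightarrow> \<theta> x \<in> space N" for x by (rule measurable_space[OF \<theta>(1)])
  show ?thesis
    unfolding strongly_measurable_def
  proof (intro exI[of _ "\<lambda>n x. \<Phi> (\<sigma> n (\<theta> x))"] conjI allI)
    fix n
    show "simple_function M (\<lambda>x. \<Phi> (\<sigma> n (\<theta> x)))"
      using simple_function_compose[OF simple_function_comp[OF \<theta>(1) \<sigma>(1)], of \<Phi> n] by (simp add: comp_def)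
    show "(\<lambda>x. \<Phi> (\<sigma> n (\<theta> x))) \<in> space M \<rightarrow> V'" using \<sigma>(2) \<theta>s \<Phi>(1) by blast
  next
    have "AE x in distr M N \<theta>. (\<lambda>n. d (\<sigma> n x) (f x)) \<longlonglongrightarrow> 0" unfolding \<theta>(2) by (rule lim)
    then have "AE x in M. (\<lambda>n. d (\<sigma> n (\<theta> x)) (f (\<theta> x))) \<longlonglongrightarrow> 0" by (rule AE_distrD[OF \<theta>(1)])
    then show "AE x in M. (\<lambda>n. d' (\<Phi> (\<sigma> n (\<theta> x))) (\<Phi> (f (\<theta> x)))) \<longlonglongrightarrow> 0"
    proof (rule AE_mp[OF _ AE_I2], intro impI)
      fix x assume x: "x \<in> space M" and l: "(\<lambda>n. d (\<sigma> n (\<theta> x)) (f (\<theta> x))) \<longlonglongrightarrow> 0"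
      have "\<sigma> n (\<theta> x) \<in> V" "f (\<theta> x) \<in> V" for n using \<sigma>(2) f(2) \<theta>s[OF x] by blast+
      then show "(\<lambda>n. d' (\<Phi> (\<sigma> n (\<theta> x))) (\<Phi> (f (\<theta> x)))) \<longlonglongrightarrow> 0" using l by (simp add: \<Phi>(2))
    qed
  qed
qed

lemma bochner_Lp_map:
  assumes f: "f \<in> bochner_Lp p N V d \<nu>"
    and \<theta>: "\<theta> \<in> M \<rightarrow>\<^sub>M N" "distr M N \<theta> = N"
    and \<Phi>: "\<And>a. a \<in> V \<Longrightarrow> \<Phi> a \<in> V'" "\<And>a b. a \<in> V \<Longrightarrow> b \<in> V \<Longrightarrow> d' (\<Phi> a) (\<Phi> b) = d a b" "\<And>a. a \<in> V \<Longrightarrow> \<nu>' (\<Phi> a) = \<nu> a"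
  shows "(\<lambda>x. \<Phi> (f (\<theta> x))) \<in> bochner_Lp p M V' d' \<nu>'"
proof -
  have fV: "f \<in> space N \<rightarrow> V" "strongly_measurable N V d f" "integrable N (\<lambda>x. \<nu> (f x) powr p)"
    using f by (auto simp: bochner_Lp_def)
  have \<theta>s: "x \<in> space M \<Longrightarrow> f (\<theta> x) \<in> V" for x using measurable_space[OF \<theta>(1)] fV(1) by blast
  have "integrable M (\<lambda>x. \<nu> (f (\<theta> x)) powr p)"
    using integrable_distr[OF \<theta>(1), of "\<lambda>x. \<nu> (f x) powr p"] fV(3) unfolding \<theta>(2) by simp
  then have "integrable M (\<lambda>x. \<nu>' (\<Phi> (f (\<theta> x))) powr p)"
    by (rule Bochner_Integration.integrable_cong[THEN iffD1, rotated 2]) (simp_all add: \<theta>s \<Phi>(3))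
  then show ?thesis
    using \<theta>s \<Phi>(1) strongly_measurable_map[OF fV(2,1) \<theta> \<Phi>(1,2)] by (auto simp: bochner_Lp_def)
qed

lemma bochner_Linf_map:
  assumes f: "f \<in> bochner_Linf N V d \<nu>"
    and \<theta>: "\<theta> \<in> M \<rightarrow>\<^sub>M N" "distr M N \<theta> = N"
    and \<Phi>: "\<And>a. a \<in> V \<Longrightarrow> \<Phi> a \<in> V'" "\<And>a b. a \<in> V \<Longrightarrow> b \<in> V \<Longrightarrow> d' (\<Phi> a) (\<Phi> b) = d a b" "\<And>a. a \<in> V \<Longrightarrow> \<nu>' (\<Phi> a) = \<nu> a"
  shows "(\<lambda>x. \<Phi> (f (\<theta> x))) \<in> bochner_Linf M V' d' \<nu>'"
proof -
  obtain C where fV: "f \<in> space N \<rightarrow> V" "strongly_measurable N V d f" "AE x in N. \<nu> (f x) \<le> C"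
    using f by (auto simp: bochner_Linf_def)
  have \<theta>s: "x \<in> space M \<Longrightarrow> f (\<theta> x) \<in> V" for x using measurable_space[OF \<theta>(1)] fV(1) by blast
  have "AE x in M. \<nu> (f (\<theta> x)) \<le> C" by (rule AE_distrD[OF \<theta>(1)]) (unfold \<theta>(2), rule fV(3))
  then have "AE x in M. \<nu>' (\<Phi> (f (\<theta> x))) \<le> C"
    by (rule AE_mp[OF _ AE_I2]) (simp add: \<theta>s \<Phi>(3))
  then show ?thesis
    using \<theta>s \<Phi>(1) strongly_measurable_map[OF fV(2,1) \<theta> \<Phi>(1,2)] by (auto simp: bochner_Linf_def)
qed

text \<open>For an invertible substitution nothing has to be known about \<open>f\<close>: if it is not measurable, neither is the composition, and both
  integrals are \<open>0\<close> by convention.  This applies to the pairing of \<open>F\<close> with a test function on the product, which need not be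
  jointly measurable.\<close>
lemma integral_iso:
  fixes f :: "'y \<Rightarrow> complex"
  assumes \<theta>: "\<theta> \<in> M \<rightarrow>\<^sub>M N" "distr M N \<theta> = N" and \<theta>': "\<theta>' \<in> N \<rightarrow>\<^sub>M M"
    and inv: "\<And>y. y \<in> space N \<Longrightarrow> \<theta> (\<theta>' y) = y"
  shows "(LINT x|M. f (\<theta> x)) = (LINT y|N. f y)"
proof (cases "f \<in> borel_measurable N")
  case True
  then show ?thesis using integral_distr[OF \<theta>(1), of f] \<theta>(2) by simp
next
  case False
  have "(\<lambda>x. f (\<theta> x)) \<notin> borel_measurable M"
  proof
    assume "(\<lambda>x. f (\<theta> x)) \<in> borel_measurable M"
    then have "(\<lambda>y. f (\<theta> (\<theta>' y))) \<in> borel_measurable N" by (rule measurable_compose[OF \<theta>'])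
    then have "f \<in> borel_measurable N" by (rule measurable_cong[THEN iffD1, rotated]) (simp add: inv)
    with False show False ..
  qed
  then show ?thesis using False not_integrable_integral_eq borel_measurable_integrable by metis
qed

text \<open>The functions \<open>H \<ge> 0\<close> in \<open>L\<^sup>q(Q)\<close> for the exponent \<open>q\<close> conjugate to \<open>p\<close>.  They dominate the test functions in the space variable;
  for \<open>p = 1\<close> the bound is required everywhere, which is no restriction for a dominating function.\<close>
definition dual_weight :: "real \<Rightarrow> 'a::euclidean_space set \<Rightarrow> ('a \<Rightarrow> real) \<Rightarrow> bool" where
  "dual_weight p Q H \<longleftrightarrow> H \<in> borel_measurable (lebesgue_on Q) \<and> (\<forall>y. 0 \<le> H y) \<and>
     (if p = 1 then \<exists>C. \<forall>y. H y \<le> C else integrable (lebesgue_on Q) (\<lambda>y. H y powr (p / (p - 1))))"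

lemma dual_weight_mult_integrable:
  fixes u h :: "'a::euclidean_space \<Rightarrow> complex"
  assumes p: "1 \<le> p" and H: "dual_weight p Q H" and u: "u \<in> Lp p (lebesgue_on Q)"
    and h: "h \<in> borel_measurable (lebesgue_on Q)" "AE y in lebesgue_on Q. norm (h y) \<le> H y"
  shows "integrable (lebesgue_on Q) (\<lambda>y. u y * h y)"
proof (cases "p = 1")
  case True
  then obtain C where C: "\<And>y. H y \<le> C" using H by (auto simp: dual_weight_def)
  have um: "u \<in> borel_measurable (lebesgue_on Q)" by (rule Lp_measurable[OF u])
  have ui: "integrable (lebesgue_on Q) (\<lambda>y. norm (u y))" using Lp_integrable[OF u] True by simp
  show ?thesis
  proof (rule Bochner_Integration.integrable_bound)
    show "integrable (lebesgue_on Q) (\<lambda>y. norm (u y) * C)" using ui by (rule integrable_mult_left)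
    show "(\<lambda>y. u y * h y) \<in> borel_measurable (lebesgue_on Q)" using um h(1) by (rule borel_measurable_times)
    show "AE y in lebesgue_on Q. norm (u y * h y) \<le> norm (norm (u y) * C)"
      using h(2)
    proof eventually_elim
      case (elim y)
      have "norm (h y) \<le> \<bar>C\<bar>" using elim C[of y] by linarith
      then show ?case by (simp add: norm_mult abs_mult mult_left_mono)
    qed
  qed
next
  case False
  then have "1 < p" using p by simp
  then show ?thesis using H False
    by (intro Lp_mult_integrable[where H = H and p = p] u h) (auto simp: dual_weight_def)
qed

lemma dual_weight_scale: "dual_weight p Q H \<Longrightarrow> 0 \<le> c \<Longrightarrow> dual_weight p Q (\<lambda>y. c * H y)"
proof -
  assume H: "dual_weight p Q H" and c: "0 \<le> c"
  have "\<exists>D. \<forall>y. c * H y \<le> D" if "\<exists>C. \<forall>y. H y \<le> C"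
    using that c by (meson mult_left_mono)
  then show ?thesis using H c unfolding dual_weight_def by (auto simp: powr_mult split: if_splits)
qed

context mean_value_algebra
begin

lemma sup_dist_const: "sup_dist (\<lambda>_::'a. a) (\<lambda>_. b) = norm (a - b)" and sup_norm_const: "sup_norm (\<lambda>_::'a. a) = norm a"
  by (simp_all add: sup_dist_def sup_norm_def)

lemma dual_weight_test_function:
  fixes c :: "'a \<Rightarrow> complex"
  assumes p: "1 \<le> p" and H: "dual_weight p Q H"
    and c: "c \<in> borel_measurable (lebesgue_on Q)" "\<And>y. norm (c y) \<le> H y"
  shows "(\<lambda>y _. c y) \<in> test_space p A Q"
proof -
  obtain F where F: "\<And>i. simple_function (lebesgue_on Q) (F i)" "\<And>y. y \<in> space (lebesgue_on Q) \<Longrightarrow> (\<lambda>i. F i y) \<longlonglongrightarrow> c y"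
    using borel_measurable_implies_sequence_metric[OF c(1), of 0] by blast
  have sm: "strongly_measurable (lebesgue_on Q) A sup_dist (\<lambda>y _. c y)"
    unfolding strongly_measurable_def
  proof (intro exI[of _ "\<lambda>i y _. F i y"] conjI allI AE_I2)
    show "simple_function (lebesgue_on Q) (\<lambda>y _. F i y)" for i
      using simple_function_compose[OF F(1), of "\<lambda>z _. z" i] by (simp add: comp_def)
    show "(\<lambda>y _. F i y) \<in> space (lebesgue_on Q) \<rightarrow> A" for i by (auto intro: const_in)
    show "(\<lambda>n. sup_dist (\<lambda>_::'a. F n y) (\<lambda>_. c y)) \<longlonglongrightarrow> 0" if "y \<in> space (lebesgue_on Q)" for y
      unfolding sup_dist_const using F(2)[OF that] by (intro tendsto_norm_zero) (simp add: LIM_zero)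
  qed
  show ?thesis
  proof (cases "p = 1")
    case True
    then obtain C where "\<And>y. H y \<le> C" using H by (auto simp: dual_weight_def)
    then have "norm (c y) \<le> C" for y using c(2) order_trans by blast
    then show ?thesis using True sm by (auto simp: test_space_def bochner_Linf_def sup_norm_const const_in)
  next
    case False
    have "integrable (lebesgue_on Q) (\<lambda>y. norm (c y) powr (p / (p - 1)))"
    proof (rule Bochner_Integration.integrable_bound)
      show "integrable (lebesgue_on Q) (\<lambda>y. H y powr (p / (p - 1)))" using H False by (simp add: dual_weight_def)
      show "(\<lambda>y. norm (c y) powr (p / (p - 1))) \<in> borel_measurable (lebesgue_on Q)" using c(1) by measurable
      show "AE y in lebesgue_on Q. norm (norm (c y) powr (p / (p - 1))) \<le> norm (H y powr (p / (p - 1)))"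
        using c(2) p False by (auto intro!: powr_mono2)
    qed
    then show ?thesis using False sm by (auto simp: test_space_def bochner_Lp_def sup_norm_const const_in)
  qed
qed

lemma test_space_strongly_measurable:
  assumes "\<psi> \<in> test_space p A Q"
  shows "strongly_measurable (lebesgue_on Q) A sup_dist \<psi>" and "y \<in> Q \<Longrightarrow> \<psi> y \<in> A"
  using assms by (auto simp: test_space_def bochner_Linf_def bochner_Lp_def split: if_splits)

lemma test_space_weight:
  assumes p: "1 \<le> p" and \<psi>: "\<psi> \<in> test_space p A Q"
  obtains H where "dual_weight p Q H" "AE y in lebesgue_on Q. sup_norm (\<psi> y) \<le> H y"
proof (cases "p = 1")
  case True
  then obtain C where "AE y in lebesgue_on Q. sup_norm (\<psi> y) \<le> C" using \<psi> by (auto simp: test_space_def bochner_Linf_def)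
  then have "AE y in lebesgue_on Q. sup_norm (\<psi> y) \<le> \<bar>C\<bar>" by eventually_elim simp
  moreover have "dual_weight p Q (\<lambda>_. \<bar>C\<bar>)" using True by (auto simp: dual_weight_def)
  ultimately show ?thesis using that by blast
next
  case False
  define q where "q = p / (p - 1)"
  have q: "0 < q" using p False by (simp add: q_def)
  have int: "integrable (lebesgue_on Q) (\<lambda>y. sup_norm (\<psi> y) powr q)"
    using \<psi> False by (simp add: test_space_def bochner_Lp_def q_def)
  define H where "H y = (sup_norm (\<psi> y) powr q) powr (1 / q)" for y
  have "H \<in> borel_measurable (lebesgue_on Q)"
    unfolding H_def using borel_measurable_integrable[OF int] by measurable
  moreover have "H y powr q = sup_norm (\<psi> y) powr q" for y
    unfolding H_def powr_powr[of "sup_norm (\<psi> y) powr q"] using q by simp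
  ultimately have "dual_weight p Q H" using int False by (auto simp: dual_weight_def q_def[symmetric] H_def)
  moreover have "AE y in lebesgue_on Q. sup_norm (\<psi> y) \<le> H y"
    by (rule AE_I2) (use q in \<open>simp add: H_def powr_powr sup_norm_ge0 test_space_strongly_measurable(2)[OF \<psi>]\<close>)
  ultimately show ?thesis using that by blast
qed

text \<open>For the simple functions approximating \<open>\<psi>\<close>, with values in \<open>A\<close>, this holds because elements of \<open>A\<close> are continuous.\<close>
lemma test_space_measurable:
  assumes Q: "Q \<in> sets lebesgue" and \<psi>: "\<psi> \<in> test_space p A Q"
    and \<kappa>: "\<kappa> \<in> borel_measurable (lebesgue_on Q)"
  shows "(\<lambda>y. \<psi> y (\<kappa> y)) \<in> borel_measurable (lebesgue_on Q)"
proof -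
  obtain \<sigma> where \<sigma>: "\<And>n. simple_function (lebesgue_on Q) (\<sigma> n)" "\<And>n. \<sigma> n \<in> space (lebesgue_on Q) \<rightarrow> A"
    and lim: "AE y in lebesgue_on Q. (\<lambda>n. sup_dist (\<sigma> n y) (\<psi> y)) \<longlonglongrightarrow> 0"
    using test_space_strongly_measurable(1)[OF \<psi>] unfolding strongly_measurable_def by blast
  show ?thesis
  proof (rule borel_measurable_lebesgue_on_AE_lim[OF Q])
    fix n
    have fin: "finite (\<sigma> n ` space (lebesgue_on Q))" using \<sigma>(1) by (simp add: simple_function_def)
    show "(\<lambda>y. \<sigma> n y (\<kappa> y)) \<in> borel_measurable (lebesgue_on Q)"
    proof (rule measurable_compose_countable'[where f = "\<lambda>a y. a (\<kappa> y)" and g = "\<sigma> n" and I = "\<sigma> n ` space (lebesgue_on Q)"])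
      fix a assume "a \<in> \<sigma> n ` space (lebesgue_on Q)"
      then have "a \<in> A" using \<sigma>(2) by blast
      then have "a \<in> borel_measurable borel" by (intro borel_measurable_continuous_onI continuous_in)
      then show "(\<lambda>y. a (\<kappa> y)) \<in> borel_measurable (lebesgue_on Q)" by (rule measurable_compose[OF \<kappa>])
    next
      show "\<sigma> n \<in> lebesgue_on Q \<rightarrow>\<^sub>M count_space (\<sigma> n ` space (lebesgue_on Q))"
        using \<sigma>(1)[of n] unfolding measurable_count_space_eq2[OF fin] simple_function_def by auto
      show "countable (\<sigma> n ` space (lebesgue_on Q))" using fin by (rule countable_finite)
    qed
  next
    show "AE y in lebesgue_on Q. (\<lambda>n. \<sigma> n y (\<kappa> y)) \<longlonglongrightarrow> \<psi> y (\<kappa> y)"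
      using lim
    proof (rule AE_mp[OF _ AE_I2], intro impI)
      fix y assume y: "y \<in> space (lebesgue_on Q)" and l: "(\<lambda>n. sup_dist (\<sigma> n y) (\<psi> y)) \<longlonglongrightarrow> 0"
      have "\<psi> y \<in> A" using y test_space_strongly_measurable(2)[OF \<psi>] by simp
      moreover have "\<sigma> n y \<in> A" for n using \<sigma>(2) y by blast
      ultimately have "norm (\<sigma> n y (\<kappa> y) - \<psi> y (\<kappa> y)) \<le> sup_dist (\<sigma> n y) (\<psi> y)" for n
        unfolding sup_dist_def by (intro norm_le_sup_norm diff_in)
      then have "(\<lambda>n. \<sigma> n y (\<kappa> y) - \<psi> y (\<kappa> y)) \<longlonglongrightarrow> 0"
        by (intro Lim_null_comparison[OF _ l]) simp
      then show "(\<lambda>n. \<sigma> n y (\<kappa> y)) \<longlonglongrightarrow> \<psi> y (\<kappa> y)" by (simp add: LIM_zero_iff)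
    qed
  qed
qed

lemma test_space_subst:
  assumes \<psi>: "\<psi> \<in> test_space p A Q" and \<theta>: "\<theta> \<in> lebesgue_on Q' \<rightarrow>\<^sub>M lebesgue_on Q" "distr (lebesgue_on Q') (lebesgue_on Q) \<theta> = lebesgue_on Q"
    and \<Phi>: "\<And>a. a \<in> A \<Longrightarrow> \<Phi> a \<in> A" "\<And>a b. a \<in> A \<Longrightarrow> b \<in> A \<Longrightarrow> sup_dist (\<Phi> a) (\<Phi> b) = sup_dist a b" "\<And>a. a \<in> A \<Longrightarrow> sup_norm (\<Phi> a) = sup_norm a"
  shows "(\<lambda>x. \<Phi> (\<psi> (\<theta> x))) \<in> test_space p A Q'"
proof (cases "p = 1")
  case True
  then have "\<psi> \<in> bochner_Linf (lebesgue_on Q) A sup_dist sup_norm" using \<psi> by (simp add: test_space_def)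
  then have "(\<lambda>x. \<Phi> (\<psi> (\<theta> x))) \<in> bochner_Linf (lebesgue_on Q') A sup_dist sup_norm"
    by (rule bochner_Linf_map[OF _ \<theta>]) (rule \<Phi>; assumption)+
  then show ?thesis using True by (simp add: test_space_def)
next
  case False
  then have "\<psi> \<in> bochner_Lp (p / (p - 1)) (lebesgue_on Q) A sup_dist sup_norm" using \<psi> by (simp add: test_space_def)
  then have "(\<lambda>x. \<Phi> (\<psi> (\<theta> x))) \<in> bochner_Lp (p / (p - 1)) (lebesgue_on Q') A sup_dist sup_norm"
    by (rule bochner_Lp_map[OF _ \<theta>]) (rule \<Phi>; assumption)+
  then show ?thesis using False by (simp add: test_space_def)
qed

text \<open>Apply \<open>gliding_hump\<close> to \<open>w = u H\<close> and \<open>g / H\<close>.  For \<open>p = 1\<close> neither dominated convergence nor a bound on the norms of \<open>u n\<close> would be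
  enough; what makes it work is the convergence against all functions dominated by \<open>H\<close>, which are test functions constant in the
  fast variable.\<close>
lemma null_oscillation_integral:
  fixes u g :: "nat \<Rightarrow> 'a \<Rightarrow> complex"
  assumes p: "1 \<le> p" and H: "dual_weight p Q H" and u: "\<And>n. u n \<in> Lp p (lebesgue_on Q)"
    and conv: "\<And>c. c \<in> borel_measurable (lebesgue_on Q) \<Longrightarrow> (\<And>y. norm (c y) \<le> H y) \<Longrightarrow>
        convergent (\<lambda>n. LINT y|lebesgue_on Q. u n y * c y)"
    and g: "\<And>n. g n \<in> borel_measurable (lebesgue_on Q)" "\<And>n. AE y in lebesgue_on Q. norm (g n y) \<le> H y"
    and g0: "AE y in lebesgue_on Q. (\<lambda>n. g n y) \<longlonglongrightarrow> 0"
  shows "(\<lambda>n. LINT y|lebesgue_on Q. u n y * g n y) \<longlonglongrightarrow> 0"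
proof -
  have Hm[measurable]: "H \<in> borel_measurable (lebesgue_on Q)" and H0: "\<And>y. 0 \<le> H y" using H by (auto simp: dual_weight_def)
  note g(1)[measurable]
  define \<gamma> where "\<gamma> n y = (if 0 < H y \<and> norm (g n y) \<le> H y then g n y / of_real (H y) else 0)" for n y
  define w where "w n y = u n y * of_real (H y)" for n y
  have "(\<lambda>n. LINT y|lebesgue_on Q. w n y * \<gamma> n y) \<longlonglongrightarrow> 0"
  proof (rule gliding_hump)
    show "integrable (lebesgue_on Q) (w n)" for n
      unfolding w_def by (rule dual_weight_mult_integrable[OF p H u]) (use H0 in auto)
    show "\<gamma> n \<in> borel_measurable (lebesgue_on Q)" for n
      unfolding \<gamma>_def by measurable
    show "norm (\<gamma> n y) \<le> 1" for n y by (auto simp: \<gamma>_def norm_divide)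
    show "AE y in lebesgue_on Q. (\<lambda>n. \<gamma> n y) \<longlonglongrightarrow> 0"
      using g0
    proof eventually_elim
      case (elim y)
      have "norm (\<gamma> n y) \<le> norm (g n y) * inverse (H y)" for n
        using H0[of y] by (auto simp: \<gamma>_def norm_mult norm_inverse divide_inverse)
      then show ?case
        by (intro Lim_null_comparison[OF _ tendsto_mult_left_zero[OF tendsto_norm_zero[OF elim], of "inverse (H y)"]]) simp
    qed
    fix \<phi> :: "'a \<Rightarrow> complex" assume \<phi>: "\<phi> \<in> borel_measurable (lebesgue_on Q)" "\<And>y. norm (\<phi> y) \<le> 1"
    have "convergent (\<lambda>n. LINT y|lebesgue_on Q. u n y * (of_real (H y) * \<phi> y))"
    proof (rule conv)
      show "(\<lambda>y. of_real (H y) * \<phi> y) \<in> borel_measurable (lebesgue_on Q)" using \<phi>(1) by measurable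
      show "norm (of_real (H y) * \<phi> y) \<le> H y" for y using \<phi>(2)[of y] H0[of y] by (simp add: norm_mult mult_left_le)
    qed
    then show "convergent (\<lambda>n. LINT y|lebesgue_on Q. w n y * \<phi> y)" by (simp add: w_def mult.assoc)
  qed
  moreover have "(LINT y|lebesgue_on Q. w n y * \<gamma> n y) = (LINT y|lebesgue_on Q. u n y * g n y)" for n
  proof (rule integral_cong_AE)
    have [measurable]: "u n \<in> borel_measurable (lebesgue_on Q)" by (rule Lp_measurable[OF u])
    show "(\<lambda>y. w n y * \<gamma> n y) \<in> borel_measurable (lebesgue_on Q)" unfolding w_def \<gamma>_def by measurable
    show "(\<lambda>y. u n y * g n y) \<in> borel_measurable (lebesgue_on Q)" by measurable
    show "AE y in lebesgue_on Q. w n y * \<gamma> n y = u n y * g n y"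
      using g(2)[of n]
    proof eventually_elim
      case (elim y)
      then show ?case using H0[of y] by (cases "H y = 0") (auto simp: w_def \<gamma>_def)
    qed
  qed
  ultimately show ?thesis by simp
qed

end

section \<open>Translation of weakly sigma-convergent sequences\<close>

theorem proposition3:
  fixes A :: "('a::euclidean_space \<Rightarrow> complex) set"
    and G :: "'a functional monoid"
    and \<beta> :: "'a functional measure"
    and Q :: "'a set" and p :: real and t :: 'a
    and \<epsilon> :: "nat \<Rightarrow> real" and r :: "'a functional"
    and u v :: "nat \<Rightarrow> 'a \<Rightarrow> complex"
    and u0 :: "'a \<Rightarrow> ('a \<Rightarrow> complex) set"
  assumes "class_AA A G"
    and "M_measure A \<beta>"
    and "open Q"
    and "1 \<le> p"
    and "\<And>n. 0 < \<epsilon> n \<and> \<epsilon> n \<le> 1"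
    and "\<epsilon> \<longlonglongrightarrow> 0"
    and "r \<in> spectrum A"
    and "(\<lambda>n. dirac A (t /\<^sub>R \<epsilon> n)) \<longlonglongrightarrow> r"
    and "weak_sigma_conv p A \<beta> Q \<epsilon> u u0"
    and "\<And>n x. v n x = u n (x + t)"
  shows "(\<exists>v0\<in>Lp_besic p A \<beta> ((\<lambda>z. z - t) ` Q).
            \<forall>x\<in>(\<lambda>z. z - t) ` Q. \<forall>f\<in>gelfand1 p A \<beta> (u0 (x + t)).
              (\<lambda>s. f (s \<otimes>\<^bsub>G\<^esub> r)) \<in> gelfand1 p A \<beta> (v0 x)) \<and>
         (\<forall>v0\<in>Lp_besic p A \<beta> ((\<lambda>z. z - t) ` Q).
            (AE x in lebesgue_on ((\<lambda>z. z - t) ` Q). \<forall>f\<in>gelfand1 p A \<beta> (u0 (x + t)).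
              (\<lambda>s. f (s \<otimes>\<^bsub>G\<^esub> r)) \<in> gelfand1 p A \<beta> (v0 x)) \<longrightarrow>
            weak_sigma_conv p A \<beta> ((\<lambda>z. z - t) ` Q) \<epsilon> v v0)"
proof -
  note Q_open = assms(3) and p = assms(4) and r = assms(7) and lim_r = assms(8) and conv = assms(9) and v = assms(10)
  interpret almost_periodic_setting A G \<beta> by unfold_locales (rule assms(1,2))+
  define Q' where "Q' = (\<lambda>z. z - t) ` Q"
  have Q: "Q \<in> sets lebesgue" using Q_open by simp
  have Q': "Q' \<in> sets lebesgue" unfolding Q'_def using lebesgue_sets_translation[OF Q, of "- t"] by (simp add: image_def)
  have Q_eq: "(\<lambda>z. z - (- t)) ` Q' = Q" by (auto simp: Q'_def image_image)
  have \<theta>: "(\<lambda>x. x + t) \<in> lebesgue_on Q' \<rightarrow>\<^sub>M lebesgue_on Q" "distr (lebesgue_on Q') (lebesgue_on Q) (\<lambda>x. x + t) = lebesgue_on Q"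
    unfolding Q'_def by (rule translation_measurable_on, rule distr_lebesgue_on_translation[OF Q])
  have \<theta>': "(\<lambda>x. x - t) \<in> lebesgue_on Q \<rightarrow>\<^sub>M lebesgue_on Q'" "distr (lebesgue_on Q) (lebesgue_on Q') (\<lambda>x. x - t) = lebesgue_on Q'"
    using translation_measurable_on[of "- t" Q'] distr_lebesgue_on_translation[OF Q', of "- t"] unfolding Q_eq by simp_all
  have dl: "dirac_limit r" unfolding dirac_limit_def using r lim_r by (intro conjI exI[of _ "\<lambda>n. t /\<^sub>R \<epsilon> n"])
  have dli: "dirac_limit (inv\<^bsub>G\<^esub> r)" by (rule dirac_limit_inv[OF dl])
  have ir: "inv\<^bsub>G\<^esub> r \<in> spectrum A" by (rule inv_in_spectrum[OF r])
  have lim_ir: "(\<lambda>n. dirac A (- (t /\<^sub>R \<epsilon> n))) \<longlonglongrightarrow> inv\<^bsub>G\<^esub> r"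
    using continuous_on_tendsto_compose[OF continuous_inv lim_r r] by (simp add: dirac_in inv_dirac)
  obtain F where un: "\<And>n. u n \<in> Lp p (lebesgue_on Q)" and u0: "u0 \<in> Lp_besic p A \<beta> Q"
    and F: "F \<in> Lp p (lebesgue_on Q \<Otimes>\<^sub>M \<beta>)" "AE x in lebesgue_on Q. (\<lambda>s. F (x, s)) \<in> gelfand1 p A \<beta> (u0 x)"
    and lim: "\<And>\<psi>. \<psi> \<in> test_space p A Q \<Longrightarrow> (\<lambda>n. LINT x|lebesgue_on Q. u n x * \<psi> x (x /\<^sub>R \<epsilon> n))
             \<longlonglongrightarrow> (LINT (x, s)|(lebesgue_on Q \<Otimes>\<^sub>M \<beta>). F (x, s) * gelfand (\<psi> x) s)"
    using conv unfolding weak_sigma_conv_def represents_hat_def by blast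
  have u0q: "u0 x \<in> besic_quot p A \<beta>" if "x \<in> Q" for x
    using u0 that by (auto simp: Lp_besic_def bochner_Lp_def)
  have part1: "\<exists>v0\<in>Lp_besic p A \<beta> Q'. \<forall>x\<in>Q'. \<forall>f\<in>gelfand1 p A \<beta> (u0 (x + t)).
              (\<lambda>s. f (s \<otimes>\<^bsub>G\<^esub> r)) \<in> gelfand1 p A \<beta> (v0 x)"
  proof (intro bexI ballI)
    show "(\<lambda>x. quot_shift p r (u0 (x + t))) \<in> Lp_besic p A \<beta> Q'"
      unfolding Lp_besic_def
      by (rule bochner_Lp_map[OF u0[unfolded Lp_besic_def] \<theta>])
         (rule quot_shift_in[OF p dl] quot_dist_shift[OF p dl] quot_norm_shift[OF p dl]; assumption)+
    fix x f assume "x \<in> Q'" and f: "f \<in> gelfand1 p A \<beta> (u0 (x + t))"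
    then have "x + t \<in> Q" by (auto simp: Q'_def)
    then show "(\<lambda>s. f (s \<otimes>\<^bsub>G\<^esub> r)) \<in> gelfand1 p A \<beta> (quot_shift p r (u0 (x + t)))"
      by (intro gelfand1_shift[OF p dl] u0q f)
  qed
  have part2: "weak_sigma_conv p A \<beta> Q' \<epsilon> v v0"
    if v0: "v0 \<in> Lp_besic p A \<beta> Q'"
      and hat: "AE x in lebesgue_on Q'. \<forall>f\<in>gelfand1 p A \<beta> (u0 (x + t)). (\<lambda>s. f (s \<otimes>\<^bsub>G\<^esub> r)) \<in> gelfand1 p A \<beta> (v0 x)" for v0
  proof -
    define \<Theta> where "\<Theta> = (\<lambda>(x, s). (x + t, s \<otimes>\<^bsub>G\<^esub> r))"
    define \<Theta>' where "\<Theta>' = (\<lambda>(x, s). (x - t, s \<otimes>\<^bsub>G\<^esub> inv\<^bsub>G\<^esub> r))"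
    have R: "(\<lambda>s. s \<otimes>\<^bsub>G\<^esub> r) \<in> \<beta> \<rightarrow>\<^sub>M \<beta>" "(\<lambda>s. s \<otimes>\<^bsub>G\<^esub> inv\<^bsub>G\<^esub> r) \<in> \<beta> \<rightarrow>\<^sub>M \<beta>"
      by (rule measurable_right_mult[OF r], rule measurable_right_mult[OF ir])
    have \<Theta>m: "\<Theta> \<in> lebesgue_on Q' \<Otimes>\<^sub>M \<beta> \<rightarrow>\<^sub>M lebesgue_on Q \<Otimes>\<^sub>M \<beta>"
      unfolding \<Theta>_def case_prod_beta
      by (intro measurable_Pair measurable_compose[OF measurable_fst \<theta>(1)] measurable_compose[OF measurable_snd R(1)])
    have \<Theta>'m: "\<Theta>' \<in> lebesgue_on Q \<Otimes>\<^sub>M \<beta> \<rightarrow>\<^sub>M lebesgue_on Q' \<Otimes>\<^sub>M \<beta>"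
      unfolding \<Theta>'_def case_prod_beta
      by (intro measurable_Pair measurable_compose[OF measurable_fst \<theta>'(1)] measurable_compose[OF measurable_snd R(2)])
    have \<Theta>d: "distr (lebesgue_on Q' \<Otimes>\<^sub>M \<beta>) (lebesgue_on Q \<Otimes>\<^sub>M \<beta>) \<Theta> = lebesgue_on Q \<Otimes>\<^sub>M \<beta>"
      using pair_measure_distr[OF \<theta>(1) R(1)] \<beta>.sigma_finite_measure_axioms
      unfolding \<Theta>_def distr_right_mult[OF dl] \<theta>(2) by simp
    have \<Theta>i: "\<Theta> (\<Theta>' y) = y" if "y \<in> space (lebesgue_on Q \<Otimes>\<^sub>M \<beta>)" for y
      using that r by (auto simp: \<Theta>_def \<Theta>'_def space_pair_measure space_beta mult_inv_cancel)
    have vn: "v n \<in> Lp p (lebesgue_on Q')" for n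
    proof -
      have "v n = (\<lambda>x. u n (x + t))" using v by blast
      then show ?thesis using Lp_distr(1)[OF \<theta>(2,1) un[of n]] by simp
    qed
    have F': "(\<lambda>z. F (\<Theta> z)) \<in> Lp p (lebesgue_on Q' \<Otimes>\<^sub>M \<beta>)" by (rule Lp_distr(1)[OF \<Theta>d \<Theta>m F(1)])
    have "AE x in lebesgue_on Q'. (\<lambda>s. F (x + t, s)) \<in> gelfand1 p A \<beta> (u0 (x + t))"
      by (rule AE_distrD[OF \<theta>(1)]) (unfold \<theta>(2), rule F(2))
    then have "AE x in lebesgue_on Q'. (\<lambda>s. F (x + t, s \<otimes>\<^bsub>G\<^esub> r)) \<in> gelfand1 p A \<beta> (v0 x)"
      using hat by eventually_elim (drule (1) bspec, simp)
    then have rep: "represents_hat p A \<beta> Q' v0 (\<lambda>z. F (\<Theta> z))"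
      unfolding represents_hat_def using F' by (simp add: \<Theta>_def)
    have lim': "(\<lambda>n. LINT x|lebesgue_on Q'. v n x * \<psi> x (x /\<^sub>R \<epsilon> n))
         \<longlonglongrightarrow> (LINT (x, s)|(lebesgue_on Q' \<Otimes>\<^sub>M \<beta>). F (\<Theta> (x, s)) * gelfand (\<psi> x) s)"
      if \<psi>: "\<psi> \<in> test_space p A Q'" for \<psi>
    proof -
      (* psi2 is the limit of the translated test functions, and g the error. *)
      define \<psi>2 where "\<psi>2 y = shift (inv\<^bsub>G\<^esub> r) (\<psi> (y - t))" for y
      have \<psi>A: "\<psi> (y - t) \<in> A" if "y \<in> Q" for y
        using test_space_strongly_measurable(2)[OF \<psi>] that by (simp add: Q'_def)
      have \<psi>2: "\<psi>2 \<in> test_space p A Q"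
        unfolding \<psi>2_def
      proof (rule test_space_subst[OF \<psi> \<theta>'])
        fix a b assume a: "a \<in> A" and b: "b \<in> A"
        show "shift (inv\<^bsub>G\<^esub> r) a \<in> A" by (rule shift_in[OF ir a])
        show "sup_norm (shift (inv\<^bsub>G\<^esub> r) a) = sup_norm a" by (rule sup_norm_shift[OF ir a])
        show "sup_dist (shift (inv\<^bsub>G\<^esub> r) a) (shift (inv\<^bsub>G\<^esub> r) b) = sup_dist a b"
          unfolding sup_dist_def shift_diff[OF ir a b, symmetric] by (rule sup_norm_shift[OF ir diff_in[OF a b]])
      qed
      define g where "g n y = \<psi> (y - t) ((y - t) /\<^sub>R \<epsilon> n) - \<psi>2 y (y /\<^sub>R \<epsilon> n)" for n y
      obtain H where H: "dual_weight p Q H" "AE y in lebesgue_on Q. sup_norm (\<psi>2 y) \<le> H y"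
        using test_space_weight[OF p \<psi>2] by blast
      have id: "(\<lambda>y. y) \<in> borel_measurable (lebesgue_on S)" for S :: "'a set"
        by (intro measurable_restrict_space1 measurable_completion) simp
      have m2: "(\<lambda>y. \<psi>2 y (y /\<^sub>R \<epsilon> n)) \<in> borel_measurable (lebesgue_on Q)" for n
        by (rule test_space_measurable[OF Q \<psi>2]) (intro borel_measurable_scaleR id borel_measurable_const)
      have "(\<lambda>x. \<psi> x (x /\<^sub>R \<epsilon> n)) \<in> borel_measurable (lebesgue_on Q')" for n
        by (rule test_space_measurable[OF Q' \<psi>]) (intro borel_measurable_scaleR id borel_measurable_const)
      then have m1: "(\<lambda>y. \<psi> (y - t) ((y - t) /\<^sub>R \<epsilon> n)) \<in> borel_measurable (lebesgue_on Q)" for n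
        by (rule measurable_compose[OF \<theta>'(1)])
      have gm: "g n \<in> borel_measurable (lebesgue_on Q)" for n
        unfolding g_def by (intro borel_measurable_diff m1 m2)
      have n2: "AE y in lebesgue_on Q. norm (\<psi>2 y (y /\<^sub>R \<epsilon> n)) \<le> H y" for n
        using H(2)
      proof (rule AE_mp[OF _ AE_I2], intro impI)
        fix y assume y: "y \<in> space (lebesgue_on Q)" and le: "sup_norm (\<psi>2 y) \<le> H y"
        then show "norm (\<psi>2 y (y /\<^sub>R \<epsilon> n)) \<le> H y"
          using norm_le_sup_norm[of "\<psi>2 y"] test_space_strongly_measurable(2)[OF \<psi>2, of y] by (auto intro: order_trans)
      qed
      have n1: "AE y in lebesgue_on Q. norm (g n y) \<le> 2 * H y" for n
        using H(2)
      proof (rule AE_mp[OF _ AE_I2], intro impI)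
        fix y assume y: "y \<in> space (lebesgue_on Q)" and le: "sup_norm (\<psi>2 y) \<le> H y"
        then have yQ: "y \<in> Q" by simp
        have "norm (\<psi> (y - t) ((y - t) /\<^sub>R \<epsilon> n)) \<le> sup_norm (\<psi>2 y)"
          unfolding \<psi>2_def sup_norm_shift[OF ir \<psi>A[OF yQ]] by (rule norm_le_sup_norm[OF \<psi>A[OF yQ]])
        moreover have "norm (\<psi>2 y (y /\<^sub>R \<epsilon> n)) \<le> sup_norm (\<psi>2 y)"
          by (rule norm_le_sup_norm[OF test_space_strongly_measurable(2)[OF \<psi>2 yQ]])
        ultimately show "norm (g n y) \<le> 2 * H y"
          using norm_triangle_ineq4[of "\<psi> (y - t) ((y - t) /\<^sub>R \<epsilon> n)" "\<psi>2 y (y /\<^sub>R \<epsilon> n)"] le unfolding g_def by linarith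
      qed
      have g0: "AE y in lebesgue_on Q. (\<lambda>n. g n y) \<longlonglongrightarrow> 0"
      proof (rule AE_I2)
        fix y assume "y \<in> space (lebesgue_on Q)"
        then have a: "\<psi> (y - t) \<in> A" by (simp add: \<psi>A)
        have "norm (g n y) \<le> sup_norm (\<lambda>z. \<psi> (y - t) (z + - (t /\<^sub>R \<epsilon> n)) - shift (inv\<^bsub>G\<^esub> r) (\<psi> (y - t)) z)" for n
          using norm_le_sup_norm[OF diff_in[OF translate_in[OF a] shift_in[OF ir a]], of "y /\<^sub>R \<epsilon> n" "- (t /\<^sub>R \<epsilon> n)"]
          by (simp add: g_def \<psi>2_def scaleR_diff_right)
        then show "(\<lambda>n. g n y) \<longlonglongrightarrow> 0"
          by (intro Lim_null_comparison[OF _ translate_tendsto_shift[OF ir lim_ir a]]) simp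
      qed
      have H2: "dual_weight p Q (\<lambda>y. 2 * H y)" by (rule dual_weight_scale[OF H(1)]) simp
      have small: "(\<lambda>n. LINT y|lebesgue_on Q. u n y * g n y) \<longlonglongrightarrow> 0"
      proof (rule null_oscillation_integral[OF p H2 un _ gm n1 g0])
        fix c :: "'a \<Rightarrow> complex" assume c: "c \<in> borel_measurable (lebesgue_on Q)" "\<And>y. norm (c y) \<le> 2 * H y"
        show "convergent (\<lambda>n. LINT y|lebesgue_on Q. u n y * c y)"
          using lim[OF dual_weight_test_function[OF p H2 c]] by (rule convergentI)
      qed
      have split: "(LINT x|lebesgue_on Q'. v n x * \<psi> x (x /\<^sub>R \<epsilon> n))
          = (LINT y|lebesgue_on Q. u n y * \<psi>2 y (y /\<^sub>R \<epsilon> n)) + (LINT y|lebesgue_on Q. u n y * g n y)" for n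
      proof -
        have "(LINT x|lebesgue_on Q'. v n x * \<psi> x (x /\<^sub>R \<epsilon> n))
            = (LINT x|lebesgue_on Q'. u n (x + t) * \<psi> ((x + t) - t) (((x + t) - t) /\<^sub>R \<epsilon> n))"
          by (simp add: v)
        also have "\<dots> = (LINT y|lebesgue_on Q. u n y * \<psi> (y - t) ((y - t) /\<^sub>R \<epsilon> n))"
          by (rule integral_iso[OF \<theta> \<theta>'(1), where f = "\<lambda>y. u n y * \<psi> (y - t) ((y - t) /\<^sub>R \<epsilon> n)"]) simp
        also have "\<dots> = (LINT y|lebesgue_on Q. u n y * \<psi>2 y (y /\<^sub>R \<epsilon> n) + u n y * g n y)"
          by (intro Bochner_Integration.integral_cong refl) (simp add: g_def algebra_simps)
        also have "\<dots> = (LINT y|lebesgue_on Q. u n y * \<psi>2 y (y /\<^sub>R \<epsilon> n)) + (LINT y|lebesgue_on Q. u n y * g n y)"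
          by (intro Bochner_Integration.integral_add dual_weight_mult_integrable[OF p H(1) un m2 n2]
              dual_weight_mult_integrable[OF p H2 un gm n1])
        finally show ?thesis .
      qed
      have "(LINT z|(lebesgue_on Q' \<Otimes>\<^sub>M \<beta>). F (\<Theta> z) * gelfand (\<psi> (fst z)) (snd z))
          = (LINT z|(lebesgue_on Q' \<Otimes>\<^sub>M \<beta>). F (\<Theta> z) * gelfand (\<psi>2 (fst (\<Theta> z))) (snd (\<Theta> z)))"
      proof (intro Bochner_Integration.integral_cong refl)
        fix z assume "z \<in> space (lebesgue_on Q' \<Otimes>\<^sub>M \<beta>)"
        then obtain x s where z: "z = (x, s)" "x \<in> Q'" "s \<in> spectrum A" by (auto simp: space_pair_measure space_beta)
        then have a: "\<psi> x \<in> A" using test_space_strongly_measurable(2)[OF \<psi>] by blast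
        have "(s \<otimes>\<^bsub>G\<^esub> r) (shift (inv\<^bsub>G\<^esub> r) (\<psi> x)) = s (\<psi> x)"
          using gelfand_shift[OF ir a mult_in_spectrum[OF z(3) r]] mult_inv_cancel(1)[OF z(3) r] by simp
        then show "F (\<Theta> z) * gelfand (\<psi> (fst z)) (snd z) = F (\<Theta> z) * gelfand (\<psi>2 (fst (\<Theta> z))) (snd (\<Theta> z))"
          by (simp add: z(1) \<Theta>_def \<psi>2_def gelfand_def)
      qed
      also have "\<dots> = (LINT z|(lebesgue_on Q \<Otimes>\<^sub>M \<beta>). F z * gelfand (\<psi>2 (fst z)) (snd z))"
        by (rule integral_iso[OF \<Theta>m \<Theta>d \<Theta>'m \<Theta>i, where f = "\<lambda>z. F z * gelfand (\<psi>2 (fst z)) (snd z)"])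
      finally have "(LINT (x, s)|(lebesgue_on Q' \<Otimes>\<^sub>M \<beta>). F (\<Theta> (x, s)) * gelfand (\<psi> x) s)
          = (LINT (x, s)|(lebesgue_on Q \<Otimes>\<^sub>M \<beta>). F (x, s) * gelfand (\<psi>2 x) s)"
        by (simp add: case_prod_beta')
      then show ?thesis unfolding split using tendsto_add[OF lim[OF \<psi>2] small] by simp
    qed
    show ?thesis unfolding weak_sigma_conv_def using vn v0 rep lim' by blast
  qed
  show ?thesis using part1 part2 unfolding Q'_def by blast
qed

end
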